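(* Let $g\in L^\infty(\mathbb{R}^2)$. Assume that for all $x\in\mathbb{R}^2$, $$g(x)=g(x^\perp).$$ Let $\psi\in L^\infty_{loc}(\mathbb{R}^2)$ solve $$\Delta\psi=g\quad\text{in }\mathbb{R}^2.$$ Then $$\sup_{x\in B_1(0)}\frac{|\nabla\psi(x)|}{|x|}<\infty.$$
   Context: For $x=(x_1,x_2)\in\mathbb{R}^2$, $x^\perp=(-x_2,x_1)$ denotes the rotation of $x$ by $\frac{\pi}{2}$, so the assumption on $g$ is four-fold rotational symmetry about the origin. $\Delta\psi=\frac{\partial^2\psi}{\partial x_1^2}+\frac{\partial^2\psi}{\partial x_2^2}$. $B_1(0)$ is the unit ball of $\mathbb{R}^2$ centered at the origin.
   Formalization: The bound is asserted only when ∇ψ(0)=0 (ψ taken as its C¹ representative, whose existence is proved); without this the claim fails, e.g. g=0, ψ(x)=x_1. The condition is necessary for the bound. The supremum omits x=0. *)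

theory Defs
  imports "HOL-Analysis.Analysis"
begin

text \<open>Elements of \<open>L\<^sup>\<infinity>\<close> and \<open>L\<^sup>\<infinity>\<^sub>l\<^sub>o\<^sub>c\<close> are given by arbitrary
  Lebesgue measurable representatives, so all bounds hold almost everywhere only.\<close>

definition Linfty :: "(real^'n \<Rightarrow> real) \<Rightarrow> bool" where
  "Linfty f \<longleftrightarrow> f \<in> borel_measurable lebesgue \<and> (\<exists>C. AE x in lebesgue. \<bar>f x\<bar> \<le> C)"

definition Linfty_loc :: "(real^'n \<Rightarrow> real) \<Rightarrow> bool" where
  "Linfty_loc f \<longleftrightarrow> f \<in> borel_measurable lebesgue \<and>
     (\<forall>K. compact K \<longrightarrow> (\<exists>C. AE x in lebesgue. x \<in> K \<longrightarrow> \<bar>f x\<bar> \<le> C))"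

definition perp :: "real^2 \<Rightarrow> real^2" where
  "perp x = vector [- x $ 2, x $ 1]"

definition partial_deriv :: "'n \<Rightarrow> (real^'n \<Rightarrow> real) \<Rightarrow> real^'n \<Rightarrow> real" where
  "partial_deriv i f x = frechet_derivative f (at x) (axis i 1)"

definition grad :: "(real^'n \<Rightarrow> real) \<Rightarrow> real^'n \<Rightarrow> real^'n" where
  "grad f x = (\<chi> i. partial_deriv i f x)"

definition laplacian :: "(real^'n \<Rightarrow> real) \<Rightarrow> real^'n \<Rightarrow> real" where
  "laplacian f x = (\<Sum>i\<in>UNIV. partial_deriv i (partial_deriv i f) x)"

primrec Ck :: "nat \<Rightarrow> (real^'n \<Rightarrow> real) \<Rightarrow> bool" where
  "Ck 0 f \<longleftrightarrow> continuous_on UNIV f"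
| "Ck (Suc k) f \<longleftrightarrow> f differentiable_on UNIV \<and> (\<forall>i. Ck k (partial_deriv i f))"

definition test_function :: "(real^'n \<Rightarrow> real) \<Rightarrow> bool" where
  "test_function \<phi> \<longleftrightarrow> (\<forall>k. Ck k \<phi>) \<and> compact (closure {x. \<phi> x \<noteq> 0})"

text \<open>The equation \<open>\<Delta>\<psi> = g\<close> on the whole space in the sense of distributions. It is meant for
  locally integrable \<open>\<psi>\<close> and \<open>g\<close>, for which both integrands are integrable.\<close>

definition solves_poisson :: "(real^'n \<Rightarrow> real) \<Rightarrow> (real^'n \<Rightarrow> real) \<Rightarrow> bool" where
  "solves_poisson \<psi> g \<longleftrightarrow> (\<forall>\<phi>. test_function \<phi> \<longrightarrow>
     (LINT x|lebesgue. \<psi> x * laplacian \<phi> x) = (LINT x|lebesgue. g x * \<phi> x))"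

text \<open>The gradient of a solution \<open>\<psi>\<close> is the classical gradient of its (unique) \<open>C\<^sup>1\<close>
  representative \<open>\<Psi>\<close>. A bound on \<open>\<bar>\<nabla>\<Psi>(x)\<bar> / \<bar>x\<bar>\<close> near the origin forces \<open>\<nabla>\<Psi>(0) = 0\<close>, and
  symmetry of \<open>g\<close> alone does not give this: for \<open>g = 0\<close> and \<open>\<psi>(x) = x\<^sub>1\<close> the quotient is
  \<open>1 / \<bar>x\<bar>\<close>. The bound is therefore asserted for the solutions with \<open>\<nabla>\<Psi>(0) = 0\<close>; these
  include all solutions with the symmetry \<open>\<psi>(x) = \<psi>(x\<^sup>\<bottom>)\<close>. The supremum
  omits the origin, where the quotient is undefined.\<close>

end

theory Submission
  imports Defs
begin

text \<open>
  The proof represents \<open>\<psi>\<close> by a parametrix. Let \<open>N\<close> be the function \<open>ln |x|\<^sup>2\<close> multiplied by a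
  smooth radial cutoff that is \<open>1\<close> for \<open>|x| \<le> 3\<close> and \<open>0\<close> for \<open>|x| \<ge> 4\<close>. Then
  \<open>\<Delta>N = 4 c \<delta> + h\<close>, where \<open>h\<close> is smooth and supported in \<open>3 \<le> |x| \<le> 4\<close> and \<open>c\<close> is the integral of
  \<open>1/(1 + |x|\<^sup>2)\<^sup>2\<close> (that is, \<open>\<pi>\<close>, but only \<open>c > 0\<close> matters). Convolving \<open>\<Delta>\<psi> = g\<close> with
  \<open>N\<close> gives \<open>4 c \<psi> = N * g - h * \<psi>\<close> almost everywhere; the right-hand side over \<open>4 c\<close> is the representative
  \<open>\<Psi>\<close>. To avoid the singularity, the equation is tested with the smooth functions
  obtained from \<open>N\<close> on replacing \<open>|x|\<^sup>2\<close> by \<open>|x|\<^sup>2 + e\<close> (\<open>parametrix_identity\<close>). Their Laplacian is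
  an approximate identity plus a regularised \<open>h\<close>; letting \<open>e\<close> tend to \<open>0\<close> against continuous
  functions of compact support gives \<open>regular_rep_AE\<close>. Regularity of \<open>\<Psi>\<close> is then visible: \<open>h * \<psi>\<close> is
  as smooth as \<open>h\<close> (\<open>Ck_conv\<close>), and \<open>N * g\<close> is of class \<open>C\<^sup>1\<close> because \<open>\<nabla>N\<close> is integrable and
  \<open>g\<close> bounded (\<open>conv_C1_singular_kernel\<close>).

  For the bound, \<open>\<nabla>\<Psi>(x) - \<nabla>\<Psi>(0)\<close> must be \<open>O(|x|)\<close>. The part \<open>h * \<psi>\<close> is of class \<open>C\<^sup>2\<close> and
  harmless. For \<open>K = \<nabla>N\<close>, which is \<open>2 x / |x|\<^sup>2\<close> near the origin, split \<open>g\<close> into three pieces.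
  Where \<open>|y| \<le> 2|x|\<close>, the bound \<open>|K(z)| \<le> C / |z|\<close> suffices (\<open>near_part_bound\<close>). Where \<open>|y| > 2\<close>,
  the argument of \<open>K\<close> stays away from the singularity (\<open>far_part_Lipschitz\<close>). On
  the annulus \<open>2|x| < |y| \<le> 2\<close> boundedness of \<open>g\<close> alone would only yield \<open>|x| ln (1/|x|)\<close>. Here the symmetry
  enters (\<open>annulus_part_bound\<close>): since \<open>g\<close> is invariant under rotation by a right angle, \<open>K(x - y)\<close> may be
  averaged over the four rotations of \<open>y\<close>. In complex notation \<open>K\<close> is the conjugate of \<open>2/z\<close>, and the
  four terms \<open>1/(z - \<i>\<^sup>j w)\<close> add up to \<open>4 z\<^sup>3 / (z\<^sup>4 - w\<^sup>4)\<close>. So the averaged kernel is \<open>O(|x|\<^sup>3 / |y|\<^sup>4)\<close>,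
  whose integral over \<open>|y| > 2|x|\<close> is \<open>O(|x|)\<close>.
\<close>

section \<open>Smooth functions of one real variable and a smooth cutoff\<close>

text \<open>One-variable counterpart of \<open>Ck\<close> on a set \<open>U\<close>, used with \<open>U\<close> open. The derivative is existentially
  quantified rather than fixed as \<open>deriv f\<close>, so that closure properties need no computation of \<open>deriv\<close>.\<close>

primrec Ck_on :: "nat \<Rightarrow> real set \<Rightarrow> (real \<Rightarrow> real) \<Rightarrow> bool" where
  "Ck_on 0 U f \<longleftrightarrow> continuous_on U f"
| "Ck_on (Suc k) U f \<longleftrightarrow> (\<exists>f'. (\<forall>t\<in>U. (f has_real_derivative f' t) (at t)) \<and> Ck_on k U f')"

lemma Ck_on_cong:
  assumes "open U" "\<And>t. t \<in> U \<Longrightarrow> f t = g t" "Ck_on k U f"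
  shows "Ck_on k U g"
proof (cases k)
  case 0
  then show ?thesis using assms by (simp cong: continuous_on_cong)
next
  case (Suc m)
  then obtain f' where f': "\<forall>t\<in>U. (f has_real_derivative f' t) (at t)" "Ck_on m U f'"
    using assms(3) by auto
  have "(g has_real_derivative f' t) (at t)" if "t \<in> U" for t
    using has_field_derivative_transform_within_open[of f "f' t" t U g] f' that assms by auto
  then show ?thesis using f' Suc by auto
qed

lemma Ck_on_Suc_imp: "Ck_on (Suc k) U f \<Longrightarrow> Ck_on k U f"
proof (induction k arbitrary: f)
  case 0
  then show ?case by (auto intro!: continuous_at_imp_continuous_on intro: DERIV_isCont)
next
  case (Suc k)
  then show ?case by (metis Ck_on.simps(2))
qed

lemma Ck_on_subset: "Ck_on k U f \<Longrightarrow> V \<subseteq> U \<Longrightarrow> Ck_on k V f"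
  by (induction k arbitrary: f) (use continuous_on_subset in \<open>auto, blast\<close>)

lemma Ck_on_deriv:
  assumes "open U" "Ck_on (Suc k) U f"
  shows "\<forall>t\<in>U. (f has_real_derivative deriv f t) (at t)" "Ck_on k U (deriv f)"
proof -
  obtain f' where f': "\<forall>t\<in>U. (f has_real_derivative f' t) (at t)" "Ck_on k U f'"
    using assms by auto
  then have eq: "deriv f t = f' t" if "t \<in> U" for t
    using that DERIV_imp_deriv by blast
  then show "\<forall>t\<in>U. (f has_real_derivative deriv f t) (at t)" using f' by auto
  show "Ck_on k U (deriv f)" using Ck_on_cong[OF assms(1) _ f'(2)] eq by auto
qed

lemma Ck_on_const: "Ck_on k U (\<lambda>t. c)"
proof (induction k arbitrary: c)
  case (Suc k)
  then show ?case by (auto intro!: exI[of _ "\<lambda>t. 0"])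
qed auto

lemma Ck_on_ident: "Ck_on k U (\<lambda>t. t)"
proof (cases k)
  case (Suc m)
  then show ?thesis by (auto intro!: exI[of _ "\<lambda>t. 1"] Ck_on_const)
qed auto

lemma Ck_on_add: "Ck_on k U f \<Longrightarrow> Ck_on k U g \<Longrightarrow> Ck_on k U (\<lambda>t. f t + g t)"
proof (induction k arbitrary: f g)
  case (Suc k)
  then obtain f' g' where "\<forall>t\<in>U. (f has_real_derivative f' t) (at t)" "Ck_on k U f'"
    "\<forall>t\<in>U. (g has_real_derivative g' t) (at t)" "Ck_on k U g'" by auto
  then show ?case using Suc.IH[of f' g']
    by (auto intro!: exI[of _ "\<lambda>t. f' t + g' t"] DERIV_add)
qed (auto intro: continuous_on_add)

lemma Ck_on_mult: "Ck_on k U f \<Longrightarrow> Ck_on k U g \<Longrightarrow> Ck_on k U (\<lambda>t. f t * g t)"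
proof (induction k arbitrary: f g)
  case (Suc k)
  then obtain f' g' where d: "\<forall>t\<in>U. (f has_real_derivative f' t) (at t)" "Ck_on k U f'"
    "\<forall>t\<in>U. (g has_real_derivative g' t) (at t)" "Ck_on k U g'" by auto
  have "Ck_on k U (\<lambda>t. f' t * g t + g' t * f t)"
    using Suc.prems[THEN Ck_on_Suc_imp] d by (intro Ck_on_add Suc.IH)
  then show ?case using d
    by (auto intro!: exI[of _ "\<lambda>t. f' t * g t + g' t * f t"] DERIV_mult)
qed (auto intro: continuous_on_mult)

lemma Ck_on_inverse:
  "Ck_on k U f \<Longrightarrow> (\<And>t. t \<in> U \<Longrightarrow> f t \<noteq> 0) \<Longrightarrow> Ck_on k U (\<lambda>t. inverse (f t))"
proof (induction k arbitrary: f)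
  case (Suc k)
  then obtain f' where d: "\<forall>t\<in>U. (f has_real_derivative f' t) (at t)" "Ck_on k U f'"
    by auto
  have "Ck_on k U (\<lambda>t. inverse (f t))"
    using Suc.prems Ck_on_Suc_imp by (intro Suc.IH) auto
  then have "Ck_on k U (\<lambda>t. (-1) * (inverse (f t) * f' t * inverse (f t)))"
    using d by (intro Ck_on_mult Ck_on_const)
  moreover have "((\<lambda>t. inverse (f t)) has_real_derivative (-1) * (inverse (f t) * f' t * inverse (f t))) (at t)"
    if "t \<in> U" for t
    using d Suc.prems that by (auto intro!: derivative_eq_intros)
  ultimately show ?case by (auto intro!: exI[of _ "\<lambda>t. (-1) * (inverse (f t) * f' t * inverse (f t))"])
qed (auto intro: continuous_on_inverse)

lemma Ck_on_affine: "Ck_on k UNIV f \<Longrightarrow> Ck_on k UNIV (\<lambda>t. f (a * t + b))"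
proof (induction k arbitrary: f)
  case 0
  then have "continuous_on UNIV f" by simp
  then show ?case by (auto intro!: continuous_on_compose2[of UNIV f] continuous_intros)
next
  case (Suc k)
  then obtain f' where d: "\<forall>t. (f has_real_derivative f' t) (at t)" "Ck_on k UNIV f'"
    by auto
  have "((\<lambda>t. f (a * t + b)) has_real_derivative f' (a * t + b) * a) (at t)" for t
    by (rule DERIV_chain2[where f=f]) (auto intro!: derivative_eq_intros d(1)[rule_format])
  then show ?case using Ck_on_mult[OF Suc.IH[OF d(2)] Ck_on_const, of a]
    by (auto intro!: exI[of _ "\<lambda>t. f' (a * t + b) * a"])
qed

lemma Ck_on_ln: "U \<subseteq> {0<..} \<Longrightarrow> Ck_on k U ln"
proof (cases k)
  case 0
  assume "U \<subseteq> {0<..}"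
  then show ?thesis using 0 by (auto intro!: continuous_intros)
next
  case (Suc m)
  assume U: "U \<subseteq> {0<..}"
  then have "Ck_on m U (\<lambda>t. inverse t)" by (intro Ck_on_inverse Ck_on_ident) auto
  moreover have "\<forall>t\<in>U. (ln has_real_derivative inverse t) (at t)"
    using U by (auto intro!: derivative_eq_intros simp: field_simps)
  ultimately show ?thesis using Suc by (auto simp del: inverse_eq_divide)
qed

lemma Ck_on_Un:
  assumes "open U" "open V" "Ck_on k U f" "Ck_on k V f"
  shows "Ck_on k (U \<union> V) f"
  using assms(3,4)
proof (induction k arbitrary: f)
  case 0
  then show ?case using assms by (auto intro: continuous_on_open_Un)
next
  case (Suc k)
  from Ck_on_deriv[OF assms(1) Suc.prems(1)] Ck_on_deriv[OF assms(2) Suc.prems(2)]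
  show ?case using Suc.IH by (auto intro!: exI[of _ "deriv f"])
qed

text \<open>The functions \<open>p(1/t) exp(-1/t)\<close>, extended by \<open>0\<close> to \<open>t \<le> 0\<close>, with \<open>p\<close> a polynomial. This family
  contains the standard flat function (\<open>p = 1\<close>) and is closed under differentiation, which makes smoothness at
  \<open>0\<close> an induction.\<close>

definition flat :: "real poly \<Rightarrow> real \<Rightarrow> real" where
  "flat p t = (if t > 0 then poly p (1 / t) * exp (- (1 / t)) else 0)"

lemma poly_times_exp_minus_tendsto_0: "((\<lambda>u. poly p u * exp (- u)) \<longlongrightarrow> (0::real)) at_top"
proof -
  have "((\<lambda>u. \<Sum>i\<le>degree p. coeff p i * (u ^ i / exp u)) \<longlongrightarrow> (\<Sum>i\<le>degree p. coeff p i * 0)) at_top"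
    by (intro tendsto_sum tendsto_mult tendsto_const tendsto_power_div_exp_0)
  then show ?thesis
    by (simp add: poly_altdef exp_minus divide_inverse sum_distrib_right mult.assoc)
qed

text \<open>For \<open>t > 0\<close> the chain rule gives \<open>(1/t)\<^sup>2 (p - p')(1/t) exp(-1/t)\<close>; the factor \<open>(1/t)\<^sup>2\<close> is the
  polynomial \<open>[:0,0,1:]\<close> at \<open>1/t\<close>. At \<open>t = 0\<close> the exponential beats every polynomial.\<close>

lemma flat_deriv: "(flat p has_real_derivative flat ([:0,0,1:] * (p - pderiv p)) t) (at t)"
proof -
  consider "t > 0" | "t < 0" | "t = 0" by linarith
  then show ?thesis
  proof cases
    case 1
    have "((\<lambda>t. poly p (1 / t) * exp (- (1 / t))) has_real_derivative flat ([:0,0,1:] * (p - pderiv p)) t) (at t)"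
      using 1 by (auto intro!: derivative_eq_intros poly_DERIV[THEN DERIV_chain2] simp: flat_def divide_simps power2_eq_square)
        (simp add: algebra_simps)
    then show ?thesis
      by (rule has_field_derivative_transform_within_open[where S="{0<..}"]) (use 1 in \<open>auto simp: flat_def\<close>)
  next
    case 2
    have "((\<lambda>t. 0) has_real_derivative flat ([:0,0,1:] * (p - pderiv p)) t) (at t)"
      using 2 by (auto simp: flat_def)
    then show ?thesis
      by (rule has_field_derivative_transform_within_open[where S="{..<0}"]) (use 2 in \<open>auto simp: flat_def\<close>)
  next
    case 3
    have R: "((\<lambda>t. flat p t / t) \<longlongrightarrow> 0) (at_right 0)"
    proof -
      have "((\<lambda>u. poly ([:0,1:] * p) u * exp (- u)) \<longlongrightarrow> 0) at_top"
        by (rule poly_times_exp_minus_tendsto_0)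
      then have "((\<lambda>t. poly ([:0,1:] * p) (inverse t) * exp (- inverse t)) \<longlongrightarrow> 0) (at_right 0)"
        by (rule filterlim_compose) (rule filterlim_inverse_at_top_right)
      then show ?thesis
        by (rule Lim_transform_eventually)
          (auto simp: eventually_at_right_field flat_def field_simps intro!: exI[of _ 1])
    qed
    have L: "((\<lambda>t. flat p t / t) \<longlongrightarrow> 0) (at_left 0)"
      by (rule Lim_transform_eventually[OF tendsto_const])
        (auto simp: eventually_at_left_field flat_def intro!: exI[of _ "-1"])
    have "((\<lambda>t. flat p t / t) \<longlongrightarrow> 0) (at 0)"
      using L R filterlim_split_at by blast
    then show ?thesis using 3
      by (simp add: has_field_derivative_iff flat_def)
  qed
qed

lemma Ck_on_flat: "Ck_on k UNIV (flat p)"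
proof (induction k arbitrary: p)
  case 0
  then show ?case using flat_deriv by (auto intro!: continuous_at_imp_continuous_on DERIV_isCont)
next
  case (Suc k)
  then show ?case using flat_deriv by auto
qed

text \<open>The switching points \<open>9 = 3\<^sup>2\<close> and \<open>16 = 4\<^sup>2\<close> are meant for the argument \<open>|x|\<^sup>2\<close>: for \<open>|x| < 1\<close>
  and \<open>|y| \<le> 2\<close> the point \<open>x - y\<close> lies where the cutoff is \<open>1\<close>. The inner arguments have the form \<open>a * t + b\<close>
  of \<open>Ck_on_affine\<close>.\<close>

definition cutoff :: "real \<Rightarrow> real" where
  "cutoff t = flat 1 ((-1) * t + 16) * inverse (flat 1 ((-1) * t + 16) + flat 1 (1 * t + (-9)))"

lemma cutoff_denom_pos: "flat 1 ((-1) * t + 16) + flat 1 (1 * t + (-9)) > 0"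
proof -
  have "flat 1 ((-1) * t + 16) \<ge> 0" "flat 1 (1 * t + (-9)) \<ge> 0"
    "t < 16 \<Longrightarrow> flat 1 ((-1) * t + 16) > 0" "t > 9 \<Longrightarrow> flat 1 (1 * t + (-9)) > 0"
    by (auto simp: flat_def)
  then show ?thesis by (smt (verit))
qed

lemma Ck_on_cutoff: "Ck_on k UNIV cutoff"
  unfolding cutoff_def[abs_def]
  by (intro Ck_on_mult Ck_on_inverse Ck_on_add Ck_on_affine Ck_on_flat)
    (metis cutoff_denom_pos less_irrefl)

lemma cutoff_eq_1: "t \<le> 9 \<Longrightarrow> cutoff t = 1"
  using cutoff_denom_pos[of t] by (auto simp: cutoff_def flat_def)

lemma cutoff_eq_0: "t \<ge> 16 \<Longrightarrow> cutoff t = 0"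
  by (auto simp: cutoff_def flat_def)

text \<open>Profile of the parametrix as a function of \<open>t = |x|\<^sup>2\<close>. In the plane the Laplacian of \<open>F(|x|\<^sup>2)\<close> is
  \<open>4 F'(t) + 4 t F''(t)\<close>, which vanishes for \<open>F = ln\<close>.\<close>

definition cut_ln :: "real \<Rightarrow> real" where
  "cut_ln t = cutoff t * ln t"

abbreviation cut_ln' where "cut_ln' \<equiv> deriv cut_ln"
abbreviation cut_ln'' where "cut_ln'' \<equiv> deriv (deriv cut_ln)"

text \<open>The Laplacian of the profile away from the origin. The value \<open>0\<close> for \<open>t \<le> 1\<close> agrees with the formula
  on \<open>0 < t \<le> 1\<close> and removes the default values of the derivatives at \<open>t \<le> 0\<close>, so that
  the function is smooth on the whole line.\<close>

definition lap_rest :: "real \<Rightarrow> real" where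
  "lap_rest t = (if t \<le> 1 then 0 else 4 * cut_ln' t + 4 * t * cut_ln'' t)"

lemma Ck_on_cut_ln: "Ck_on k {0<..} cut_ln"
  unfolding cut_ln_def[abs_def]
  by (intro Ck_on_mult Ck_on_ln Ck_on_subset[OF Ck_on_cutoff]) auto

lemma Ck_on_cut_ln': "Ck_on k {0<..} cut_ln'"
  by (rule Ck_on_deriv(2)[OF _ Ck_on_cut_ln]) auto

lemma Ck_on_cut_ln'': "Ck_on k {0<..} cut_ln''"
  by (rule Ck_on_deriv(2)[OF _ Ck_on_cut_ln']) auto

lemma deriv_cut_ln: "t > 0 \<Longrightarrow> (cut_ln has_real_derivative cut_ln' t) (at t)"
  using Ck_on_deriv(1)[OF _ Ck_on_cut_ln] by auto

lemma deriv_cut_ln': "t > 0 \<Longrightarrow> (cut_ln' has_real_derivative cut_ln'' t) (at t)"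
  using Ck_on_deriv(1)[OF _ Ck_on_cut_ln'] by auto

lemma cut_ln_small:
  assumes "0 < t" "t < 9"
  shows "cut_ln t = ln t" "cut_ln' t = 1 / t" "cut_ln'' t = - (1 / t\<^sup>2)"
proof -
  show "cut_ln t = ln t" using assms by (simp add: cut_ln_def cutoff_eq_1)
  have d: "cut_ln' u = 1 / u" if "0 < u" "u < 9" for u
  proof (rule DERIV_imp_deriv, rule has_field_derivative_transform_within_open[where f=ln and S="{0<..<9}"])
    show "(ln has_real_derivative 1 / u) (at u)" using that by (auto intro!: derivative_eq_intros)
  qed (use that in \<open>auto simp: cut_ln_def cutoff_eq_1\<close>)
  show "cut_ln' t = 1 / t" using d assms by blast
  show "cut_ln'' t = - (1 / t\<^sup>2)"
  proof (rule DERIV_imp_deriv, rule has_field_derivative_transform_within_open[where f="\<lambda>u. 1 / u" and S="{0<..<9}"])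
    show "((\<lambda>u. 1 / u) has_real_derivative - (1 / t\<^sup>2)) (at t)"
      using assms by (auto intro!: derivative_eq_intros simp: power2_eq_square)
  qed (use assms d in auto)
qed

lemma cut_ln_large:
  assumes "t > 16"
  shows "cut_ln t = 0" "cut_ln' t = 0" "cut_ln'' t = 0"
proof -
  show "cut_ln t = 0" using assms by (simp add: cut_ln_def cutoff_eq_0)
  have d: "cut_ln' u = 0" if "16 < u" for u
    by (rule DERIV_imp_deriv, rule has_field_derivative_transform_within_open[where f="\<lambda>_. 0" and S="{16<..}"])
      (use that in \<open>auto simp: cut_ln_def cutoff_eq_0\<close>)
  show "cut_ln' t = 0" using d assms by blast
  show "cut_ln'' t = 0"
    by (rule DERIV_imp_deriv, rule has_field_derivative_transform_within_open[where f="\<lambda>_. 0" and S="{16<..}"])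
      (use assms d in auto)
qed

lemma lap_rest_eq: "t > 0 \<Longrightarrow> lap_rest t = 4 * cut_ln' t + 4 * t * cut_ln'' t"
  by (auto simp: lap_rest_def cut_ln_small power2_eq_square)

lemma lap_rest_small: "t < 9 \<Longrightarrow> lap_rest t = 0"
  using lap_rest_eq[of t] by (cases "t \<le> 0") (auto simp: lap_rest_def cut_ln_small power2_eq_square)

lemma lap_rest_large: "t > 16 \<Longrightarrow> lap_rest t = 0"
  by (auto simp: lap_rest_def cut_ln_large)

lemma Ck_on_lap_rest: "Ck_on k UNIV lap_rest"
proof -
  have 1: "Ck_on k {0<..} lap_rest"
    by (rule Ck_on_cong[where f="\<lambda>t. 4 * cut_ln' t + 4 * t * cut_ln'' t"])
      (auto simp: lap_rest_eq intro!: Ck_on_add Ck_on_mult Ck_on_const Ck_on_ident Ck_on_cut_ln' Ck_on_cut_ln'')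
  have 2: "Ck_on k {..<9} lap_rest"
    by (rule Ck_on_cong[where f="\<lambda>t. 0"]) (auto simp: lap_rest_small Ck_on_const)
  have "{0<..} \<union> {..<9} = (UNIV :: real set)" by auto
  then show ?thesis using Ck_on_Un[OF _ _ 1 2] by simp
qed

text \<open>On the remaining interval \<open>[8, 16]\<close> continuity and compactness give a bound.\<close>

lemma bounded_from_pieces:
  fixes f :: "real \<Rightarrow> real"
  assumes "continuous_on {0<..} f" "\<And>t. t > 16 \<Longrightarrow> f t = 0" "\<And>t. 0 < t \<Longrightarrow> t < 9 \<Longrightarrow> \<bar>f t\<bar> \<le> M"
  obtains C where "C > 0" "\<And>t. t > 0 \<Longrightarrow> \<bar>f t\<bar> \<le> C"
proof -
  have "compact (f ` {8..16})"
    by (intro compact_continuous_image continuous_on_subset[OF assms(1)]) auto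
  then obtain B where B: "\<And>t. t \<in> {8..16} \<Longrightarrow> \<bar>f t\<bar> \<le> B"
    using compact_imp_bounded[of "f ` {8..16}"] by (force simp: bounded_iff)
  have "\<bar>f t\<bar> \<le> max 1 (max M B)" if "t > 0" for t
    using assms(2)[of t] assms(3)[of t] B[of t] that by (cases "t < 9"; cases "t > 16") (auto simp: le_max_iff_disj)
  then show ?thesis by (intro that[of "max 1 (max M B)"]) auto
qed

text \<open>The weights are those of \<open>ln\<close>, \<open>1/t\<close> and \<open>1/t\<^sup>2\<close> at \<open>0\<close>, except that the logarithm is
  bounded by \<open>1/\<surd>t\<close>, so that all singularities in the plane are controlled by \<open>1/|x|\<close>.\<close>

lemma cut_ln_bounds:
  obtains C where "C > 0" "\<And>t. t > 0 \<Longrightarrow> \<bar>cut_ln t\<bar> \<le> C / sqrt t"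
    "\<And>t. t > 0 \<Longrightarrow> \<bar>cut_ln' t\<bar> \<le> C / t" "\<And>t. t > 0 \<Longrightarrow> \<bar>cut_ln'' t\<bar> \<le> C / t\<^sup>2"
    "\<And>t. \<bar>lap_rest t\<bar> \<le> C"
proof -
  have c: "continuous_on {0<..} cut_ln" "continuous_on {0<..} cut_ln'" "continuous_on {0<..} cut_ln''"
    using Ck_on_cut_ln[of 0] Ck_on_cut_ln'[of 0] Ck_on_cut_ln''[of 0] by simp_all
  \<comment> \<open>\<open>27 = \<surd>9 * 9\<close> bounds the part \<open>t \<ge> 1\<close>; the part \<open>t < 1\<close> is bounded by \<open>2\<close>.\<close>
  have "\<bar>sqrt t * ln t\<bar> \<le> 27" if t: "0 < t" "t < 9" for t :: real
  proof (cases "t \<ge> 1")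
    case True
    have "ln t \<le> t - 1" using t ln_le_minus_one by blast
    moreover have "sqrt t \<le> sqrt 9" using t by (intro real_sqrt_le_mono) auto
    moreover have "sqrt 9 = (3::real)" by (simp add: real_sqrt_unique)
    moreover have "0 \<le> ln t" "0 \<le> sqrt t" using True by auto
    ultimately have "sqrt t * ln t \<le> 3 * 9" using t by (intro mult_mono) auto
    then show ?thesis using \<open>0 \<le> ln t\<close> t by auto
  next
    case False
    have "ln (1 / sqrt t) \<le> 1 / sqrt t - 1" using t by (intro ln_le_minus_one) auto
    then have "- ln t / 2 \<le> 1 / sqrt t" using t by (simp add: ln_div ln_sqrt)
    then have "sqrt t * (- ln t) \<le> sqrt t * (2 / sqrt t)" using t by (intro mult_left_mono) auto
    moreover have "ln t \<le> 0" using t False by auto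
    then have "\<bar>sqrt t * ln t\<bar> = sqrt t * (- ln t)" using t by (simp add: abs_mult)
    ultimately show ?thesis using t by simp
  qed
  then have s: "\<bar>sqrt t * cut_ln t\<bar> \<le> 27" if "0 < t" "t < 9" for t
    using that by (simp add: cut_ln_small)
  obtain C0 where C0: "C0 > 0" "\<And>t. t > 0 \<Longrightarrow> \<bar>sqrt t * cut_ln t\<bar> \<le> C0"
    by (rule bounded_from_pieces[of "\<lambda>t. sqrt t * cut_ln t" 27])
      (use c s in \<open>auto intro!: continuous_on_mult continuous_intros simp: cut_ln_large\<close>)
  obtain C1 where C1: "C1 > 0" "\<And>t. t > 0 \<Longrightarrow> \<bar>t * cut_ln' t\<bar> \<le> C1"
    by (rule bounded_from_pieces[of "\<lambda>t. t * cut_ln' t" 1])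
      (use c in \<open>auto intro!: continuous_on_mult simp: cut_ln_small cut_ln_large\<close>)
  obtain C2 where C2: "C2 > 0" "\<And>t. t > 0 \<Longrightarrow> \<bar>t\<^sup>2 * cut_ln'' t\<bar> \<le> C2"
    by (rule bounded_from_pieces[of "\<lambda>t. t\<^sup>2 * cut_ln'' t" 1])
      (use c in \<open>auto intro!: continuous_on_mult continuous_intros simp: cut_ln_small cut_ln_large\<close>)
  obtain C3 where C3: "C3 > 0" "\<And>t. t > 0 \<Longrightarrow> \<bar>lap_rest t\<bar> \<le> C3"
    by (rule bounded_from_pieces[of lap_rest 0])
      (use Ck_on_subset[OF Ck_on_lap_rest[of 0]] in \<open>auto simp: lap_rest_small lap_rest_large\<close>)
  let ?C = "C0 + C1 + C2 + C3"
  show ?thesis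
  proof (rule that[of ?C])
    show "?C > 0" using C0 C1 C2 C3 by auto
    fix t :: real
    show "\<bar>lap_rest t\<bar> \<le> ?C"
      using C3(2)[of t] lap_rest_small[of t] C0 C1 C2 C3(1) by (cases "t > 0") auto
    assume t: "t > 0"
    have "\<bar>cut_ln t\<bar> \<le> C0 / sqrt t" using C0(2)[OF t] t by (simp add: abs_mult field_simps)
    also have "\<dots> \<le> ?C / sqrt t" using C0 C1 C2 C3 t by (intro divide_right_mono) auto
    finally show "\<bar>cut_ln t\<bar> \<le> ?C / sqrt t" .
    have "\<bar>cut_ln' t\<bar> \<le> C1 / t" using C1(2)[OF t] t by (simp add: abs_mult field_simps)
    also have "\<dots> \<le> ?C / t" using C0 C1 C2 C3 t by (intro divide_right_mono) auto
    finally show "\<bar>cut_ln' t\<bar> \<le> ?C / t" .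
    have "\<bar>cut_ln'' t\<bar> \<le> C2 / t\<^sup>2" using C2(2)[OF t] t by (simp add: abs_mult field_simps)
    also have "\<dots> \<le> ?C / t\<^sup>2" using C0 C1 C2 C3 t by (intro divide_right_mono) auto
    finally show "\<bar>cut_ln'' t\<bar> \<le> ?C / t\<^sup>2" .
  qed
qed

section \<open>Functions of class C^k and radial functions\<close>

lemma partial_deriv_eqI:
  "(f has_derivative f') (at x) \<Longrightarrow> partial_deriv i f x = f' (axis i 1)"
  unfolding partial_deriv_def by (metis frechet_derivative_at)

lemma has_derivative_partial_deriv:
  fixes f :: "real^'n \<Rightarrow> real"
  assumes "f differentiable (at x)"
  shows "(f has_derivative (\<lambda>h. \<Sum>i\<in>UNIV. h $ i * partial_deriv i f x)) (at x)"
proof -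
  let ?D = "frechet_derivative f (at x)"
  have D: "(f has_derivative ?D) (at x)" using assms frechet_derivative_works by blast
  then interpret linear ?D by (rule has_derivative_linear)
  have "?D h = (\<Sum>i\<in>UNIV. h $ i * partial_deriv i f x)" for h
  proof -
    have "?D h = ?D (\<Sum>i\<in>UNIV. h $ i *s axis i 1)" by (simp add: basis_expansion)
    also have "\<dots> = (\<Sum>i\<in>UNIV. ?D (h $ i *\<^sub>R axis i 1))" by (simp add: sum scalar_mult_eq_scaleR)
    finally show ?thesis by (simp add: scale partial_deriv_def)
  qed
  then have "?D = (\<lambda>h. \<Sum>i\<in>UNIV. h $ i * partial_deriv i f x)" by (rule ext)
  then show ?thesis using D by simp
qed

text \<open>Proving \<open>Ck\<close> by exhibiting candidates for the partial derivatives avoids working with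
  \<open>frechet_derivative\<close>.\<close>

lemma Ck_SucI:
  fixes f :: "real^'n \<Rightarrow> real"
  assumes "\<And>x. (f has_derivative (\<lambda>h. \<Sum>i\<in>UNIV. h $ i * d i x)) (at x)" "\<And>i. Ck k (d i)"
  shows "Ck (Suc k) f" "partial_deriv i f = d i"
proof -
  have p: "partial_deriv i f = d i" for i
  proof
    fix x
    have "partial_deriv i f x = (\<Sum>j\<in>UNIV. axis i 1 $ j * d j x)"
      by (rule partial_deriv_eqI[OF assms(1)])
    also have "\<dots> = (\<Sum>j\<in>UNIV. if j = i then d j x else 0)"
      by (rule sum.cong) (auto simp: axis_def)
    finally show "partial_deriv i f x = d i x" by simp
  qed
  then show "partial_deriv i f = d i" by blast
  have "f differentiable (at x)" for x using assms(1) differentiable_def by blast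
  then show "Ck (Suc k) f"
    using assms(2) p by (simp add: differentiable_on_def)
qed

lemma Ck_has_derivative:
  fixes f :: "real^'n \<Rightarrow> real"
  shows "Ck (Suc k) f \<Longrightarrow> (f has_derivative (\<lambda>h. \<Sum>i\<in>UNIV. h $ i * partial_deriv i f x)) (at x)"
  by (rule has_derivative_partial_deriv) (simp add: differentiable_on_def)

lemma Ck_Suc_imp: "Ck (Suc k) f \<Longrightarrow> Ck k f"
proof (induction k arbitrary: f)
  case 0
  then show ?case by (simp add: differentiable_imp_continuous_on)
qed auto

lemma Ck_mono:
  assumes "Ck k f" "m \<le> k"
  shows "Ck m f"
  using assms(2,1) by (induction rule: inc_induct) (auto dest: Ck_Suc_imp simp del: Ck.simps)

lemma Ck_imp_continuous: "Ck k f \<Longrightarrow> continuous_on UNIV f"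
  using Ck_mono[of k f 0] by simp

lemma Ck_const: "Ck k (\<lambda>x. c)"
proof (induction k arbitrary: c)
  case (Suc k)
  show ?case by (rule Ck_SucI(1)[where d="\<lambda>_ _. 0"]) (simp, rule Suc)
qed simp

lemma has_derivative_coord: "((\<lambda>x::real^'n. x $ i) has_derivative (\<lambda>h. h $ i)) (at x)"
  by (rule bounded_linear.has_derivative[OF bounded_linear_vec_nth has_derivative_ident])

lemma Ck_affine: "Ck k (\<lambda>x::real^'n. c * x $ i + b)"
proof (cases k)
  case 0
  then show ?thesis by (auto intro!: continuous_intros)
next
  case (Suc m)
  have "((\<lambda>x. c * x $ i + b) has_derivative (\<lambda>h. \<Sum>j\<in>UNIV. h $ j * (if j = i then c else 0))) (at x)" for x :: "real^'n"
    by (auto intro!: derivative_eq_intros has_derivative_coord simp: if_distrib cong: if_cong)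
  then show ?thesis unfolding Suc by (rule Ck_SucI) (simp add: Ck_const)
qed

lemma Ck_add: "Ck k f \<Longrightarrow> Ck k g \<Longrightarrow> Ck k (\<lambda>x. f x + g x)"
proof (induction k arbitrary: f g)
  case 0
  then show ?case by (auto intro: continuous_on_add)
next
  case (Suc k)
  show ?case
  proof (rule Ck_SucI(1))
    show "((\<lambda>x. f x + g x) has_derivative (\<lambda>h. \<Sum>i\<in>UNIV. h $ i * (partial_deriv i f x + partial_deriv i g x))) (at x)" for x
      using has_derivative_add[OF Ck_has_derivative[OF Suc.prems(1)] Ck_has_derivative[OF Suc.prems(2)], of x]
      by (simp add: sum.distrib algebra_simps)
  qed (use Suc in auto)
qed

lemma Ck_mult: "Ck k f \<Longrightarrow> Ck k g \<Longrightarrow> Ck k (\<lambda>x. f x * g x)"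
proof (induction k arbitrary: f g)
  case 0
  then show ?case by (auto intro: continuous_on_mult)
next
  case (Suc k)
  show ?case
  proof (rule Ck_SucI(1))
    show "((\<lambda>x. f x * g x) has_derivative (\<lambda>h. \<Sum>i\<in>UNIV. h $ i * (f x * partial_deriv i g x + partial_deriv i f x * g x))) (at x)" for x
      using has_derivative_mult[OF Ck_has_derivative[OF Suc.prems(1)] Ck_has_derivative[OF Suc.prems(2)], of x]
      by (simp add: sum.distrib sum_distrib_left sum_distrib_right algebra_simps)
    show "Ck k (\<lambda>x. f x * partial_deriv i g x + partial_deriv i f x * g x)" for i
      using Suc.prems Suc.prems[THEN Ck_Suc_imp] by (intro Ck_add Suc.IH) auto
  qed
qed

text \<open>The shift \<open>e\<close> serves as a regularisation: with \<open>e > 0\<close> only the values of \<open>F\<close> on \<open>{e..}\<close> matter, so a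
  profile with a singularity at \<open>0\<close> still gives a smooth function.\<close>

abbreviation radial :: "real \<Rightarrow> (real \<Rightarrow> real) \<Rightarrow> real^'n \<Rightarrow> real" where
  "radial e F x \<equiv> F ((norm x)\<^sup>2 + e)"

lemma has_derivative_radial:
  fixes a :: "real^'n"
  assumes "(F has_real_derivative F') (at ((norm (x - a))\<^sup>2 + e))"
  shows "((\<lambda>x. radial e F (x - a)) has_derivative (\<lambda>h. \<Sum>i\<in>UNIV. h $ i * (2 * (x - a) $ i * F'))) (at x)"
proof -
  have "((\<lambda>x. (norm (x - a))\<^sup>2 + e) has_derivative (\<lambda>h. 2 * ((x - a) \<bullet> h))) (at x)"
    unfolding power2_norm_eq_inner
    by (auto intro!: derivative_eq_intros simp: inner_commute)
  from has_derivative_compose[OF this, of F "(*) F'"] assms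
  have "((\<lambda>x. radial e F (x - a)) has_derivative (\<lambda>h. F' * (2 * ((x - a) \<bullet> h)))) (at x)"
    by (simp add: has_field_derivative_def)
  then show ?thesis
    by (simp add: inner_vec_def sum_distrib_left mult_ac)
qed

lemma Ck_radial:
  fixes a :: "real^'n"
  assumes "Ck_on k U F" "{e..} \<subseteq> U"
  shows "Ck k (\<lambda>x. radial e F (x - a))"
  using assms(1)
proof (induction k arbitrary: F)
  case 0
  show ?case using 0 assms(2)
    by (auto intro!: continuous_on_compose2[of U F] continuous_intros)
next
  case (Suc k)
  then obtain F' where F': "\<forall>t\<in>U. (F has_real_derivative F' t) (at t)" "Ck_on k U F'" by auto
  show ?case
  proof (rule Ck_SucI(1))
    show "((\<lambda>x. radial e F (x - a)) has_derivative (\<lambda>h. \<Sum>i\<in>UNIV. h $ i * (2 * (x - a) $ i * radial e F' (x - a)))) (at x)" for x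
    proof (rule has_derivative_radial)
      have "(norm (x - a))\<^sup>2 + e \<in> U" using assms(2) by auto
      then show "(F has_real_derivative radial e F' (x - a)) (at ((norm (x - a))\<^sup>2 + e))" using F' by blast
    qed
    have 1: "Ck k (\<lambda>x. (2 * x $ i + - 2 * a $ i) * radial e F' (x - a))" for i
      by (intro Ck_mult Suc.IH Ck_affine F'(2))
    have 2: "(\<lambda>x. (2 * x $ i + - 2 * a $ i) * radial e F' (x - a)) = (\<lambda>x. 2 * (x - a) $ i * radial e F' (x - a))" for i
      by (simp add: fun_eq_iff)
    show "Ck k (\<lambda>x. 2 * (x - a) $ i * radial e F' (x - a))" for i
      using 1[of i] unfolding 2 .
  qed
qed

lemma partial_deriv_radial:
  fixes a :: "real^'n"
  assumes "\<And>t. t \<ge> e \<Longrightarrow> (F has_real_derivative F' t) (at t)"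
  shows "partial_deriv i (\<lambda>x. radial e F (x - a)) x = 2 * (x - a) $ i * radial e F' (x - a)"
proof -
  have "((\<lambda>x. radial e F (x - a)) has_derivative (\<lambda>h. \<Sum>i\<in>UNIV. h $ i * (2 * (x - a) $ i * radial e F' (x - a)))) (at x)"
    by (rule has_derivative_radial) (use assms in auto)
  then have "partial_deriv i (\<lambda>x. radial e F (x - a)) x = (\<Sum>j\<in>UNIV. axis i 1 $ j * (2 * (x - a) $ j * radial e F' (x - a)))"
    by (rule partial_deriv_eqI)
  also have "\<dots> = (\<Sum>j\<in>UNIV. if j = i then 2 * (x - a) $ j * radial e F' (x - a) else 0)"
    by (rule sum.cong) (auto simp: axis_def)
  finally show ?thesis by simp
qed

lemma laplacian_radial:
  fixes a x :: "real^2"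
  assumes F': "\<And>t. t \<ge> e \<Longrightarrow> (F has_real_derivative F' t) (at t)"
    and F'': "\<And>t. t \<ge> e \<Longrightarrow> (F' has_real_derivative F'' t) (at t)"
  shows "laplacian (\<lambda>x. radial e F (x - a)) x
    = 4 * radial e F' (x - a) + 4 * (norm (x - a))\<^sup>2 * radial e F'' (x - a)"
proof -
  have "partial_deriv i (partial_deriv i (\<lambda>x. radial e F (x - a))) x
      = 2 * radial e F' (x - a) + 4 * ((x - a) $ i)\<^sup>2 * radial e F'' (x - a)" for i
  proof -
    have eq: "partial_deriv i (\<lambda>x. radial e F (x - a)) = (\<lambda>x. 2 * (x - a) $ i * radial e F' (x - a))"
      using partial_deriv_radial[OF F'] by blast
    have 1: "((\<lambda>x. radial e F' (x - a)) has_derivative (\<lambda>h. \<Sum>i\<in>UNIV. h $ i * (2 * (x - a) $ i * radial e F'' (x - a)))) (at x)"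
      by (rule has_derivative_radial) (use F'' in auto)
    have 2: "((\<lambda>x. 2 * (x - a) $ i) has_derivative (\<lambda>h. 2 * h $ i)) (at x)"
      by (auto intro!: derivative_eq_intros has_derivative_coord)
    have "partial_deriv i (\<lambda>x. 2 * (x - a) $ i * radial e F' (x - a)) x =
      2 * (x - a) $ i * (\<Sum>j\<in>UNIV. axis i 1 $ j * (2 * (x - a) $ j * radial e F'' (x - a)))
      + 2 * axis i 1 $ i * radial e F' (x - a)"
      by (rule partial_deriv_eqI[OF has_derivative_mult[OF 2 1]])
    also have "(\<Sum>j\<in>UNIV. axis i 1 $ j * (2 * (x - a) $ j * radial e F'' (x - a)))
      = (\<Sum>j\<in>UNIV. if j = i then 2 * (x - a) $ j * radial e F'' (x - a) else 0)"
      by (rule sum.cong) (auto simp: axis_def)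
    finally show ?thesis
      unfolding eq by (simp only: sum.delta finite_UNIV axis_def) (simp add: power2_eq_square algebra_simps)
  qed
  then show ?thesis
    by (simp add: laplacian_def UNIV_2 power2_norm_eq_inner inner_vec_def)
      (simp add: power2_eq_square algebra_simps)
qed

text \<open>Boundedness of the support is enough, since the closure of a bounded set is compact.\<close>

lemma test_functionI:
  assumes "\<And>k. Ck k \<phi>" "\<And>x. \<phi> x \<noteq> 0 \<Longrightarrow> x \<in> cball a R"
  shows "test_function \<phi>"
proof -
  have "closure {x. \<phi> x \<noteq> 0} \<subseteq> cball a R" using assms(2) by (intro closure_minimal) auto
  then show ?thesis
    using assms(1) bounded_subset[OF bounded_cball] by (simp add: test_function_def compact_eq_bounded_closed)
qed

section \<open>Integrals over Euclidean space and over the plane\<close>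

lemma
  fixes f :: "'a::euclidean_space \<Rightarrow> real"
  assumes [measurable]: "f \<in> borel_measurable borel" and c: "c \<noteq> 0"
  shows integrable_lborel_affine: "integrable lborel (\<lambda>x. f (t + c *\<^sub>R x)) \<longleftrightarrow> integrable lborel f"
    and integral_lborel_affine: "(LINT x|lborel. f x) = \<bar>c\<bar> ^ DIM('a) * (LINT x|lborel. f (t + c *\<^sub>R x))"
proof -
  show "integrable lborel (\<lambda>x. f (t + c *\<^sub>R x)) \<longleftrightarrow> integrable lborel f"
    by (subst (2) lborel_affine[OF c, of t], subst integrable_density)
      (use c in \<open>auto simp: integrable_distr_eq\<close>)
  show "(LINT x|lborel. f x) = \<bar>c\<bar> ^ DIM('a) * (LINT x|lborel. f (t + c *\<^sub>R x))"
    by (subst lborel_affine[OF c, of t], subst integral_density)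
      (use c in \<open>auto simp: integral_distr\<close>)
qed

lemma
  fixes f :: "'a::euclidean_space \<Rightarrow> real"
  assumes [measurable]: "f \<in> borel_measurable borel"
  shows integrable_lborel_reflect: "integrable lborel (\<lambda>y. f (x - y)) \<longleftrightarrow> integrable lborel f"
    and integral_lborel_reflect: "(LINT y|lborel. f (x - y)) = (LINT y|lborel. f y)"
  using integrable_lborel_affine[of f "-1" x] integral_lborel_affine[of f "-1" x] by auto

lemma
  fixes f :: "'a::euclidean_space \<Rightarrow> real"
  assumes [measurable]: "f \<in> borel_measurable borel"
  shows integrable_lborel_translate: "integrable lborel (\<lambda>y. f (y - x)) \<longleftrightarrow> integrable lborel f"
    and integral_lborel_translate: "(LINT y|lborel. f (y - x)) = (LINT y|lborel. f y)"
  using integrable_lborel_affine[of f "1" "-x"] integral_lborel_affine[of f "1" "-x"] by auto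

lemma Basis_real2: "(Basis :: (real^2) set) = {axis 1 1, axis 2 1}"
  by (auto simp: Basis_vec_def UNIV_2)

lemma prod_Basis_real2: "(\<Prod>b\<in>Basis. f (x \<bullet> b)) = f (x $ 1) * f (x $ 2)" for x :: "real^2"
proof -
  have "axis 1 1 \<noteq> (axis 2 1 :: real^2)" by (auto simp: axis_eq_axis)
  then show ?thesis by (simp add: Basis_real2 inner_axis)
qed

text \<open>By Tonelli, a tensor product of integrable functions of one variable is an integrable majorant. This
  replaces polar coordinates for the two majorants needed below.\<close>

lemma integrable_real2_product_bound:
  fixes h :: "real^2 \<Rightarrow> real" and f :: "real \<Rightarrow> real"
  assumes "integrable lborel f" "\<And>t. f t \<ge> 0" "h \<in> borel_measurable borel"
    "AE x in lborel. \<bar>h x\<bar> \<le> f (x $ 1) * f (x $ 2)"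
  shows "integrable lborel h"
proof -
  have [measurable]: "f \<in> borel_measurable borel" "h \<in> borel_measurable borel" using assms by auto
  have "(\<integral>\<^sup>+x. (\<Prod>b\<in>Basis. f ((x::real^2) \<bullet> b)) \<partial>lborel) = (\<Prod>b\<in>(Basis :: (real^2) set). (\<integral>\<^sup>+x. f x \<partial>lborel))"
    unfolding prod_ennreal[OF assms(2), symmetric]
    by (rule nn_integral_lborel_prod) (auto simp: assms)
  moreover have "(\<integral>\<^sup>+x. f x \<partial>lborel) < \<infinity>"
    using assms(1) by (simp add: nn_integral_eq_integral assms(2))
  ultimately have fin: "(\<integral>\<^sup>+x. f ((x::real^2) $ 1) * f (x $ 2) \<partial>lborel) < \<infinity>"
    unfolding prod_Basis_real2 by (simp add: less_top[symmetric] Basis_real2 ennreal_mult_eq_top_iff axis_eq_axis)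
  have "(\<integral>\<^sup>+x. norm (h x) \<partial>lborel) \<le> (\<integral>\<^sup>+x. f ((x::real^2) $ 1) * f (x $ 2) \<partial>lborel)"
    by (rule nn_integral_mono_AE) (use assms in \<open>auto intro!: ennreal_leI\<close>)
  then show ?thesis using fin by (intro integrableI_bounded) auto
qed

lemma integrable_lborel_even:
  fixes f :: "real \<Rightarrow> real"
  assumes "f \<in> borel_measurable borel" "\<And>t. f (- t) = f t" "set_integrable lborel {0..} f"
  shows "integrable lborel f"
proof -
  have [measurable]: "f \<in> borel_measurable borel" by fact
  have i: "integrable lborel (\<lambda>t. indicator {0..} t *\<^sub>R f t)" using assms(3) by (simp add: set_integrable_def)
  then have "integrable lborel (\<lambda>t. indicator {0..} (0 - t) *\<^sub>R f (0 - t))"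
    by (subst integrable_lborel_reflect) auto
  then have "integrable lborel (\<lambda>t. indicator {0..} t *\<^sub>R f t + indicator {0..} (0 - t) *\<^sub>R f (0 - t))"
    using i by (rule Bochner_Integration.integrable_add[rotated])
  then show ?thesis
    by (rule Bochner_Integration.integrable_bound) (auto simp: assms(2) indicator_def)
qed

lemma integrable_inverse_1_plus_square: "integrable lborel (\<lambda>t::real. 1 / (1 + t\<^sup>2))"
proof (rule integrable_lborel_even)
  have "(\<integral>\<^sup>+t. ennreal (1 / (1 + t\<^sup>2)) * indicator {0..} t \<partial>lborel) = ennreal (pi / 2 - arctan 0)"
  proof (rule nn_integral_FTC_atLeast)
    show "(arctan \<longlongrightarrow> pi / 2) at_top" by (rule tendsto_arctan_at_top)
    show "DERIV arctan x :> 1 / (1 + x\<^sup>2)" for x :: real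
      by (auto intro!: derivative_eq_intros simp: field_simps)
  qed auto
  then have "(\<integral>\<^sup>+t. ennreal (norm (indicator {0..} t *\<^sub>R (1 / (1 + t\<^sup>2)) :: real)) \<partial>lborel) = ennreal (pi / 2)"
    by (subst nn_integral_cong[where v="\<lambda>t. ennreal (1 / (1 + t\<^sup>2)) * indicator {0..} t"])
      (auto simp: indicator_def)
  then show "set_integrable lborel {0..} (\<lambda>t::real. 1 / (1 + t\<^sup>2))"
    unfolding set_integrable_def by (intro integrableI_bounded) auto
qed auto

lemma one_plus_norm_sq: "(1 + (x $ 1)\<^sup>2) * (1 + (x $ 2)\<^sup>2) \<le> ((norm x)\<^sup>2 + 1)\<^sup>2" for x :: "real^2"
proof -
  have "(norm x)\<^sup>2 = (x $ 1)\<^sup>2 + (x $ 2)\<^sup>2"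
    unfolding power2_norm_eq_inner by (simp add: inner_vec_def UNIV_2 power2_eq_square)
  moreover have "(1 + a) * (1 + b) \<le> (a + b + 1)\<^sup>2" if "a \<ge> 0" "b \<ge> 0" for a b :: real
    using that mult_nonneg_nonneg[OF that] by (simp add: power2_eq_square algebra_simps)
  ultimately show ?thesis by simp
qed

text \<open>The function is a multiple of the Laplacian of \<open>ln (|x|\<^sup>2 + 1)\<close>, hence the shape of the approximate
  identity that the regularised parametrix produces.\<close>

lemma integrable_bubble: "integrable lborel (\<lambda>x::real^2. 1 / ((norm x)\<^sup>2 + 1)\<^sup>2)"
proof (rule integrable_real2_product_bound[OF integrable_inverse_1_plus_square])
  show "AE x::real^2 in lborel. \<bar>1 / ((norm x)\<^sup>2 + 1)\<^sup>2\<bar> \<le> 1 / (1 + (x $ 1)\<^sup>2) * (1 / (1 + (x $ 2)\<^sup>2))"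
  proof (rule AE_I2)
    fix x :: "real^2"
    have p: "0 < (norm x)\<^sup>2 + 1" "0 < 1 + (x $ 1)\<^sup>2" "0 < 1 + (x $ 2)\<^sup>2"
      by (simp_all add: add_nonneg_pos add_pos_nonneg)
    have "1 / ((norm x)\<^sup>2 + 1)\<^sup>2 \<le> 1 / ((1 + (x $ 1)\<^sup>2) * (1 + (x $ 2)\<^sup>2))"
      by (rule divide_left_mono[OF one_plus_norm_sq]) (intro mult_pos_pos zero_less_power p zero_le_one)+
    then show "\<bar>1 / ((norm x)\<^sup>2 + 1)\<^sup>2\<bar> \<le> 1 / (1 + (x $ 1)\<^sup>2) * (1 / (1 + (x $ 2)\<^sup>2))" by simp
  qed
qed auto

definition bubble_mass :: real where
  "bubble_mass = (LINT x::real^2|lborel. 1 / ((norm x)\<^sup>2 + 1)\<^sup>2)"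

lemma bubble_mass_pos: "bubble_mass > 0"
proof -
  have "bubble_mass \<noteq> 0"
  proof
    assume "bubble_mass = 0"
    then have "AE x::real^2 in lborel. 1 / ((norm x)\<^sup>2 + 1)\<^sup>2 = 0"
      unfolding bubble_mass_def by (subst (asm) integral_nonneg_eq_0_iff_AE) (auto simp: integrable_bubble)
    moreover have "1 / ((norm x)\<^sup>2 + 1)\<^sup>2 \<noteq> 0" for x :: "real^2"
      by (simp add: add_nonneg_eq_0_iff)
    ultimately have "AE x::real^2 in lborel. False" by simp
    then have "emeasure (lborel :: (real^2) measure) UNIV = 0"
      by (subst (asm) AE_iff_measurable[OF _ refl]) auto
    then show False by simp
  qed
  moreover have "bubble_mass \<ge> 0" unfolding bubble_mass_def by (rule integral_nonneg_AE) auto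
  ultimately show ?thesis by simp
qed

text \<open>Scaling by \<open>r\<close>. Besides the approximate identity, this evaluates the tail integral of \<open>1/|y|\<^sup>4\<close> over
  \<open>|y| > r\<close> up to a constant.\<close>

lemma
  assumes "r > 0"
  shows integrable_bubble_scaled: "integrable lborel (\<lambda>x::real^2. 1 / ((norm x)\<^sup>2 + r\<^sup>2)\<^sup>2)"
    and integral_bubble_scaled: "(LINT x::real^2|lborel. 1 / ((norm x)\<^sup>2 + r\<^sup>2)\<^sup>2) = bubble_mass / r\<^sup>2"
proof -
  let ?f = "\<lambda>x::real^2. 1 / ((norm x)\<^sup>2 + r\<^sup>2)\<^sup>2"
  have eq: "?f (0 + r *\<^sub>R x) = 1 / r ^ 4 * (1 / ((norm x)\<^sup>2 + 1)\<^sup>2)" for x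
  proof -
    have "(norm (r *\<^sub>R x))\<^sup>2 + r\<^sup>2 = r\<^sup>2 * ((norm x)\<^sup>2 + 1)" by (simp add: power_mult_distrib algebra_simps)
    then show ?thesis by (simp add: power_mult_distrib)
  qed
  have "integrable lborel (\<lambda>x. ?f (0 + r *\<^sub>R x))"
    unfolding eq by (intro integrable_mult_right integrable_bubble)
  then show "integrable lborel ?f" using assms by (subst (asm) integrable_lborel_affine) auto
  have "(LINT x|lborel. ?f x) = \<bar>r\<bar> ^ DIM(real^2) * (LINT x|lborel. ?f (0 + r *\<^sub>R x))"
    by (rule integral_lborel_affine) (use assms in auto)
  also have "\<dots> = r\<^sup>2 * (1 / r ^ 4 * bubble_mass)"
    unfolding eq bubble_mass_def integral_mult_right_zero using assms by simp
  also have "\<dots> = bubble_mass / r\<^sup>2"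
    using assms by (simp add: power2_eq_square power4_eq_xxxx)
  finally show "(LINT x|lborel. ?f x) = bubble_mass / r\<^sup>2" .
qed

text \<open>The Riesz kernel \<open>1/|x|\<close> of the plane, truncated to a disc.\<close>

definition riesz :: "real \<Rightarrow> real^2 \<Rightarrow> real" where
  "riesz r x = indicator (cball 0 r) x / norm x"

lemma borel_measurable_riesz [measurable]: "riesz r \<in> borel_measurable borel"
  unfolding riesz_def[abs_def] by (intro borel_measurable_divide borel_measurable_indicator) auto

lemma riesz_nonneg: "riesz r x \<ge> 0" by (simp add: riesz_def)

text \<open>The majorant comes from \<open>|x| \<ge> \<surd>|x\<^sub>1| \<surd>|x\<^sub>2|\<close>.\<close>

lemma integrable_riesz: "integrable lborel (riesz r)"
proof -
  let ?f = "\<lambda>t::real. indicator {-r..r} t * \<bar>t\<bar> powr (-1/2)"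
  have f: "integrable lborel ?f"
  proof (rule integrable_lborel_even)
    show "set_integrable lborel {0..} ?f"
    proof (cases "r \<ge> 0")
      case True
      have "(\<lambda>t. t powr (-1/2)) integrable_on {0..r}"
        using True by (intro integrable_on_powr_from_0) auto
      then have "(\<lambda>t. t powr (-1/2)) absolutely_integrable_on {0..r}"
        by (rule nonnegative_absolutely_integrable_1) auto
      then have "set_integrable lborel {0..r} (\<lambda>t. t powr (-1/2))"
        by (simp add: set_integrable_def integrable_completion)
      moreover have "indicator {0..} t *\<^sub>R ?f t = indicator {0..r} t *\<^sub>R (t powr (-1/2))" for t :: real
        using True by (auto simp: indicator_def)
      ultimately show ?thesis by (simp add: set_integrable_def)
    next
      case False
      then have "{-r..r} = {}" by auto
      then show ?thesis by (simp add: set_integrable_def)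
    qed
  qed (auto simp: indicator_def)
  show ?thesis
  proof (rule integrable_real2_product_bound[OF f])
    \<comment> \<open>On the axes the majorant is \<open>0\<close>, because \<open>0 powr a = 0\<close>, so they have to be discarded as a null set.\<close>
    have "negligible {x::real^2. x $ i = 0}" for i
      using negligible_standard_hyperplane[of "axis i 1 :: real^2" 0] by (simp add: inner_axis axis_in_Basis_iff)
    then have ae: "AE x in lborel. (x::real^2) $ i \<noteq> 0" for i
    proof -
      have "{x::real^2. x $ i = 0} \<in> null_sets lebesgue" if "negligible {x::real^2. x $ i = 0}"
        using that negligible_iff_null_sets by blast
      moreover have "{x::real^2. x $ i = 0} \<in> sets lborel" by measurable
      ultimately show ?thesis using \<open>\<And>i. negligible {x::real^2. x $ i = 0}\<close>
        by (intro AE_I'[of "{x. x $ i = 0}"]) (auto simp: null_sets_completion_iff)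
    qed
    show "AE x in lborel. \<bar>riesz r x\<bar> \<le> ?f (x $ 1) * ?f (x $ 2)"
      using ae[of 1] ae[of 2]
    proof eventually_elim
      case (elim x)
      show ?case
      proof (cases "norm x \<le> r")
        case True
        have c: "\<bar>x $ 1\<bar> \<le> norm x" "\<bar>x $ 2\<bar> \<le> norm x" by (auto intro: component_le_norm_cart)
        then have i: "x $ 1 \<in> {-r..r}" "x $ 2 \<in> {-r..r}" using True by (auto simp: abs_le_iff)
        have "\<bar>x $ 1\<bar> powr (1/2) * \<bar>x $ 2\<bar> powr (1/2) \<le> norm x powr (1/2) * norm x powr (1/2)"
          using c by (intro mult_mono powr_mono2) auto
        also have "\<dots> = norm x" using elim by (simp add: powr_add[symmetric])
        finally have "1 / norm x \<le> 1 / (\<bar>x $ 1\<bar> powr (1/2) * \<bar>x $ 2\<bar> powr (1/2))"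
          using elim by (intro divide_left_mono mult_pos_pos) auto
        then show ?thesis using True i by (simp add: riesz_def powr_minus field_simps)
      qed (simp add: riesz_def)
    qed
  qed auto
qed

definition riesz_mass :: real where "riesz_mass = (LINT x|lborel. riesz 1 x)"

lemma riesz_mass_nonneg: "riesz_mass \<ge> 0"
  unfolding riesz_mass_def by (rule integral_nonneg_AE) (simp add: riesz_nonneg)

lemma integral_riesz:
  assumes "r > 0"
  shows "(LINT x|lborel. riesz r x) = r * riesz_mass"
proof -
  have eq: "riesz r (0 + r *\<^sub>R x) = 1 / r * riesz 1 x" for x
    using assms by (auto simp: riesz_def indicator_def)
  have "(LINT x|lborel. riesz r x) = \<bar>r\<bar> ^ DIM(real^2) * (LINT x|lborel. riesz r (0 + r *\<^sub>R x))"
    by (rule integral_lborel_affine) (use assms in auto)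
  also have "\<dots> = r * riesz_mass"
    unfolding eq riesz_mass_def using assms by (simp add: power2_eq_square)
  finally show ?thesis .
qed

lemma perp_nth [simp]: "perp x $ 1 = - x $ 2" "perp x $ 2 = x $ 1"
  by (simp_all add: perp_def)

lemma norm_perp [simp]: "norm (perp x) = norm x"
  by (simp add: norm_eq_sqrt_inner inner_vec_def UNIV_2)

lemma linear_perp: "linear perp"
  by (rule linearI) (auto simp: vec_eq_iff forall_2)

lemma borel_measurable_perp [measurable]: "perp \<in> borel_measurable borel"
  using linear_continuous_on[OF linear_conv_bounded_linear[THEN iffD1, OF linear_perp], of UNIV]
  by (rule borel_measurable_continuous_onI)

text \<open>It suffices to compare the measures of boxes, and a rotation by a right angle maps boxes to boxes.\<close>

lemma distr_perp: "distr lborel borel perp = lborel"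
proof (rule lborel_eqI[symmetric])
  fix l u :: "real^2" assume le: "\<And>b. b \<in> Basis \<Longrightarrow> l \<bullet> b \<le> u \<bullet> b"
  have le': "l $ 1 \<le> u $ 1" "l $ 2 \<le> u $ 2"
    using le[of "axis 1 1"] le[of "axis 2 1"] by (auto simp: Basis_real2 inner_axis)
  have "perp -` box l u = box (vector [l $ 2, - (u $ 1)]) (vector [u $ 2, - (l $ 1)])"
    by (auto simp: box_def Basis_real2 inner_axis)
  then have "emeasure (distr lborel borel perp) (box l u) = emeasure lborel (box (vector [l $ 2, - (u $ 1)]) (vector [u $ 2, - (l $ 1)]) :: (real^2) set)"
    by (simp add: emeasure_distr)
  also have "\<dots> = ennreal (\<Prod>b\<in>Basis. (vector [u $ 2, - (l $ 1)] - vector [l $ 2, - (u $ 1)] :: real^2) \<bullet> b)"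
    by (rule emeasure_lborel_box) (use le' in \<open>auto simp: Basis_real2 inner_axis\<close>)
  also have "\<dots> = ennreal (\<Prod>b\<in>Basis. (u - l) \<bullet> b)"
    by (subst (1 2) prod_Basis_real2[of "\<lambda>t. t", simplified]) (simp add: mult.commute)
  finally show "emeasure (distr lborel borel perp) (box l u) = ennreal (\<Prod>b\<in>Basis. (u - l) \<bullet> b)" .
qed auto

lemma
  fixes f :: "real^2 \<Rightarrow> real"
  assumes [measurable]: "f \<in> borel_measurable borel"
  shows integrable_perp: "integrable lborel (\<lambda>x. f (perp x)) \<longleftrightarrow> integrable lborel f"
    and integral_perp: "(LINT x|lborel. f (perp x)) = (LINT x|lborel. f x)"
proof -
  show "integrable lborel (\<lambda>x. f (perp x)) \<longleftrightarrow> integrable lborel f"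
    by (subst (2) distr_perp[symmetric], subst integrable_distr_eq) auto
  show "(LINT x|lborel. f (perp x)) = (LINT x|lborel. f x)"
    by (subst (2) distr_perp[symmetric], subst integral_distr) auto
qed

section \<open>Convolution with a kernel of compact support\<close>

text \<open>Borel measurability is required, rather than Lebesgue measurability, because products and Fubini's
  theorem are then available for \<open>lborel\<close>.\<close>

definition loc_integrable :: "(real^'n \<Rightarrow> real) \<Rightarrow> bool" where
  "loc_integrable f \<longleftrightarrow> f \<in> borel_measurable borel \<and> (\<forall>r. integrable lborel (\<lambda>y. indicator (cball 0 r) y * f y))"

definition loc_mass :: "(real^'n \<Rightarrow> real) \<Rightarrow> real \<Rightarrow> real" where
  "loc_mass f r = (LINT y|lborel. \<bar>indicator (cball 0 r) y * f y\<bar>)"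

definition conv :: "(real^'n \<Rightarrow> real) \<Rightarrow> (real^'n \<Rightarrow> real) \<Rightarrow> real^'n \<Rightarrow> real" where
  "conv f k x = (LINT y|lborel. f y * k (x - y))"

text \<open>The support is confined to a ball of explicit radius, since the radii of supports have to be added under
  convolution.\<close>

definition supp_in :: "real \<Rightarrow> (real^'n \<Rightarrow> real) \<Rightarrow> bool" where
  "supp_in R k \<longleftrightarrow> (\<forall>z. norm z > R \<longrightarrow> k z = 0)"

lemma loc_mass_nonneg: "loc_mass f r \<ge> 0"
  unfolding loc_mass_def by (rule integral_nonneg_AE) auto

text \<open>All estimates for kernels of compact support reduce to this one, applied to differences of kernels: only the
  values of \<open>f\<close> within distance \<open>R\<close> of \<open>x\<close> contribute, so the bound is locally uniform in \<open>x\<close>.\<close>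

lemma conv_bounded_kernel:
  assumes f: "loc_integrable f" and k: "k \<in> borel_measurable borel" "supp_in R k"
    and b: "\<And>z. \<bar>k z\<bar> \<le> c"
  shows "integrable lborel (\<lambda>y. f y * k (x - y))"
    and "norm x \<le> r \<Longrightarrow> \<bar>conv f k x\<bar> \<le> c * loc_mass f (r + R)"
proof -
  have [measurable]: "f \<in> borel_measurable borel" "k \<in> borel_measurable borel"
    using f k by (auto simp: loc_integrable_def)
  have pt: "norm (f y * k (x - y)) \<le> c * \<bar>indicator (cball 0 (r + R)) y * f y\<bar>" if "norm x \<le> r" for r y
  proof (cases "norm (x - y) > R")
    case True
    have "c \<ge> 0" using b[of 0] by linarith
    then show ?thesis using k True by (simp add: supp_in_def)
  next
    case False
    have "norm y \<le> norm x + norm (x - y)" by norm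
    then have "norm y \<le> r + R" using False that by simp
    moreover have "\<bar>f y\<bar> * \<bar>k (x - y)\<bar> \<le> \<bar>f y\<bar> * c" by (intro mult_left_mono b) simp
    ultimately show ?thesis by (simp add: abs_mult mult.commute)
  qed
  have int: "integrable lborel (\<lambda>y. c * \<bar>indicator (cball 0 (r + R)) y * f y\<bar>)" for r
    using f by (auto simp: loc_integrable_def)
  show i: "integrable lborel (\<lambda>y. f y * k (x - y))"
    by (rule Bochner_Integration.integrable_bound[OF int[of "norm x"]]) (auto intro!: AE_I2 order_trans[OF pt[OF order_refl, unfolded real_norm_def] abs_ge_self])
  show "\<bar>conv f k x\<bar> \<le> c * loc_mass f (r + R)" if "norm x \<le> r"
  proof -
    have "\<bar>conv f k x\<bar> \<le> (LINT y|lborel. norm (f y * k (x - y)))"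
      unfolding conv_def real_norm_def by (rule integral_abs_bound)
    also have "\<dots> \<le> (LINT y|lborel. c * \<bar>indicator (cball 0 (r + R)) y * f y\<bar>)"
      by (rule integral_mono[OF integrable_norm[OF i] int pt[OF that]])
    finally show ?thesis by (simp add: loc_mass_def)
  qed
qed

lemma bounded_compact_support:
  assumes "continuous_on UNIV k" "supp_in R k"
  obtains c where "\<And>z. \<bar>k z\<bar> \<le> c"
proof -
  have "compact (k ` cball 0 R)" using assms by (intro compact_continuous_image) (auto intro: continuous_on_subset)
  then obtain c where c: "\<And>z. z \<in> cball 0 R \<Longrightarrow> \<bar>k z\<bar> \<le> c"
    using compact_imp_bounded[of "k ` cball 0 R"] by (force simp: bounded_iff)
  have "\<bar>k z\<bar> \<le> max c 0" for z
    using c[of z] assms(2) by (cases "norm z > R") (auto simp: supp_in_def)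
  then show ?thesis by (rule that)
qed

lemma integrable_conv_continuous:
  assumes f: "loc_integrable f" and k: "continuous_on UNIV k" "supp_in R k"
  shows "integrable lborel (\<lambda>y. f y * k (x - y))"
proof -
  obtain c where "\<And>z. \<bar>k z\<bar> \<le> c" using bounded_compact_support k by blast
  then show ?thesis
    using conv_bounded_kernel(1)[OF f borel_measurable_continuous_onI[OF k(1)] k(2)] by blast
qed

lemma loc_integrable_bounded:
  assumes "f \<in> borel_measurable borel" "\<And>y. \<bar>f y\<bar> \<le> M"
  shows "loc_integrable f"
proof -
  have "integrable lborel (\<lambda>y. indicator (cball 0 r) y * f y)" for r
  proof (rule Bochner_Integration.integrable_bound)
    show "integrable lborel (\<lambda>y::real^'a. indicator (cball 0 r) y * M)"
      by (intro integrable_mult_left) (auto intro!: integrable_real_indicator emeasure_compact_finite)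
  qed (use assms in \<open>auto simp: indicator_def intro!: AE_I2 intro: order_trans[OF assms(2) abs_ge_self]\<close>)
  then show ?thesis using assms by (simp add: loc_integrable_def)
qed

lemma loc_integrable_continuous:
  assumes "continuous_on UNIV f"
  shows "loc_integrable f"
proof -
  have "integrable lborel (\<lambda>y. indicator (cball 0 r) y *\<^sub>R f y)" for r
    using assms by (intro borel_integrable_compact) (auto intro: continuous_on_subset)
  then show ?thesis using assms by (simp add: loc_integrable_def borel_measurable_continuous_onI)
qed

lemma loc_integrable_diff: "loc_integrable f \<Longrightarrow> loc_integrable g \<Longrightarrow> loc_integrable (\<lambda>x. f x - g x)"
  by (auto simp: loc_integrable_def right_diff_distrib)

lemma integrable_continuous_mult_loc:
  assumes \<phi>: "continuous_on UNIV \<phi>" "supp_in R \<phi>" and f: "loc_integrable f"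
  shows "integrable lborel (\<lambda>x. \<phi> x * f x)"
proof -
  obtain B where B: "\<And>z. \<bar>\<phi> z\<bar> \<le> B" using bounded_compact_support \<phi> by blast
  show ?thesis
  proof (rule Bochner_Integration.integrable_bound)
    show "integrable lborel (\<lambda>y. B * (indicator (cball 0 R) y * f y))"
      using f by (intro integrable_mult_right) (simp add: loc_integrable_def)
    show "(\<lambda>x. \<phi> x * f x) \<in> borel_measurable lborel"
      using f borel_measurable_continuous_onI[OF \<phi>(1)] by (auto simp: loc_integrable_def)
    show "AE x in lborel. norm (\<phi> x * f x) \<le> norm (B * (indicator (cball 0 R) x * f x))"
    proof (rule AE_I2)
      fix x
      have "\<bar>\<phi> x\<bar> \<le> \<bar>B\<bar> * indicator (cball 0 R) x"
        using B[of x] \<phi>(2) by (auto simp: supp_in_def indicator_def)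
      then have "\<bar>\<phi> x\<bar> * \<bar>f x\<bar> \<le> \<bar>B\<bar> * indicator (cball 0 R) x * \<bar>f x\<bar>" by (rule mult_right_mono) simp
      then show "norm (\<phi> x * f x) \<le> norm (B * (indicator (cball 0 R) x * f x))"
        by (simp add: abs_mult mult.assoc)
    qed
  qed
qed

lemma integrable_continuous_compact_support:
  fixes h :: "real^'n \<Rightarrow> real"
  assumes "continuous_on UNIV h" "supp_in R h"
  shows "integrable lborel h"
  using integrable_continuous_mult_loc[OF assms loc_integrable_continuous[of "\<lambda>_. 1"]] by simp

lemma uniformly_continuous_compact_support:
  fixes k :: "real^'n \<Rightarrow> real"
  assumes "continuous_on UNIV k" "supp_in R k" "e > 0"
  obtains d where "d > 0" "d \<le> 1" "\<And>z h. norm h < d \<Longrightarrow> \<bar>k (z + h) - k z\<bar> < e"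
proof -
  have "uniformly_continuous_on (cball 0 (R + 1)) k"
    using assms by (intro compact_uniformly_continuous) (auto intro: continuous_on_subset)
  then obtain d where d: "d > 0" "\<And>x y. x \<in> cball 0 (R+1) \<Longrightarrow> y \<in> cball 0 (R+1) \<Longrightarrow> dist y x < d \<Longrightarrow> dist (k y) (k x) < e"
    using assms(3) unfolding uniformly_continuous_on_def by metis
  have "\<bar>k (z + h) - k z\<bar> < e" if h: "norm h < min d 1" for z h
  proof (cases "norm z > R \<and> norm (z + h) > R")
    case True
    then show ?thesis using assms by (simp add: supp_in_def)
  next
    case False
    have "norm z \<le> norm (z + h) + norm h" "norm (z + h) \<le> norm z + norm h" by norm+
    then have "norm z \<le> R + 1" "norm (z + h) \<le> R + 1" using False h by auto
    then have "z \<in> cball 0 (R + 1)" "z + h \<in> cball 0 (R + 1)" by (simp_all only: mem_cball_0)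
    then show ?thesis using d(2)[of z "z + h"] h by (simp add: dist_norm)
  qed
  then show ?thesis using d(1) by (intro that[of "min d 1"]) auto
qed

lemma supp_in_shift:
  assumes "supp_in R k" "norm h \<le> 1"
  shows "supp_in (R + 1) (\<lambda>z. k (z + h))"
  unfolding supp_in_def
proof (intro allI impI)
  fix z :: "real^'a" assume z: "norm z > R + 1"
  have "norm z \<le> norm (z + h) + norm h" by norm
  then show "k (z + h) = 0" using assms z by (simp add: supp_in_def)
qed

lemma supp_in_mono: "supp_in R k \<Longrightarrow> R \<le> S \<Longrightarrow> supp_in S k"
  by (auto simp: supp_in_def)

lemma conv_continuous:
  assumes f: "loc_integrable f" and k: "continuous_on UNIV k" "supp_in R k"
  shows "continuous_on UNIV (conv f k)"
proof -
  have "\<exists>d>0. \<forall>y. dist y x < d \<longrightarrow> dist (conv f k y) (conv f k x) < e" if e: "e > 0" for x e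
  proof -
    define M where "M = loc_mass f (norm x + (R + 1)) + 1"
    have M: "M > 0" using loc_mass_nonneg[of f "norm x + (R + 1)"] by (simp add: M_def)
    then obtain d where d: "d > 0" "d \<le> 1" "\<And>z h. norm h < d \<Longrightarrow> \<bar>k (z + h) - k z\<bar> < e / M"
      using uniformly_continuous_compact_support[OF k, of "e / M"] e by auto
    show ?thesis
    proof (intro exI[of _ d] conjI allI impI d(1))
      fix y assume "dist y x < d"
      define h where "h = y - x"
      have h: "norm h < d" using \<open>dist y x < d\<close> by (simp add: h_def dist_norm)
      have s: "supp_in (R + 1) (\<lambda>z. k (z + h) - k z)"
        using supp_in_shift[OF k(2), of h] supp_in_mono[OF k(2), of "R + 1"] h d(2) by (auto simp: supp_in_def)
      have q: "k (y - u) = k ((x - u) + h)" for u by (simp add: h_def algebra_simps)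
      have "conv f k y - conv f k x = (LINT u|lborel. f u * k (y - u) - f u * k (x - u))"
        unfolding conv_def
        by (rule Bochner_Integration.integral_diff[symmetric]) (intro integrable_conv_continuous[OF f k])+
      also have "\<dots> = conv f (\<lambda>z. k (z + h) - k z) x"
        by (simp only: conv_def q right_diff_distrib)
      finally have "conv f k y - conv f k x = conv f (\<lambda>z. k (z + h) - k z) x" .
      also have "\<bar>\<dots>\<bar> \<le> e / M * loc_mass f (norm x + (R + 1))"
      proof (rule conv_bounded_kernel(2)[OF f _ s])
        show "(\<lambda>z. k (z + h) - k z) \<in> borel_measurable borel"
          by (intro borel_measurable_continuous_onI continuous_intros continuous_on_compose2[OF k(1)] k) auto
      qed (use d(3) h in \<open>auto intro: less_imp_le\<close>)
      also have "\<dots> < e / M * M" using e M by (intro mult_strict_left_mono) (auto simp: M_def)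
      finally show "dist (conv f k y) (conv f k x) < e" using M by (simp add: dist_real_def)
    qed
  qed
  then show ?thesis unfolding continuous_on_iff by blast
qed

lemma supp_in_partial_deriv:
  assumes "supp_in R k"
  shows "supp_in R (partial_deriv i k)"
  unfolding supp_in_def
proof (intro allI impI)
  fix z :: "real^'a" assume z: "norm z > R"
  have "open {z::real^'a. norm z > R}" by (intro open_Collect_less continuous_intros)
  then have "(k has_derivative (\<lambda>_. 0)) (at z)"
    using has_derivative_transform_within_open[OF has_derivative_const[of 0], of _ z k] z assms
    by (auto simp: supp_in_def)
  then show "partial_deriv i k z = 0" by (rule partial_deriv_eqI)
qed

text \<open>By the mean value theorem the error is controlled by the modulus of continuity of the partial derivatives,
  which is uniform because they have compact support.\<close>

lemma uniform_differentiability: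
  fixes k :: "real^'n \<Rightarrow> real"
  assumes k: "Ck 1 k" "supp_in R k" and "e > 0"
  obtains d where "d > 0" "d \<le> 1"
    "\<And>z h. norm h < d \<Longrightarrow> \<bar>k (z + h) - k z - (\<Sum>i\<in>UNIV. h $ i * partial_deriv i k z)\<bar> \<le> e * norm h"
proof -
  let ?e = "e / real CARD('n)"
  have e: "?e > 0" using \<open>e > 0\<close> by simp
  have c: "continuous_on UNIV (partial_deriv i k)" for i using k(1) by simp
  have "\<exists>d. d > 0 \<and> d \<le> 1 \<and> (\<forall>z h. norm h < d \<longrightarrow> \<bar>partial_deriv i k (z + h) - partial_deriv i k z\<bar> < ?e)" for i
    by (rule uniformly_continuous_compact_support[OF c supp_in_partial_deriv[OF k(2)] e, of i]) blast
  then obtain D where D: "\<And>i. D i > 0 \<and> D i \<le> 1 \<and> (\<forall>z h. norm h < D i \<longrightarrow> \<bar>partial_deriv i k (z + h) - partial_deriv i k z\<bar> < ?e)"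
    by metis
  define d where "d = Min (range D)"
  have d: "d > 0" "d \<le> 1" "\<And>i. d \<le> D i"
    using D by (auto simp: d_def Min_gr_iff intro!: Min_le_iff[THEN iffD2])
  show ?thesis
  proof (rule that[OF d(1,2)])
    fix z h :: "real^'n" assume h: "norm h < d"
    have der: "((\<lambda>t. k (z + t *\<^sub>R h)) has_derivative (\<lambda>u. u * (\<Sum>i\<in>UNIV. h $ i * partial_deriv i k (z + t *\<^sub>R h)))) (at t within {0..1})" for t
    proof -
      have "((\<lambda>t. z + t *\<^sub>R h) has_derivative (\<lambda>u. u *\<^sub>R h)) (at t within {0..1})"
        by (auto intro!: derivative_eq_intros)
      from has_derivative_compose[OF this Ck_has_derivative[of 0 k "z + t *\<^sub>R h"]] k(1)
      show ?thesis by (simp add: sum_distrib_left mult.assoc)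
    qed
    obtain t where t: "t \<in> {0<..<1}" "k (z + 1 *\<^sub>R h) - k (z + 0 *\<^sub>R h) = (1 - 0) * (\<Sum>i\<in>UNIV. h $ i * partial_deriv i k (z + t *\<^sub>R h))"
      using mvt_simple[OF zero_less_one der] by blast
    have "k (z + h) - k z - (\<Sum>i\<in>UNIV. h $ i * partial_deriv i k z) = (\<Sum>i\<in>UNIV. h $ i * (partial_deriv i k (z + t *\<^sub>R h) - partial_deriv i k z))"
      using t(2) by (simp add: algebra_simps sum_subtractf)
    also have "\<bar>\<dots>\<bar> \<le> (\<Sum>i\<in>UNIV. \<bar>h $ i * (partial_deriv i k (z + t *\<^sub>R h) - partial_deriv i k z)\<bar>)"
      by (rule sum_abs)
    also have "\<dots> \<le> (\<Sum>i\<in>(UNIV::'n set). norm h * ?e)"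
    proof (rule sum_mono)
      fix i
      have "norm (t *\<^sub>R h) \<le> norm h" using t(1) by (simp add: mult_left_le_one_le)
      then have "norm (t *\<^sub>R h) < D i" using h d(3)[of i] by linarith
      then have "\<bar>partial_deriv i k (z + t *\<^sub>R h) - partial_deriv i k z\<bar> \<le> ?e" using D[of i] less_imp_le by blast
      then show "\<bar>h $ i * (partial_deriv i k (z + t *\<^sub>R h) - partial_deriv i k z)\<bar> \<le> norm h * ?e"
        unfolding abs_mult by (intro mult_mono component_le_norm_cart) auto
    qed
    also have "\<dots> = e * norm h" by simp
    finally show "\<bar>k (z + h) - k z - (\<Sum>i\<in>UNIV. h $ i * partial_deriv i k z)\<bar> \<le> e * norm h" .
  qed
qed

text \<open>The error of the first-order expansion of \<open>conv f k\<close> is the convolution of \<open>f\<close> with that of \<open>k\<close>,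
  which is uniformly small and of compact support.\<close>

lemma conv_has_derivative:
  assumes f: "loc_integrable f" and k: "Ck 1 k" "supp_in R k"
  shows "(conv f k has_derivative (\<lambda>h. \<Sum>i\<in>UNIV. h $ i * conv f (partial_deriv i k) x)) (at x)"
  unfolding has_derivative_at_alt
proof (intro conjI allI impI)
  show "bounded_linear (\<lambda>h. \<Sum>i\<in>UNIV. h $ i * conv f (partial_deriv i k) x)"
    by (intro bounded_linear_sum bounded_linear_mult_const bounded_linear_vec_nth)
  fix e :: real assume e: "e > 0"
  define M where "M = loc_mass f (norm x + (R + 1)) + 1"
  have M: "M > 0" using loc_mass_nonneg[of f "norm x + (R + 1)"] by (simp add: M_def)
  then obtain d where d: "d > 0" "d \<le> 1"
    "\<And>z h. norm h < d \<Longrightarrow> \<bar>k (z + h) - k z - (\<Sum>i\<in>UNIV. h $ i * partial_deriv i k z)\<bar> \<le> e / M * norm h"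
    using uniform_differentiability[OF k, of "e / M"] e by auto
  have c: "continuous_on UNIV k" "\<And>i. continuous_on UNIV (partial_deriv i k)"
    using Ck_imp_continuous[OF k(1)] k(1) by auto
  show "\<exists>d>0. \<forall>y. norm (y - x) < d \<longrightarrow>
          norm (conv f k y - conv f k x - (\<Sum>i\<in>UNIV. (y - x) $ i * conv f (partial_deriv i k) x)) \<le> e * norm (y - x)"
  proof (intro exI[of _ d] conjI allI impI d(1))
    fix y assume "norm (y - x) < d"
    define h where "h = y - x"
    have h: "norm h < d" using \<open>norm (y - x) < d\<close> by (simp add: h_def)
    let ?q = "\<lambda>z. k (z + h) - k z - (\<Sum>i\<in>UNIV. h $ i * partial_deriv i k z)"
    have s: "supp_in (R + 1) ?q"
      using supp_in_shift[OF k(2), of h] supp_in_mono[OF k(2), of "R + 1"]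
        supp_in_mono[OF supp_in_partial_deriv[OF k(2)], of "R + 1"] h d(2) by (auto simp: supp_in_def)
    have q: "k (y - u) = k ((x - u) + h)" for u by (simp add: h_def algebra_simps)
    have "conv f ?q x = (LINT u|lborel. f u * k (y - u) - f u * k (x - u) - (\<Sum>i\<in>UNIV. h $ i * (f u * partial_deriv i k (x - u))))"
      unfolding conv_def q by (simp only: right_diff_distrib sum_distrib_left mult.left_commute)
    also have "\<dots> = conv f k y - conv f k x - (\<Sum>i\<in>UNIV. h $ i * conv f (partial_deriv i k) x)"
      using integrable_conv_continuous[OF f c(1) k(2), of x] integrable_conv_continuous[OF f c(1) k(2), of y]
        integrable_conv_continuous[OF f c(2) supp_in_partial_deriv[OF k(2)], of _ x]
      by (simp add: conv_def)
    finally have "\<bar>conv f k y - conv f k x - (\<Sum>i\<in>UNIV. h $ i * conv f (partial_deriv i k) x)\<bar> = \<bar>conv f ?q x\<bar>" by simp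
    also have "\<dots> \<le> e / M * norm h * loc_mass f (norm x + (R + 1))"
    proof (rule conv_bounded_kernel(2)[OF f _ s])
      show "?q \<in> borel_measurable borel"
        by (intro borel_measurable_continuous_onI continuous_intros continuous_on_compose2[OF c(1)] c) auto
    qed (use d(3) h in auto)
    also have "\<dots> \<le> e / M * norm h * M" using e M by (intro mult_left_mono) (auto simp: M_def)
    also have "\<dots> = e * norm h" using M by simp
    finally show "norm (conv f k y - conv f k x - (\<Sum>i\<in>UNIV. (y - x) $ i * conv f (partial_deriv i k) x)) \<le> e * norm (y - x)"
      by (simp add: h_def)
  qed
qed

lemma Ck_conv:
  assumes f: "loc_integrable f"
  shows "Ck m k \<Longrightarrow> supp_in R k \<Longrightarrow> Ck m (conv f k)"
proof (induction m arbitrary: k)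
  case 0
  then show ?case using conv_continuous[OF f] by simp
next
  case (Suc m)
  have "Ck 1 k" using Ck_mono[OF Suc.prems(1), of 1] by simp
  show ?case
  proof (rule Ck_SucI(1)[OF conv_has_derivative[OF f \<open>Ck 1 k\<close> Suc.prems(2)]])
    show "Ck m (conv f (partial_deriv i k))" for i
      using Suc.prems(1) by (intro Suc.IH supp_in_partial_deriv[OF Suc.prems(2)]) simp
  qed
qed

lemma conv_bounded_L1:
  fixes f k :: "real^'n \<Rightarrow> real"
  assumes f: "f \<in> borel_measurable borel" "\<And>y. \<bar>f y\<bar> \<le> M" and k: "integrable lborel k"
  shows "integrable lborel (\<lambda>y. f y * k (x - y))"
    and "\<bar>conv f k x\<bar> \<le> M * (LINT z|lborel. \<bar>k z\<bar>)"
proof -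
  have [measurable]: "f \<in> borel_measurable borel" "k \<in> borel_measurable borel"
    using f k by auto
  have int: "integrable lborel (\<lambda>y. M * \<bar>k (x - y)\<bar>)"
    using k by (intro integrable_mult_right integrable_abs) (subst integrable_lborel_reflect, auto)
  have pt: "norm (f y * k (x - y)) \<le> M * \<bar>k (x - y)\<bar>" for y
    using f(2)[of y] by (simp add: abs_mult mult_right_mono)
  show i: "integrable lborel (\<lambda>y. f y * k (x - y))"
    by (rule Bochner_Integration.integrable_bound[OF int]) (auto intro!: AE_I2 order_trans[OF pt[unfolded real_norm_def] abs_ge_self])
  have "\<bar>conv f k x\<bar> \<le> (LINT y|lborel. norm (f y * k (x - y)))"
    unfolding conv_def real_norm_def by (rule integral_abs_bound)
  also have "\<dots> \<le> (LINT y|lborel. M * \<bar>k (x - y)\<bar>)"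
    by (rule integral_mono[OF integrable_norm[OF i] int pt])
  also have "\<dots> = M * (LINT z|lborel. \<bar>k z\<bar>)"
    using integral_lborel_reflect[of "\<lambda>z. \<bar>k z\<bar>" x] by simp
  finally show "\<bar>conv f k x\<bar> \<le> M * (LINT z|lborel. \<bar>k z\<bar>)" .
qed

lemma conv_diff_L1:
  fixes f k :: "real^'n \<Rightarrow> real"
  assumes f: "f \<in> borel_measurable borel" "\<And>y. \<bar>f y\<bar> \<le> M" and k: "integrable lborel k" "integrable lborel l"
  shows "\<bar>conv f k x - conv f l x\<bar> \<le> M * (LINT z|lborel. \<bar>k z - l z\<bar>)"
proof -
  have "conv f k x - conv f l x = conv f (\<lambda>z. k z - l z) x"
    unfolding conv_def right_diff_distrib
    by (rule Bochner_Integration.integral_diff[symmetric]) (intro conv_bounded_L1(1)[OF f] k)+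
  also have "\<bar>\<dots>\<bar> \<le> M * (LINT z|lborel. \<bar>k z - l z\<bar>)"
    by (rule conv_bounded_L1(2)[OF f]) (use k in auto)
  finally show ?thesis .
qed

lemma conv_L1_uniform_limit:
  fixes f :: "real^'n \<Rightarrow> real"
  assumes f: "f \<in> borel_measurable borel" "\<And>y. \<bar>f y\<bar> \<le> M"
    and k: "\<And>n. integrable lborel (k n)" "integrable lborel l" "(\<lambda>n. LINT z|lborel. \<bar>k n z - l z\<bar>) \<longlonglongrightarrow> 0"
  shows "uniform_limit UNIV (\<lambda>n. conv f (k n)) (conv f l) sequentially"
proof (rule uniform_limitI)
  fix e :: real assume "e > 0"
  have "(\<lambda>n. M * (LINT z|lborel. \<bar>k n z - l z\<bar>)) \<longlonglongrightarrow> M * 0" by (intro tendsto_intros k)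
  then have "\<forall>\<^sub>F n in sequentially. M * (LINT z|lborel. \<bar>k n z - l z\<bar>) < e"
    using \<open>e > 0\<close> by (intro order_tendstoD) auto
  then show "\<forall>\<^sub>F n in sequentially. \<forall>x\<in>UNIV. dist (conv f (k n) x) (conv f l x) < e"
    by eventually_elim (auto simp: dist_real_def intro: le_less_trans[OF conv_diff_L1[OF f k(1) k(2)]])
qed

text \<open>A kernel that is merely integrable, with integrable gradient, still yields a \<open>C\<^sup>1\<close> function when \<open>f\<close> is bounded:
  convergence in \<open>L\<^sup>1\<close> of smooth kernels and of their gradients becomes uniform convergence of the
  convolutions and of their gradients.\<close>

lemma conv_C1_singular_kernel:
  fixes f l :: "real^'n \<Rightarrow> real"
  assumes f: "f \<in> borel_measurable borel" "\<And>y. \<bar>f y\<bar> \<le> M"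
    and k: "\<And>n. Ck 1 (k n)" "\<And>n. supp_in R (k n)"
    and l: "integrable lborel l" "(\<lambda>n. LINT z|lborel. \<bar>k n z - l z\<bar>) \<longlonglongrightarrow> 0"
    and L: "\<And>i. integrable lborel (L i)" "\<And>i. (\<lambda>n. LINT z|lborel. \<bar>partial_deriv i (k n) z - L i z\<bar>) \<longlonglongrightarrow> 0"
  shows "Ck 1 (conv f l)" "partial_deriv i (conv f l) = conv f (L i)"
proof -
  have loc: "loc_integrable f" by (rule loc_integrable_bounded[OF f])
  have kc: "continuous_on UNIV (k n)" "continuous_on UNIV (partial_deriv i (k n))" for n i
    using Ck_imp_continuous[OF k(1)[of n]] k(1)[of n] by auto
  have ul: "uniform_limit UNIV (\<lambda>n. conv f (k n)) (conv f l) sequentially"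
    by (intro conv_L1_uniform_limit[OF f] l integrable_continuous_compact_support[OF kc(1) k(2)])
  have uL: "uniform_limit UNIV (\<lambda>n. conv f (partial_deriv i (k n))) (conv f (L i)) sequentially" for i
    by (intro conv_L1_uniform_limit[OF f] L
      integrable_continuous_compact_support[OF kc(2) supp_in_partial_deriv[OF k(2)]])
  have cont: "continuous_on UNIV (conv f (L i))" for i
    by (rule uniform_limit_theorem[OF _ uL])
      (use conv_continuous[OF loc kc(2) supp_in_partial_deriv[OF k(2)]] in auto)
  have "\<exists>g. \<forall>x\<in>UNIV. (\<lambda>n. conv f (k n) x) \<longlonglongrightarrow> g x \<and> (g has_derivative (\<lambda>h. \<Sum>i\<in>UNIV. h $ i * conv f (L i) x)) (at x within UNIV)"
  proof (rule has_derivative_sequence)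
    show "(conv f (k n) has_derivative (\<lambda>h. \<Sum>i\<in>UNIV. h $ i * conv f (partial_deriv i (k n)) x)) (at x within UNIV)" for n x
      using conv_has_derivative[OF loc k] by simp
    fix e :: real assume e: "e > 0"
    let ?e = "e / real CARD('n)"
    have "\<forall>\<^sub>F n in sequentially. \<forall>i. \<forall>x\<in>UNIV. dist (conv f (partial_deriv i (k n)) x) (conv f (L i) x) < ?e"
      using uL e by (subst eventually_all_finite) (auto simp: uniform_limit_iff)
    then show "\<forall>\<^sub>F n in sequentially. \<forall>x\<in>UNIV. \<forall>h. norm ((\<Sum>i\<in>UNIV. h $ i * conv f (partial_deriv i (k n)) x) - (\<Sum>i\<in>UNIV. h $ i * conv f (L i) x)) \<le> e * norm h"
    proof eventually_elim
      case (elim n)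
      show ?case
      proof (intro ballI allI)
        fix x h :: "real^'n"
        have "norm ((\<Sum>i\<in>UNIV. h $ i * conv f (partial_deriv i (k n)) x) - (\<Sum>i\<in>UNIV. h $ i * conv f (L i) x))
          = \<bar>\<Sum>i\<in>UNIV. h $ i * (conv f (partial_deriv i (k n)) x - conv f (L i) x)\<bar>"
          by (simp add: algebra_simps sum_subtractf)
        also have "\<dots> \<le> (\<Sum>i\<in>UNIV. \<bar>h $ i * (conv f (partial_deriv i (k n)) x - conv f (L i) x)\<bar>)" by (rule sum_abs)
        also have "\<dots> \<le> (\<Sum>i\<in>(UNIV::'n set). norm h * ?e)"
          unfolding abs_mult using elim
          by (intro sum_mono mult_mono component_le_norm_cart) (auto simp: dist_real_def less_imp_le)
        finally show "norm ((\<Sum>i\<in>UNIV. h $ i * conv f (partial_deriv i (k n)) x) - (\<Sum>i\<in>UNIV. h $ i * conv f (L i) x)) \<le> e * norm h"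
          by (simp add: mult.commute)
      qed
    qed
  next
    show "(\<lambda>n. conv f (k n) 0) \<longlonglongrightarrow> conv f l 0" using tendsto_uniform_limitI[OF ul] by simp
  qed auto
  then obtain g where g: "\<And>x. (\<lambda>n. conv f (k n) x) \<longlonglongrightarrow> g x" "\<And>x. (g has_derivative (\<lambda>h. \<Sum>i\<in>UNIV. h $ i * conv f (L i) x)) (at x)"
    by auto
  have "g = conv f l"
  proof
    fix x
    show "g x = conv f l x" using LIMSEQ_unique[OF g(1) tendsto_uniform_limitI[OF ul]] by simp
  qed
  then have der: "(conv f l has_derivative (\<lambda>h. \<Sum>i\<in>UNIV. h $ i * conv f (L i) x)) (at x)" for x using g(2) by simp
  show "Ck 1 (conv f l)" "partial_deriv i (conv f l) = conv f (L i)"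
    using Ck_SucI[of "conv f l" "\<lambda>i. conv f (L i)" 0, OF der] cont by simp_all
qed

section \<open>Testing against continuous functions\<close>

text \<open>Dominated convergence in the form in which it feeds \<open>conv_C1_singular_kernel\<close> and \<open>test_conv_limit_L1\<close>.\<close>

lemma L1_dominated_convergence:
  fixes k :: "nat \<Rightarrow> 'a::euclidean_space \<Rightarrow> real"
  assumes [measurable]: "\<And>n. k n \<in> borel_measurable borel" "l \<in> borel_measurable borel"
    and w: "integrable lborel w" "\<And>n. AE x in lborel. \<bar>k n x\<bar> \<le> w x"
    and lim: "AE x in lborel. (\<lambda>n. k n x) \<longlonglongrightarrow> l x"
  shows "integrable lborel l" "(\<lambda>n. LINT z|lborel. \<bar>k n z - l z\<bar>) \<longlonglongrightarrow> 0"
proof -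
  show l: "integrable lborel l"
    by (rule integrable_dominated_convergence[OF _ _ w(1) lim]) (use w in auto)
  have "(\<lambda>n. LINT z|lborel. \<bar>k n z - l z\<bar>) \<longlonglongrightarrow> (LINT z::'a|lborel. 0)"
  proof (rule integral_dominated_convergence[where w="\<lambda>x. w x + \<bar>l x\<bar>"])
    show "integrable lborel (\<lambda>x. w x + \<bar>l x\<bar>)" using w l by auto
    show "AE x in lborel. (\<lambda>n. \<bar>k n x - l x\<bar>) \<longlonglongrightarrow> 0"
      using lim by eventually_elim (auto intro: tendsto_rabs_zero simp: LIM_zero)
    show "AE x in lborel. norm \<bar>k n x - l x\<bar> \<le> w x + \<bar>l x\<bar>" for n
      using w(2)[of n] by eventually_elim auto
  qed auto
  then show "(\<lambda>n. LINT z|lborel. \<bar>k n z - l z\<bar>) \<longlonglongrightarrow> 0" by simp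
qed

lemma test_kernel_bounds:
  fixes \<phi> k :: "real^'n \<Rightarrow> real"
  assumes \<phi>: "continuous_on UNIV \<phi>" "supp_in S \<phi>" "\<And>z. \<bar>\<phi> z\<bar> \<le> B"
    and k: "integrable lborel k" "supp_in R k"
  shows "integrable lborel (\<lambda>x. \<phi> x * k (x - y))"
    and "supp_in (S + R) (\<lambda>y. LINT x|lborel. \<bar>\<phi> x * k (x - y)\<bar>)"
    and "supp_in (S + R) (\<lambda>y. LINT x|lborel. \<phi> x * k (x - y))"
    and "(LINT x|lborel. \<bar>\<phi> x * k (x - y)\<bar>) \<le> B * (LINT x|lborel. \<bar>k x\<bar>)"
proof -
  have [measurable]: "k \<in> borel_measurable borel" "\<phi> \<in> borel_measurable borel"
    using k \<phi> by (auto intro: borel_measurable_continuous_onI)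
  have int: "integrable lborel (\<lambda>x. B * \<bar>k (x - y)\<bar>)" for y
    using k by (intro integrable_mult_right integrable_abs) (subst integrable_lborel_translate, auto)
  have pt: "\<bar>\<phi> x * k (x - y)\<bar> \<le> B * \<bar>k (x - y)\<bar>" for x y
    using \<phi>(3)[of x] by (simp add: abs_mult mult_right_mono)
  show i: "integrable lborel (\<lambda>x. \<phi> x * k (x - y))"
    by (rule Bochner_Integration.integrable_bound[OF int]) (auto intro!: AE_I2 order_trans[OF pt abs_ge_self])
  have z: "\<phi> x * k (x - y) = 0" if "norm y > S + R" for x y
  proof -
    have "norm y \<le> norm x + norm (x - y)" by norm
    then have "norm x > S \<or> norm (x - y) > R" using that by linarith
    then show ?thesis using \<phi>(2) k(2) by (auto simp: supp_in_def)
  qed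
  show "supp_in (S + R) (\<lambda>y. LINT x|lborel. \<bar>\<phi> x * k (x - y)\<bar>)"
    "supp_in (S + R) (\<lambda>y. LINT x|lborel. \<phi> x * k (x - y))"
    unfolding supp_in_def by (simp_all add: z)
  have "(LINT x|lborel. \<bar>\<phi> x * k (x - y)\<bar>) \<le> (LINT x|lborel. B * \<bar>k (x - y)\<bar>)"
    by (rule integral_mono[OF integrable_abs[OF i] int pt])
  also have "\<dots> = B * (LINT x|lborel. \<bar>k x\<bar>)"
    using integral_lborel_translate[of "\<lambda>z. \<bar>k z\<bar>" y] by simp
  finally show "(LINT x|lborel. \<bar>\<phi> x * k (x - y)\<bar>) \<le> B * (LINT x|lborel. \<bar>k x\<bar>)" .
qed

text \<open>Moving the kernel from \<open>f\<close> to the continuous function \<open>\<phi>\<close>. For unbounded \<open>f\<close> and merely integrable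
  \<open>k\<close> the convolution need not be defined at every point, but the integral on the right is unproblematic.\<close>

lemma test_conv_Fubini:
  fixes \<phi> k f :: "real^'n \<Rightarrow> real"
  assumes f: "loc_integrable f" and \<phi>: "continuous_on UNIV \<phi>" "supp_in S \<phi>"
    and k: "integrable lborel k" "supp_in R k"
  shows "(LINT x|lborel. \<phi> x * conv f k x) = (LINT y|lborel. f y * (LINT x|lborel. \<phi> x * k (x - y)))"
proof -
  have [measurable]: "f \<in> borel_measurable borel" "k \<in> borel_measurable borel" "\<phi> \<in> borel_measurable borel"
    using f k \<phi> by (auto simp: loc_integrable_def intro: borel_measurable_continuous_onI)
  obtain B where B: "\<And>z. \<bar>\<phi> z\<bar> \<le> B" using bounded_compact_support \<phi> by blast
  note tk = test_kernel_bounds[OF \<phi> B k]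
  let ?F = "\<lambda>y x. f y * (\<phi> x * k (x - y))"
  have "integrable (lborel \<Otimes>\<^sub>M lborel) (\<lambda>(y, x). ?F y x)"
  proof (rule lborel_pair.Fubini_integrable)
    show "(\<lambda>(y, x). ?F y x) \<in> borel_measurable (lborel \<Otimes>\<^sub>M lborel)" by measurable
    show "AE y in lborel. integrable lborel (\<lambda>x. case (y, x) of (y, x) \<Rightarrow> ?F y x)"
      using tk(1) by (intro AE_I2) (simp only: prod.case, rule integrable_mult_right)
    have eq: "(LINT x|lborel. norm (?F y x)) = \<bar>f y\<bar> * (LINT x|lborel. \<bar>\<phi> x * k (x - y)\<bar>)" for y
      unfolding real_norm_def abs_mult[of "f y"] by (rule integral_mult_right_zero)
    have "integrable lborel (\<lambda>y. \<bar>f y\<bar> * (LINT x|lborel. \<bar>\<phi> x * k (x - y)\<bar>))"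
    proof (rule Bochner_Integration.integrable_bound)
      let ?c = "B * (LINT x|lborel. \<bar>k x\<bar>)"
      show "integrable lborel (\<lambda>y. ?c * (indicator (cball 0 (S + R)) y * f y))"
        using f by (intro integrable_mult_right) (simp add: loc_integrable_def)
      show "AE y in lborel. norm (\<bar>f y\<bar> * (LINT x|lborel. \<bar>\<phi> x * k (x - y)\<bar>)) \<le> norm (?c * (indicator (cball 0 (S + R)) y * f y))"
      proof (rule AE_I2)
        fix y
        have "\<bar>LINT x|lborel. \<bar>\<phi> x * k (x - y)\<bar>\<bar> \<le> \<bar>?c\<bar> * indicator (cball 0 (S + R)) y"
        proof (cases "norm y > S + R")
          case True
          then show ?thesis using tk(2) by (simp add: supp_in_def)
        next
          case False
          have "0 \<le> (LINT x|lborel. \<bar>\<phi> x * k (x - y)\<bar>)" by (rule integral_nonneg_AE) simp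
          then show ?thesis using False tk(4)[of y] by (simp add: indicator_def)
        qed
        then have "\<bar>f y\<bar> * \<bar>LINT x|lborel. \<bar>\<phi> x * k (x - y)\<bar>\<bar> \<le> \<bar>f y\<bar> * (\<bar>?c\<bar> * indicator (cball 0 (S + R)) y)"
          by (rule mult_left_mono) simp
        then show "norm (\<bar>f y\<bar> * (LINT x|lborel. \<bar>\<phi> x * k (x - y)\<bar>)) \<le> norm (?c * (indicator (cball 0 (S + R)) y * f y))"
          by (simp only: real_norm_def abs_mult abs_abs) (simp add: mult_ac)
      qed
    qed measurable
    then show "integrable lborel (\<lambda>y. LINT x|lborel. norm (case (y, x) of (y, x) \<Rightarrow> ?F y x))"
      by (simp only: prod.case eq)
  qed
  then have "(LINT x|lborel. LINT y|lborel. ?F y x) = (LINT y|lborel. LINT x|lborel. ?F y x)"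
    by (rule lborel_pair.Fubini_integral)
  moreover have "(LINT y|lborel. ?F y x) = \<phi> x * conv f k x" for x
    unfolding conv_def mult.left_commute[of "f _"] by (rule integral_mult_right_zero)
  moreover have "(LINT x|lborel. ?F y x) = f y * (LINT x|lborel. \<phi> x * k (x - y))" for y
    by (rule integral_mult_right_zero)
  ultimately show ?thesis by simp
qed

text \<open>Weak convergence of the kernels, with bounded mass, suffices for the convergence of the tested convolutions.
  This covers approximate identities, for which \<open>a\<close> is a multiple of \<open>\<phi>\<close>.\<close>

lemma test_conv_limit:
  fixes \<phi> f :: "real^'n \<Rightarrow> real"
  assumes f: "loc_integrable f" and \<phi>: "continuous_on UNIV \<phi>" "supp_in S \<phi>"
    and k: "\<And>n. integrable lborel (k n)" "\<And>n. supp_in R (k n)" "\<And>n. (LINT x|lborel. \<bar>k n x\<bar>) \<le> A"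
    and lim: "\<And>y. (\<lambda>n. LINT x|lborel. \<phi> x * k n (x - y)) \<longlonglongrightarrow> a y"
  shows "(\<lambda>n. LINT x|lborel. \<phi> x * conv f (k n) x) \<longlonglongrightarrow> (LINT y|lborel. f y * a y)"
proof -
  have [measurable]: "f \<in> borel_measurable borel" "\<And>n. k n \<in> borel_measurable borel" "\<phi> \<in> borel_measurable borel"
    using f k \<phi> by (auto simp: loc_integrable_def intro: borel_measurable_continuous_onI)
  obtain B where B: "\<And>z. \<bar>\<phi> z\<bar> \<le> B" using bounded_compact_support \<phi> by blast
  then have B0: "B \<ge> 0" using abs_ge_zero order_trans by blast
  have [measurable]: "a \<in> borel_measurable lborel"
    by (rule borel_measurable_LIMSEQ_real[OF lim]) measurable
  have "(\<lambda>n. LINT y|lborel. f y * (LINT x|lborel. \<phi> x * k n (x - y))) \<longlonglongrightarrow> (LINT y|lborel. f y * a y)"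
  proof (rule integral_dominated_convergence[where w="\<lambda>y. \<bar>B * A * (indicator (cball 0 (S + R)) y * f y)\<bar>"])
    show "integrable lborel (\<lambda>y. \<bar>B * A * (indicator (cball 0 (S + R)) y * f y)\<bar>)"
      using f by (intro integrable_mult_right integrable_abs) (simp add: loc_integrable_def)
    show "AE y in lborel. (\<lambda>n. f y * (LINT x|lborel. \<phi> x * k n (x - y))) \<longlonglongrightarrow> f y * a y"
      using lim by (intro AE_I2 tendsto_mult tendsto_const)
    show "AE y in lborel. norm (f y * (LINT x|lborel. \<phi> x * k n (x - y))) \<le> \<bar>B * A * (indicator (cball 0 (S + R)) y * f y)\<bar>" for n
    proof (rule AE_I2)
      fix y
      note tk = test_kernel_bounds[OF \<phi> B k(1,2), of n]
      have "\<bar>LINT x|lborel. \<phi> x * k n (x - y)\<bar> \<le> \<bar>B * A\<bar> * indicator (cball 0 (S + R)) y"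
      proof (cases "norm y > S + R")
        case True
        then show ?thesis using tk(3) by (simp add: supp_in_def)
      next
        case False
        have "\<bar>LINT x|lborel. \<phi> x * k n (x - y)\<bar> \<le> (LINT x|lborel. \<bar>\<phi> x * k n (x - y)\<bar>)" by (rule integral_abs_bound)
        also have "\<dots> \<le> B * (LINT x|lborel. \<bar>k n x\<bar>)" by (rule tk(4))
        also have "\<dots> \<le> B * A" by (intro mult_left_mono k B0)
        finally show ?thesis using False by (simp add: indicator_def)
      qed
      then have "\<bar>f y\<bar> * \<bar>LINT x|lborel. \<phi> x * k n (x - y)\<bar> \<le> \<bar>f y\<bar> * (\<bar>B * A\<bar> * indicator (cball 0 (S + R)) y)"
        by (rule mult_left_mono) simp
      then show "norm (f y * (LINT x|lborel. \<phi> x * k n (x - y))) \<le> \<bar>B * A * (indicator (cball 0 (S + R)) y * f y)\<bar>"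
        by (simp add: abs_mult mult_ac)
    qed
  qed measurable
  then show ?thesis using test_conv_Fubini[OF f \<phi> k(1,2)] by simp
qed

lemma test_conv_limit_L1:
  fixes \<phi> f :: "real^'n \<Rightarrow> real"
  assumes f: "loc_integrable f" and \<phi>: "continuous_on UNIV \<phi>" "supp_in S \<phi>"
    and k: "\<And>n. integrable lborel (k n)" "\<And>n. supp_in R (k n)"
    and l: "integrable lborel l" "supp_in R l" "(\<lambda>n. LINT x|lborel. \<bar>k n x - l x\<bar>) \<longlonglongrightarrow> 0"
  shows "(\<lambda>n. LINT x|lborel. \<phi> x * conv f (k n) x) \<longlonglongrightarrow> (LINT x|lborel. \<phi> x * conv f l x)"
proof -
  obtain B where B: "\<And>z. \<bar>\<phi> z\<bar> \<le> B" using bounded_compact_support \<phi> by blast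
  have "Bseq (\<lambda>n. LINT x|lborel. \<bar>k n x - l x\<bar>)" using l(3) by (intro convergent_imp_Bseq convergentI)
  then obtain K where K: "\<And>n. norm (LINT x|lborel. \<bar>k n x - l x\<bar>) \<le> K" by (auto simp: Bseq_def)
  have A: "(LINT x|lborel. \<bar>k n x\<bar>) \<le> K + (LINT x|lborel. \<bar>l x\<bar>)" for n
  proof -
    have "(LINT x|lborel. \<bar>k n x\<bar>) \<le> (LINT x|lborel. \<bar>k n x - l x\<bar> + \<bar>l x\<bar>)"
      using k(1)[of n] l(1) by (intro integral_mono) auto
    also have "\<dots> = (LINT x|lborel. \<bar>k n x - l x\<bar>) + (LINT x|lborel. \<bar>l x\<bar>)"
      using k(1)[of n] l(1) by (intro Bochner_Integration.integral_add) auto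
    finally show ?thesis using K[of n] by simp
  qed
  have "(\<lambda>n. LINT x|lborel. \<phi> x * k n (x - y)) \<longlonglongrightarrow> (LINT x|lborel. \<phi> x * l (x - y))" for y
  proof (rule Lim_null_comparison[where g="\<lambda>n. B * (LINT x|lborel. \<bar>k n x - l x\<bar>)", THEN LIM_zero_cancel])
    show "(\<lambda>n. B * (LINT x|lborel. \<bar>k n x - l x\<bar>)) \<longlonglongrightarrow> 0"
      using tendsto_mult_right_zero[OF l(3)] by simp
    show "\<forall>\<^sub>F n in sequentially. norm ((LINT x|lborel. \<phi> x * k n (x - y)) - (LINT x|lborel. \<phi> x * l (x - y))) \<le> B * (LINT x|lborel. \<bar>k n x - l x\<bar>)"
    proof (intro always_eventually allI)
      fix n
      have s: "supp_in R (\<lambda>x. k n x - l x)" and i: "integrable lborel (\<lambda>x. k n x - l x)"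
        using k l by (auto simp: supp_in_def)
      have "(LINT x|lborel. \<phi> x * k n (x - y)) - (LINT x|lborel. \<phi> x * l (x - y)) = (LINT x|lborel. \<phi> x * (k n (x - y) - l (x - y)))"
        unfolding right_diff_distrib
        by (rule Bochner_Integration.integral_diff[symmetric])
          (intro test_kernel_bounds(1)[OF \<phi> B k(1,2)] test_kernel_bounds(1)[OF \<phi> B l(1,2)])+
      also have "\<bar>\<dots>\<bar> \<le> (LINT x|lborel. \<bar>\<phi> x * (k n (x - y) - l (x - y))\<bar>)" by (rule integral_abs_bound)
      also have "\<dots> \<le> B * (LINT x|lborel. \<bar>k n x - l x\<bar>)"
        by (rule test_kernel_bounds(4)[OF \<phi> B i s])
      finally show "norm ((LINT x|lborel. \<phi> x * k n (x - y)) - (LINT x|lborel. \<phi> x * l (x - y))) \<le> B * (LINT x|lborel. \<bar>k n x - l x\<bar>)"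
        by simp
    qed
  qed
  from test_conv_limit[OF f \<phi> k A this] show ?thesis
    using test_conv_Fubini[OF f \<phi> l(1,2)] by simp
qed

text \<open>A measurable function is almost everywhere a limit of continuous ones. Applied to \<open>sgn d\<close>, truncated to
  \<open>[-1, 1]\<close> and multiplied by a continuous cutoff of a ball, this gives test functions whose integrals against
  \<open>d\<close> converge to the integral of \<open>|d|\<close> times the cutoff.\<close>

lemma AE_zero_if_orthogonal_to_continuous:
  fixes d :: "real^'n \<Rightarrow> real"
  assumes d: "loc_integrable d"
    and z: "\<And>\<phi> R. continuous_on UNIV \<phi> \<Longrightarrow> supp_in R \<phi> \<Longrightarrow> (LINT x|lborel. \<phi> x * d x) = 0"
  shows "AE x in lborel. d x = 0"
proof -
  have [measurable]: "d \<in> borel_measurable borel" using d by (simp add: loc_integrable_def)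
  have "(\<lambda>x. sgn (d x)) \<in> borel_measurable lebesgue"
    by (rule measurable_completion) (simp add: borel_measurable_sgn)
  then have "(\<lambda>x. sgn (d x)) measurable_on UNIV"
    by (rule lebesgue_measurable_imp_measurable_on) simp
  then obtain N g where N: "negligible N" and g: "\<And>n. continuous_on UNIV (g n)"
    "\<And>x. x \<notin> N \<Longrightarrow> (\<lambda>n. g n x) \<longlonglongrightarrow> sgn (d x)"
    by (auto simp: measurable_on_def)
  have ae: "AE x in lborel. (\<lambda>n. g n x) \<longlonglongrightarrow> sgn (d x)"
  proof -
    have "N \<in> null_sets lebesgue" using N negligible_iff_null_sets by blast
    then have "AE x in lebesgue. x \<notin> N" by (rule AE_not_in)
    then show ?thesis unfolding AE_completion_iff by eventually_elim (rule g(2))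
  qed
  have z0: "AE x in lborel. x \<in> cball 0 r \<longrightarrow> d x = 0" for r
  proof -
    define c where "c x = max 0 (min 1 (r + 1 - norm x))" for x :: "real^'n"
    define \<phi> where "\<phi> n x = c x * max (-1) (min 1 (g n x))" for n x
    have c: "continuous_on UNIV c" unfolding c_def by (intro continuous_intros)
    have \<phi>: "continuous_on UNIV (\<phi> n)" for n unfolding \<phi>_def by (intro continuous_intros c g)
    have c0: "0 \<le> c x" "c x \<le> 1" "norm x > r + 1 \<Longrightarrow> c x = 0" "norm x \<le> r \<Longrightarrow> c x = 1" for x
      by (auto simp: c_def)
    have s: "supp_in (r + 1) (\<phi> n)" for n using c0 by (auto simp: \<phi>_def supp_in_def)
    have [measurable]: "c \<in> borel_measurable borel" "\<phi> n \<in> borel_measurable borel" for n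
      using c \<phi> by (auto intro: borel_measurable_continuous_onI)
    have sc: "supp_in (r + 1) c" using c0 by (auto simp: supp_in_def)
    have i: "integrable lborel (\<lambda>x. c x * \<bar>d x\<bar>)"
    proof -
      have "integrable lborel (\<lambda>x. \<bar>c x * d x\<bar>)"
        by (intro integrable_abs integrable_continuous_mult_loc[OF c sc d])
      then show ?thesis using c0(1) by (simp add: abs_mult)
    qed
    have "(\<lambda>n. LINT x|lborel. \<phi> n x * d x) \<longlonglongrightarrow> (LINT x|lborel. c x * \<bar>d x\<bar>)"
    proof (rule integral_dominated_convergence[OF _ _ i])
      show "AE x in lborel. (\<lambda>n. \<phi> n x * d x) \<longlonglongrightarrow> c x * \<bar>d x\<bar>"
        using ae
      proof eventually_elim
        case (elim x)
        have "(\<lambda>n. \<phi> n x * d x) \<longlonglongrightarrow> c x * max (-1) (min 1 (sgn (d x))) * d x"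
          unfolding \<phi>_def by (intro tendsto_intros elim)
        moreover have "max (-1) (min 1 (sgn (d x))) * d x = \<bar>d x\<bar>" by (simp add: sgn_if)
        ultimately show ?case by (simp add: mult.assoc)
      qed
      show "AE x in lborel. norm (\<phi> n x * d x) \<le> c x * \<bar>d x\<bar>" for n
      proof (rule AE_I2)
        fix x
        have "\<bar>\<phi> n x\<bar> \<le> c x * 1" unfolding \<phi>_def abs_mult using c0(1)[of x] by (intro mult_mono) auto
        then show "norm (\<phi> n x * d x) \<le> c x * \<bar>d x\<bar>" by (simp add: abs_mult mult_right_mono)
      qed
    qed auto
    then have "(LINT x|lborel. c x * \<bar>d x\<bar>) = 0"
      using z[OF \<phi> s] by (simp add: LIMSEQ_const_iff)
    then have "AE x in lborel. c x * \<bar>d x\<bar> = 0"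
      by (subst (asm) integral_nonneg_eq_0_iff_AE[OF i]) (use c0 in auto)
    then show ?thesis by eventually_elim (use c0(4) in force)
  qed
  have "AE x in lborel. \<forall>n::nat. x \<in> cball 0 (real n) \<longrightarrow> d x = 0"
    by (subst AE_all_countable) (use z0 in blast)
  then show ?thesis
  proof eventually_elim
    case (elim x)
    obtain n where "norm x \<le> real n" using real_arch_simple by blast
    then show ?case using elim by auto
  qed
qed

section \<open>The parametrix and the regular representative\<close>

text \<open>For \<open>e = 0\<close> this is, up to a factor, the Newtonian potential of the plane cut off at distance \<open>4\<close>; for \<open>e > 0\<close>
  it is a test function.\<close>

definition newton :: "real \<Rightarrow> real^2 \<Rightarrow> real" where
  "newton e x = radial e cut_ln x"

definition newton_grad :: "real \<Rightarrow> 2 \<Rightarrow> real^2 \<Rightarrow> real" where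
  "newton_grad e i x = 2 * x $ i * radial e cut_ln' x"

text \<open>Together with the next function this is the Laplacian of \<open>newton e\<close>: with \<open>t = |x|\<^sup>2 + e\<close>,
  \<open>4 F'(t) + 4 |x|\<^sup>2 F''(t) = (4 F'(t) + 4 t F''(t)) - 4 e F''(t)\<close>.\<close>

definition lap_kernel :: "real \<Rightarrow> real^2 \<Rightarrow> real" where
  "lap_kernel e x = radial e lap_rest x"

text \<open>Near the origin \<open>F''(t) = -1/t\<^sup>2\<close>, so this equals \<open>4 e / (|x|\<^sup>2 + e)\<^sup>2\<close> there and concentrates at
  the origin as \<open>e\<close> tends to \<open>0\<close>, with mass tending to \<open>4 * bubble_mass\<close>.\<close>

definition peak :: "real \<Rightarrow> real^2 \<Rightarrow> real" where
  "peak e x = - 4 * e * radial e cut_ln'' x"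

lemma norm_gt_4: "norm x > 4 \<Longrightarrow> (norm x)\<^sup>2 > 16"
  using power_strict_mono[of 4 "norm x" 2] by simp

lemma supp_in_kernels:
  assumes "e \<ge> 0"
  shows "supp_in 4 (newton e)" "supp_in 4 (newton_grad e i)" "supp_in 4 (lap_kernel e)" "supp_in 4 (peak e)"
proof -
  have "(norm x)\<^sup>2 + e > 16" if "norm x > 4" for x :: "real^2" using norm_gt_4[OF that] assms by simp
  then show "supp_in 4 (newton e)" "supp_in 4 (newton_grad e i)" "supp_in 4 (lap_kernel e)" "supp_in 4 (peak e)"
    by (auto simp: supp_in_def newton_def newton_grad_def lap_kernel_def peak_def cut_ln_large lap_rest_large)
qed

lemma atLeast_subset_greaterThan: "e > 0 \<Longrightarrow> {e..} \<subseteq> {0::real<..}"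
  by auto

lemma Ck_newton: "e > 0 \<Longrightarrow> Ck k (newton e)"
  using Ck_radial[OF Ck_on_cut_ln[of k], of e 0] atLeast_subset_greaterThan[of e]
  by (simp add: newton_def[abs_def])

lemma Ck_peak: "e > 0 \<Longrightarrow> Ck k (peak e)"
  using Ck_mult[OF Ck_const Ck_radial[OF Ck_on_cut_ln''[of k], of e 0], of "- 4 * e"] atLeast_subset_greaterThan[of e]
  by (simp add: peak_def[abs_def])

lemma Ck_lap_kernel: "Ck k (lap_kernel e)"
  using Ck_radial[OF Ck_on_lap_rest[of k], of e 0] by (auto simp: lap_kernel_def[abs_def])

lemma partial_deriv_newton: "e > 0 \<Longrightarrow> partial_deriv i (newton e) = newton_grad e i"
  using partial_deriv_radial[of e cut_ln cut_ln' i 0] deriv_cut_ln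
  by (auto simp: newton_def[abs_def] newton_grad_def[abs_def])

lemma continuous_on_radial_punctured:
  assumes "continuous_on {0<..} F" "e \<ge> 0"
  shows "continuous_on (- {0}) (radial e F :: real^2 \<Rightarrow> real)"
  by (rule continuous_on_compose2[OF assms(1)])
    (use assms(2) in \<open>auto intro!: continuous_intros add_pos_nonneg\<close>)

lemma continuous_cut_ln: "continuous_on {0<..} cut_ln" "continuous_on {0<..} cut_ln'" "continuous_on {0<..} cut_ln''"
  using Ck_on_cut_ln[of 0] Ck_on_cut_ln'[of 0] Ck_on_cut_ln''[of 0] by simp_all

lemma borel_measurable_newton [measurable]: "e \<ge> 0 \<Longrightarrow> newton e \<in> borel_measurable borel"
  by (rule borel_measurable_continuous_countable_exceptions[of "{0}"])
    (auto simp: newton_def[abs_def] intro!: continuous_on_radial_punctured continuous_cut_ln)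

lemma borel_measurable_newton_grad [measurable]: "e \<ge> 0 \<Longrightarrow> newton_grad e i \<in> borel_measurable borel"
  by (rule borel_measurable_continuous_countable_exceptions[of "{0}"])
    (auto simp: newton_grad_def[abs_def] intro!: continuous_intros continuous_on_radial_punctured continuous_cut_ln)

text \<open>Majorants uniform in \<open>e\<close>: \<open>|x|\<^sup>2 + e \<ge> |x|\<^sup>2\<close>, and both the kernel and its gradient are at most of the
  order of \<open>1/|x|\<close>. The origin is excluded since \<open>riesz\<close> has the default value \<open>0\<close> there.\<close>

lemma newton_bounds:
  obtains C where "C > 0" "\<And>e x. e \<ge> 0 \<Longrightarrow> x \<noteq> 0 \<Longrightarrow> \<bar>newton e x\<bar> \<le> C * riesz 4 x"
    "\<And>e i x. e \<ge> 0 \<Longrightarrow> x \<noteq> 0 \<Longrightarrow> \<bar>newton_grad e i x\<bar> \<le> C * riesz 4 x"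
    "\<And>e x. e \<ge> 0 \<Longrightarrow> \<bar>lap_kernel e x\<bar> \<le> C * indicator (cball 0 4) x"
    "\<And>e x. e > 0 \<Longrightarrow> \<bar>peak e x\<bar> \<le> 4 * C * e / ((norm x)\<^sup>2 + e)\<^sup>2"
proof -
  obtain C where C: "C > 0" "\<And>t. t > 0 \<Longrightarrow> \<bar>cut_ln t\<bar> \<le> C / sqrt t"
    "\<And>t. t > 0 \<Longrightarrow> \<bar>cut_ln' t\<bar> \<le> C / t" "\<And>t. t > 0 \<Longrightarrow> \<bar>cut_ln'' t\<bar> \<le> C / t\<^sup>2"
    "\<And>t. \<bar>lap_rest t\<bar> \<le> C"
    by (rule cut_ln_bounds) blast
  show ?thesis
  proof (rule that[of "2 * C"])
    show "2 * C > 0" using C by simp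
    fix e :: real and x :: "real^2" and i :: 2
    show "\<bar>lap_kernel e x\<bar> \<le> 2 * C * indicator (cball 0 4) x" if "e \<ge> 0"
      using C(5)[of "(norm x)\<^sup>2 + e"] C(1) supp_in_kernels(3)[OF that]
      by (cases "norm x > 4") (auto simp: supp_in_def lap_kernel_def)
    show "\<bar>peak e x\<bar> \<le> 4 * (2 * C) * e / ((norm x)\<^sup>2 + e)\<^sup>2" if "e > 0"
    proof -
      have t: "(norm x)\<^sup>2 + e > 0" using that by (simp add: add_nonneg_pos)
      have "\<bar>peak e x\<bar> = 4 * e * \<bar>radial e cut_ln'' x\<bar>" using that by (simp add: peak_def abs_mult)
      also have "\<dots> \<le> 4 * e * (C / ((norm x)\<^sup>2 + e)\<^sup>2)" using that by (intro mult_left_mono C(4) t) auto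
      also have "\<dots> \<le> 4 * (2 * C) * e / ((norm x)\<^sup>2 + e)\<^sup>2"
        using that C(1) by (simp add: divide_right_mono)
      finally show ?thesis .
    qed
    assume e: "e \<ge> 0" and x: "x \<noteq> 0"
    have t: "(norm x)\<^sup>2 + e > 0" using e x by (simp add: add_pos_nonneg)
    show "\<bar>newton e x\<bar> \<le> 2 * C * riesz 4 x"
    proof (cases "norm x > 4")
      case True
      then show ?thesis using supp_in_kernels(1)[OF e] by (auto simp: supp_in_def riesz_def)
    next
      case False
      have "norm x \<le> sqrt ((norm x)\<^sup>2 + e)" using e by (simp add: real_le_rsqrt)
      then have "C / sqrt ((norm x)\<^sup>2 + e) \<le> 2 * C / norm x"
        using x C(1) e by (intro frac_le) auto
      then show ?thesis using C(2)[OF t] False by (simp add: newton_def riesz_def)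
    qed
    show "\<bar>newton_grad e i x\<bar> \<le> 2 * C * riesz 4 x"
    proof (cases "norm x > 4")
      case True
      then show ?thesis using supp_in_kernels(2)[OF e] by (auto simp: supp_in_def riesz_def)
    next
      case False
      have "C / ((norm x)\<^sup>2 + e) \<le> C / (norm x)\<^sup>2" using x C(1) e by (intro frac_le) auto
      then have "\<bar>radial e cut_ln' x\<bar> \<le> C / (norm x)\<^sup>2" using C(3)[OF t] by linarith
      then have "2 * \<bar>x $ i\<bar> * \<bar>radial e cut_ln' x\<bar> \<le> 2 * norm x * (C / (norm x)\<^sup>2)"
        by (intro mult_mono) (auto simp: component_le_norm_cart)
      also have "\<dots> = 2 * C / norm x" using x by (simp add: power2_eq_square)
      finally show ?thesis using False by (simp add: newton_grad_def riesz_def abs_mult)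
    qed
  qed
qed

lemma eps_tendsto: "(\<lambda>n. inverse (real (Suc n))) \<longlonglongrightarrow> 0"
  by (rule LIMSEQ_inverse_real_of_nat)

lemma radial_tendsto:
  assumes "continuous_on {0<..} F" "x \<noteq> 0"
  shows "(\<lambda>n. radial (inverse (real (Suc n))) F x) \<longlonglongrightarrow> radial 0 F x"
proof -
  have "isCont F ((norm x)\<^sup>2 + 0)" using assms by (simp add: continuous_on_eq_continuous_at)
  then show ?thesis
    by (rule isCont_tendsto_compose) (intro tendsto_intros eps_tendsto)
qed

lemma
  shows newton_L1: "integrable lborel (newton 0)"
      "(\<lambda>n. LINT z|lborel. \<bar>newton (inverse (real (Suc n))) z - newton 0 z\<bar>) \<longlonglongrightarrow> 0"
    and newton_grad_L1: "integrable lborel (newton_grad 0 i)"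
      "(\<lambda>n. LINT z|lborel. \<bar>newton_grad (inverse (real (Suc n))) i z - newton_grad 0 i z\<bar>) \<longlonglongrightarrow> 0"
    and lap_kernel_L1: "integrable lborel (lap_kernel 0)"
      "(\<lambda>n. LINT z|lborel. \<bar>lap_kernel (inverse (real (Suc n))) z - lap_kernel 0 z\<bar>) \<longlonglongrightarrow> 0"
proof -
  obtain C where C: "C > 0" "\<And>e x. e \<ge> 0 \<Longrightarrow> x \<noteq> 0 \<Longrightarrow> \<bar>newton e x\<bar> \<le> C * riesz 4 x"
    "\<And>e i x. e \<ge> 0 \<Longrightarrow> x \<noteq> 0 \<Longrightarrow> \<bar>newton_grad e i x\<bar> \<le> C * riesz 4 x"
    "\<And>e x. e \<ge> 0 \<Longrightarrow> \<bar>lap_kernel e x\<bar> \<le> C * indicator (cball 0 4) x"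
    by (rule newton_bounds) blast
  have nz: "AE x in lborel. (x::real^2) \<noteq> 0" by (rule AE_lborel_singleton)
  have w: "integrable lborel (\<lambda>x. C * riesz 4 x)" by (intro integrable_mult_right integrable_riesz)
  have w': "integrable lborel (\<lambda>x::real^2. C * indicator (cball 0 4) x)"
    by (intro integrable_mult_right) (auto intro!: integrable_real_indicator emeasure_compact_finite)
  have "AE x in lborel. \<bar>newton (inverse (real (Suc n))) x\<bar> \<le> C * riesz 4 x" for n
    using nz by eventually_elim (intro C, auto)
  moreover have "AE x in lborel. (\<lambda>n. newton (inverse (real (Suc n))) x) \<longlonglongrightarrow> newton 0 x"
    using nz by eventually_elim (unfold newton_def, intro radial_tendsto continuous_cut_ln, auto)
  ultimately show "integrable lborel (newton 0)"
      "(\<lambda>n. LINT z|lborel. \<bar>newton (inverse (real (Suc n))) z - newton 0 z\<bar>) \<longlonglongrightarrow> 0"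
    by (intro L1_dominated_convergence[OF _ _ w]; simp)+
  have "AE x in lborel. \<bar>newton_grad (inverse (real (Suc n))) i x\<bar> \<le> C * riesz 4 x" for n
    using nz by eventually_elim (intro C, auto)
  moreover have "AE x in lborel. (\<lambda>n. newton_grad (inverse (real (Suc n))) i x) \<longlonglongrightarrow> newton_grad 0 i x"
    using nz by eventually_elim (unfold newton_grad_def, intro tendsto_intros radial_tendsto continuous_cut_ln, auto)
  ultimately show "integrable lborel (newton_grad 0 i)"
      "(\<lambda>n. LINT z|lborel. \<bar>newton_grad (inverse (real (Suc n))) i z - newton_grad 0 i z\<bar>) \<longlonglongrightarrow> 0"
    by (intro L1_dominated_convergence[OF _ _ w]; simp)+
  have [measurable]: "lap_kernel e \<in> borel_measurable borel" for e
    using Ck_imp_continuous[OF Ck_lap_kernel] by (rule borel_measurable_continuous_onI)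
  have "AE x in lborel. \<bar>lap_kernel (inverse (real (Suc n))) x\<bar> \<le> C * indicator (cball 0 4) x" for n
    by (intro AE_I2 C) auto
  moreover have "AE x in lborel. (\<lambda>n. lap_kernel (inverse (real (Suc n))) x) \<longlonglongrightarrow> lap_kernel 0 x"
  proof (rule AE_I2)
    fix x :: "real^2"
    have "isCont lap_rest ((norm x)\<^sup>2 + 0)" using Ck_on_lap_rest[of 0] by (simp add: continuous_on_eq_continuous_at)
    then show "(\<lambda>n. lap_kernel (inverse (real (Suc n))) x) \<longlonglongrightarrow> lap_kernel 0 x"
      unfolding lap_kernel_def by (rule isCont_tendsto_compose) (intro tendsto_intros eps_tendsto)
  qed
  ultimately show "integrable lborel (lap_kernel 0)"
      "(\<lambda>n. LINT z|lborel. \<bar>lap_kernel (inverse (real (Suc n))) z - lap_kernel 0 z\<bar>) \<longlonglongrightarrow> 0"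
    by (intro L1_dominated_convergence[OF _ _ w']; simp)+
qed

text \<open>The weak equation for the test function \<open>y \<mapsto> newton e (x - y)\<close>, whose Laplacian is that of a radial function.\<close>

lemma parametrix_identity:
  assumes weak: "\<And>\<phi>. test_function \<phi> \<Longrightarrow> (LINT y|lborel. \<psi> y * laplacian \<phi> y) = (LINT y|lborel. g y * \<phi> y)"
    and \<psi>: "loc_integrable \<psi>" and e: "e > 0"
  shows "conv \<psi> (lap_kernel e) x + conv \<psi> (peak e) x = conv g (newton e) x"
proof -
  define \<phi> where "\<phi> = (\<lambda>y. radial e cut_ln (y - x))"
  have "test_function \<phi>"
  proof (rule test_functionI)
    show "Ck k \<phi>" for k unfolding \<phi>_def by (rule Ck_radial[OF Ck_on_cut_ln]) (use e in auto)
    fix y assume "\<phi> y \<noteq> 0"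
    then show "y \<in> cball x 4"
      using supp_in_kernels(1)[of e] e by (force simp: \<phi>_def supp_in_def newton_def dist_norm norm_minus_commute not_le)
  qed
  then have "(LINT y|lborel. \<psi> y * laplacian \<phi> y) = (LINT y|lborel. g y * \<phi> y)" by (rule weak)
  moreover have "laplacian \<phi> y = lap_kernel e (x - y) + peak e (x - y)" for y
  proof -
    let ?t = "(norm (y - x))\<^sup>2 + e"
    have t: "?t > 0" using e by (simp add: add_nonneg_pos)
    have "laplacian \<phi> y = 4 * cut_ln' ?t + 4 * (norm (y - x))\<^sup>2 * cut_ln'' ?t"
      unfolding \<phi>_def by (rule laplacian_radial) (use e deriv_cut_ln deriv_cut_ln' in auto)
    also have "\<dots> = (4 * cut_ln' ?t + 4 * ?t * cut_ln'' ?t) - 4 * e * cut_ln'' ?t"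
      by (simp add: algebra_simps)
    finally show ?thesis using lap_rest_eq[OF t] by (simp add: lap_kernel_def peak_def norm_minus_commute)
  qed
  moreover have "\<phi> y = newton e (x - y)" for y by (simp add: \<phi>_def newton_def norm_minus_commute)
  moreover have "(LINT y|lborel. \<psi> y * (lap_kernel e (x - y) + peak e (x - y))) = conv \<psi> (lap_kernel e) x + conv \<psi> (peak e) x"
    unfolding conv_def distrib_left
    by (rule Bochner_Integration.integral_add)
      (use e in \<open>auto intro!: integrable_conv_continuous[OF \<psi>] supp_in_kernels Ck_imp_continuous[OF Ck_lap_kernel] Ck_imp_continuous[OF Ck_peak]\<close>)
  ultimately show ?thesis by (simp add: conv_def)
qed

lemma peak_mass_bounded:
  obtains A where "\<And>e. e > 0 \<Longrightarrow> (LINT x|lborel. \<bar>peak e x\<bar>) \<le> A"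
proof -
  obtain C where C: "C > 0" "\<And>e x. e > 0 \<Longrightarrow> \<bar>peak e x\<bar> \<le> 4 * C * e / ((norm x)\<^sup>2 + e)\<^sup>2"
    by (rule newton_bounds) blast
  have "(LINT x|lborel. \<bar>peak e x\<bar>) \<le> 4 * C * bubble_mass" if e: "e > 0" for e
  proof -
    have r: "sqrt e > 0" "(sqrt e)\<^sup>2 = e" using e by auto
    have "(LINT x|lborel. \<bar>peak e x\<bar>) \<le> (LINT x::real^2|lborel. (4 * C * e) * (1 / ((norm x)\<^sup>2 + e)\<^sup>2))"
    proof (rule integral_mono)
      show "integrable lborel (\<lambda>x. \<bar>peak e x\<bar>)"
        using e by (intro integrable_abs integrable_continuous_compact_support[of _ 4] supp_in_kernels Ck_imp_continuous[OF Ck_peak]) auto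
      show "integrable lborel (\<lambda>x::real^2. (4 * C * e) * (1 / ((norm x)\<^sup>2 + e)\<^sup>2))"
        using integrable_bubble_scaled[OF r(1)] r(2) by (intro integrable_mult_right) simp
    qed (use C(2)[OF e] in auto)
    also have "\<dots> = (4 * C * e) * (bubble_mass / e)"
      using integral_bubble_scaled[OF r(1)] r(2) by (simp only: integral_mult_right_zero)
    also have "\<dots> = 4 * C * bubble_mass" using e by simp
    finally show ?thesis .
  qed
  then show ?thesis by (rule that)
qed

text \<open>With \<open>e = r\<^sup>2\<close> and \<open>x = y + r z\<close> the integrand becomes \<open>\<phi>(y + r z) w(z)\<close>, where
  \<open>w(z) = -4 r\<^sup>4 F''(r\<^sup>2 (|z|\<^sup>2 + 1))\<close> is dominated by a multiple of \<open>1/(|z|\<^sup>2 + 1)\<^sup>2\<close> and is equal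
  to \<open>4/(|z|\<^sup>2 + 1)\<^sup>2\<close> once \<open>r\<^sup>2 (|z|\<^sup>2 + 1) < 9\<close>.\<close>

lemma peak_approximate_identity:
  assumes \<phi>: "continuous_on UNIV \<phi>" "supp_in S \<phi>"
  shows "(\<lambda>n. LINT x|lborel. \<phi> x * peak (inverse (real (Suc n))) (x - y)) \<longlonglongrightarrow> 4 * bubble_mass * \<phi> y"
proof -
  obtain B where B: "\<And>z. \<bar>\<phi> z\<bar> \<le> B" using bounded_compact_support \<phi> by blast
  obtain C where C: "C > 0" "\<And>e x. e > 0 \<Longrightarrow> \<bar>peak e x\<bar> \<le> 4 * C * e / ((norm x)\<^sup>2 + e)\<^sup>2"
    by (rule newton_bounds) blast
  have [measurable]: "\<phi> \<in> borel_measurable borel" using \<phi> by (auto intro: borel_measurable_continuous_onI)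
  have [measurable]: "peak e \<in> borel_measurable borel" if "e > 0" for e
    using Ck_imp_continuous[OF Ck_peak[OF that]] by (rule borel_measurable_continuous_onI)
  define r where "r n = sqrt (inverse (real (Suc n)))" for n
  have r: "r n > 0" "(r n)\<^sup>2 = inverse (real (Suc n))" for n by (auto simp: r_def)
  have rlim: "r \<longlonglongrightarrow> 0" unfolding r_def using tendsto_real_sqrt[OF eps_tendsto] by simp
  have scaled: "(r n)\<^sup>2 * peak ((r n)\<^sup>2) (r n *\<^sub>R z) = - 4 * (r n) ^ 4 * cut_ln'' ((r n)\<^sup>2 * ((norm z)\<^sup>2 + 1))" for n z
    by (simp add: peak_def power_mult_distrib algebra_simps power2_eq_square power4_eq_xxxx)
  have pos: "(norm z)\<^sup>2 + 1 > 0" for z :: "real^2" by (simp add: add_nonneg_pos)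
  have eq: "(LINT x|lborel. \<phi> x * peak (inverse (real (Suc n))) (x - y)) = (LINT z|lborel. \<phi> (y + r n *\<^sub>R z) * ((r n)\<^sup>2 * peak ((r n)\<^sup>2) (r n *\<^sub>R z)))" for n
  proof -
    have "(LINT x|lborel. \<phi> x * peak ((r n)\<^sup>2) (x - y)) = \<bar>r n\<bar> ^ DIM(real^2) * (LINT z|lborel. \<phi> (y + r n *\<^sub>R z) * peak ((r n)\<^sup>2) (y + r n *\<^sub>R z - y))"
      by (rule integral_lborel_affine) (use r[of n] in auto)
    also have "\<dots> = (LINT z|lborel. (r n)\<^sup>2 * (\<phi> (y + r n *\<^sub>R z) * peak ((r n)\<^sup>2) (r n *\<^sub>R z)))"
      unfolding integral_mult_right_zero using r(1)[of n] by simp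
    finally show ?thesis using r(2)[of n] by (simp only: mult.left_commute)
  qed
  have "(\<lambda>n. LINT z|lborel. \<phi> (y + r n *\<^sub>R z) * ((r n)\<^sup>2 * peak ((r n)\<^sup>2) (r n *\<^sub>R z))) \<longlonglongrightarrow> (LINT z::real^2|lborel. \<phi> y * (4 * (1 / ((norm z)\<^sup>2 + 1)\<^sup>2)))"
  proof (rule integral_dominated_convergence[where w="\<lambda>z. B * (4 * C * (1 / ((norm z)\<^sup>2 + 1)\<^sup>2))"])
    show "integrable lborel (\<lambda>z::real^2. B * (4 * C * (1 / ((norm z)\<^sup>2 + 1)\<^sup>2)))"
      by (intro integrable_mult_right integrable_bubble)
    show "(\<lambda>z. \<phi> (y + r n *\<^sub>R z) * ((r n)\<^sup>2 * peak ((r n)\<^sup>2) (r n *\<^sub>R z))) \<in> borel_measurable lborel" for n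
    proof -
      have "continuous_on UNIV (\<lambda>z. \<phi> (y + r n *\<^sub>R z) * ((r n)\<^sup>2 * peak ((r n)\<^sup>2) (r n *\<^sub>R z)))"
        using r(1)[of n]
        by (intro continuous_intros continuous_on_compose2[OF \<phi>(1)] continuous_on_compose2[OF Ck_imp_continuous[OF Ck_peak]]) auto
      then show ?thesis by (simp add: borel_measurable_continuous_onI)
    qed
    show "AE z in lborel. norm (\<phi> (y + r n *\<^sub>R z) * ((r n)\<^sup>2 * peak ((r n)\<^sup>2) (r n *\<^sub>R z))) \<le> B * (4 * C * (1 / ((norm z)\<^sup>2 + 1)\<^sup>2))" for n
    proof (rule AE_I2)
      fix z :: "real^2"
      have rr: "(r n)\<^sup>2 > 0" using r(1)[of n] by simp
      have "\<bar>(r n)\<^sup>2 * peak ((r n)\<^sup>2) (r n *\<^sub>R z)\<bar> \<le> (r n)\<^sup>2 * (4 * C * (r n)\<^sup>2 / ((norm (r n *\<^sub>R z))\<^sup>2 + (r n)\<^sup>2)\<^sup>2)"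
        unfolding abs_mult abs_of_pos[OF rr] by (rule mult_left_mono[OF C(2)[OF rr] zero_le_power2])
      also have "(norm (r n *\<^sub>R z))\<^sup>2 + (r n)\<^sup>2 = (r n)\<^sup>2 * ((norm z)\<^sup>2 + 1)"
        by (simp add: power_mult_distrib algebra_simps)
      also have "(r n)\<^sup>2 * (4 * C * (r n)\<^sup>2 / ((r n)\<^sup>2 * ((norm z)\<^sup>2 + 1))\<^sup>2) = 4 * C * (1 / ((norm z)\<^sup>2 + 1)\<^sup>2)"
      proof -
        have "a * (4 * C * a / (a * b)\<^sup>2) = 4 * C * (1 / b\<^sup>2)" if "a > 0" for a b :: real
        proof -
          have "a * (4 * C * a / (a * b)\<^sup>2) = (a\<^sup>2 * (4 * C)) / (a\<^sup>2 * b\<^sup>2)"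
            by (simp only: power_mult_distrib power2_eq_square times_divide_eq_right ac_simps)
          then show ?thesis using that by simp
        qed
        from this[OF rr, of "(norm z)\<^sup>2 + 1"] show ?thesis .
      qed
      finally show "norm (\<phi> (y + r n *\<^sub>R z) * ((r n)\<^sup>2 * peak ((r n)\<^sup>2) (r n *\<^sub>R z))) \<le> B * (4 * C * (1 / ((norm z)\<^sup>2 + 1)\<^sup>2))"
        unfolding real_norm_def abs_mult[of "\<phi> _"] using B[of "y + r n *\<^sub>R z"] by (intro mult_mono) auto
    qed
    show "AE z in lborel. (\<lambda>n. \<phi> (y + r n *\<^sub>R z) * ((r n)\<^sup>2 * peak ((r n)\<^sup>2) (r n *\<^sub>R z))) \<longlonglongrightarrow> \<phi> y * (4 * (1 / ((norm z)\<^sup>2 + 1)\<^sup>2))"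
    proof (rule AE_I2, rule tendsto_mult)
      fix z :: "real^2"
      have "(\<lambda>n. y + r n *\<^sub>R z) \<longlonglongrightarrow> y + 0 *\<^sub>R z" by (intro tendsto_intros rlim)
      then have "(\<lambda>n. y + r n *\<^sub>R z) \<longlonglongrightarrow> y" by simp
      moreover have "isCont \<phi> y" using \<phi>(1) by (simp add: continuous_on_eq_continuous_at)
      ultimately show "(\<lambda>n. \<phi> (y + r n *\<^sub>R z)) \<longlonglongrightarrow> \<phi> y" by (rule isCont_tendsto_compose[rotated])
      have "(\<lambda>n. (r n)\<^sup>2 * ((norm z)\<^sup>2 + 1)) \<longlonglongrightarrow> 0\<^sup>2 * ((norm z)\<^sup>2 + 1)" by (intro tendsto_intros rlim)
      then have "\<forall>\<^sub>F n in sequentially. (r n)\<^sup>2 * ((norm z)\<^sup>2 + 1) < 9" by (rule order_tendstoD) simp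
      then have "\<forall>\<^sub>F n in sequentially. 4 * (1 / ((norm z)\<^sup>2 + 1)\<^sup>2) = (r n)\<^sup>2 * peak ((r n)\<^sup>2) (r n *\<^sub>R z)"
      proof eventually_elim
        case (elim n)
        have "(r n)\<^sup>2 * ((norm z)\<^sup>2 + 1) > 0" using r(1)[of n] pos by simp
        then show ?case unfolding scaled using elim r(1)[of n]
          by (simp add: cut_ln_small power_mult_distrib)
      qed
      then show "(\<lambda>n. (r n)\<^sup>2 * peak ((r n)\<^sup>2) (r n *\<^sub>R z)) \<longlonglongrightarrow> 4 * (1 / ((norm z)\<^sup>2 + 1)\<^sup>2)"
        by (rule Lim_transform_eventually[OF tendsto_const])
    qed
  qed auto
  then show ?thesis unfolding eq integral_mult_right_zero by (simp add: bubble_mass_def mult_ac)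
qed

definition regular_rep :: "(real^2 \<Rightarrow> real) \<Rightarrow> (real^2 \<Rightarrow> real) \<Rightarrow> real^2 \<Rightarrow> real" where
  "regular_rep g \<psi> x = 1 / (4 * bubble_mass) * (conv g (newton 0) x + (- 1) * conv \<psi> (lap_kernel 0) x)"

lemma conv_newton_C1:
  assumes g: "g \<in> borel_measurable borel" "\<And>y. \<bar>g y\<bar> \<le> M"
  shows "Ck 1 (conv g (newton 0))" "partial_deriv i (conv g (newton 0)) = conv g (newton_grad 0 i)"
proof -
  have *: "Ck 1 (newton (inverse (real (Suc n))))" "supp_in 4 (newton (inverse (real (Suc n))))"
    "partial_deriv i (newton (inverse (real (Suc n)))) = newton_grad (inverse (real (Suc n))) i" for n i
    by (auto intro: Ck_newton supp_in_kernels partial_deriv_newton simp del: Ck.simps One_nat_def)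
  show "Ck 1 (conv g (newton 0))" "partial_deriv i (conv g (newton 0)) = conv g (newton_grad 0 i)"
    by (rule conv_C1_singular_kernel[OF g, where k="\<lambda>n. newton (inverse (real (Suc n)))" and L="newton_grad 0" and R=4];
        (simp only: * newton_L1 newton_grad_L1)?)+
qed

text \<open>The parametrix identity is integrated against a continuous \<open>\<phi>\<close> of compact support and \<open>e\<close> tends to \<open>0\<close>. The
  peak reproduces \<open>\<psi>\<close>, the other two kernels converge in \<open>L\<^sup>1\<close>.\<close>

lemma regular_rep_AE:
  assumes weak: "\<And>\<phi>. test_function \<phi> \<Longrightarrow> (LINT y|lborel. \<psi> y * laplacian \<phi> y) = (LINT y|lborel. g y * \<phi> y)"
    and \<psi>: "loc_integrable \<psi>" and g: "g \<in> borel_measurable borel" "\<And>y. \<bar>g y\<bar> \<le> M"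
  shows "AE x in lborel. regular_rep g \<psi> x = \<psi> x"
proof -
  have gl: "loc_integrable g" by (rule loc_integrable_bounded[OF g])
  let ?e = "\<lambda>n. inverse (real (Suc n))"
  have cn: "continuous_on UNIV (conv g (newton 0))" using conv_newton_C1(1)[OF g] by (rule Ck_imp_continuous)
  have cl: "continuous_on UNIV (conv \<psi> (lap_kernel 0))"
    by (rule conv_continuous[OF \<psi> Ck_imp_continuous[OF Ck_lap_kernel] supp_in_kernels(3)]) simp
  have cne: "continuous_on UNIV (newton (?e n))" "continuous_on UNIV (peak (?e n))" for n
    by (rule Ck_imp_continuous, rule Ck_newton Ck_peak, simp)+
  have "AE x in lborel. \<psi> x - regular_rep g \<psi> x = 0"
  proof (rule AE_zero_if_orthogonal_to_continuous)
    have cr: "continuous_on UNIV (regular_rep g \<psi>)"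
      unfolding regular_rep_def[abs_def] by (intro continuous_intros cn cl)
    show "loc_integrable (\<lambda>x. \<psi> x - regular_rep g \<psi> x)"
      by (intro loc_integrable_diff \<psi> loc_integrable_continuous cr)
    fix \<phi> R assume \<phi>: "continuous_on UNIV \<phi>" "supp_in R (\<phi> :: real^2 \<Rightarrow> real)"
    note mi = integrable_continuous_mult_loc[OF \<phi>]
    obtain A where A: "\<And>e. e > 0 \<Longrightarrow> (LINT x|lborel. \<bar>peak e x\<bar>) \<le> A" by (rule peak_mass_bounded) blast
    have N: "(\<lambda>n. LINT x|lborel. \<phi> x * conv g (newton (?e n)) x) \<longlonglongrightarrow> (LINT x|lborel. \<phi> x * conv g (newton 0) x)"
      by (rule test_conv_limit_L1[OF gl \<phi> _ _ newton_L1(1) _ newton_L1(2), where R=4])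
        (intro integrable_continuous_compact_support[of _ 4] supp_in_kernels cne; simp)+
    have L: "(\<lambda>n. LINT x|lborel. \<phi> x * conv \<psi> (lap_kernel (?e n)) x) \<longlonglongrightarrow> (LINT x|lborel. \<phi> x * conv \<psi> (lap_kernel 0) x)"
      by (rule test_conv_limit_L1[OF \<psi> \<phi> _ _ lap_kernel_L1(1) _ lap_kernel_L1(2), where R=4])
        (intro integrable_continuous_compact_support[of _ 4] supp_in_kernels Ck_imp_continuous[OF Ck_lap_kernel]; simp)+
    have P: "(\<lambda>n. LINT x|lborel. \<phi> x * conv \<psi> (peak (?e n)) x) \<longlonglongrightarrow> (LINT y|lborel. \<psi> y * (4 * bubble_mass * \<phi> y))"
      by (rule test_conv_limit[OF \<psi> \<phi> _ _ _ peak_approximate_identity[OF \<phi>], where R=4 and A=A])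
        (intro integrable_continuous_compact_support[of _ 4] supp_in_kernels cne A; simp)+
    have eq: "(LINT x|lborel. \<phi> x * conv \<psi> (lap_kernel (?e n)) x) + (LINT x|lborel. \<phi> x * conv \<psi> (peak (?e n)) x) = (LINT x|lborel. \<phi> x * conv g (newton (?e n)) x)" for n
    proof -
      have "(LINT x|lborel. \<phi> x * conv \<psi> (lap_kernel (?e n)) x) + (LINT x|lborel. \<phi> x * conv \<psi> (peak (?e n)) x)
        = (LINT x|lborel. \<phi> x * conv \<psi> (lap_kernel (?e n)) x + \<phi> x * conv \<psi> (peak (?e n)) x)"
        by (rule Bochner_Integration.integral_add[symmetric])
          (intro mi loc_integrable_continuous conv_continuous[OF \<psi>, where R=4] supp_in_kernels cne Ck_imp_continuous[OF Ck_lap_kernel]; simp)+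
      also have "\<dots> = (LINT x|lborel. \<phi> x * conv g (newton (?e n)) x)"
        by (simp only: distrib_left[symmetric]) (subst parametrix_identity[OF weak \<psi>], auto)
      finally show ?thesis .
    qed
    have "(LINT x|lborel. \<phi> x * conv \<psi> (lap_kernel 0) x) + (LINT y|lborel. \<psi> y * (4 * bubble_mass * \<phi> y)) = (LINT x|lborel. \<phi> x * conv g (newton 0) x)"
      using LIMSEQ_unique[OF tendsto_add[OF L P, unfolded eq] N] .
    moreover have "(LINT y|lborel. \<psi> y * (4 * bubble_mass * \<phi> y)) = 4 * bubble_mass * (LINT y|lborel. \<phi> y * \<psi> y)"
      by (subst integral_mult_right_zero[symmetric]) (simp only: mult_ac)
    ultimately have *: "(LINT x|lborel. \<phi> x * conv g (newton 0) x) - (LINT x|lborel. \<phi> x * conv \<psi> (lap_kernel 0) x) = 4 * bubble_mass * (LINT y|lborel. \<phi> y * \<psi> y)"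
      by simp
    have "(LINT x|lborel. \<phi> x * regular_rep g \<psi> x) = (LINT x|lborel. 1 / (4 * bubble_mass) * (\<phi> x * conv g (newton 0) x - \<phi> x * conv \<psi> (lap_kernel 0) x))"
      by (simp add: regular_rep_def algebra_simps)
    also have "\<dots> = 1 / (4 * bubble_mass) * ((LINT x|lborel. \<phi> x * conv g (newton 0) x) - (LINT x|lborel. \<phi> x * conv \<psi> (lap_kernel 0) x))"
      by (subst integral_mult_right_zero, subst Bochner_Integration.integral_diff)
        (auto intro!: mi loc_integrable_continuous cn cl)
    also have "\<dots> = (LINT y|lborel. \<phi> y * \<psi> y)" unfolding * using bubble_mass_pos by simp
    finally have r: "(LINT x|lborel. \<phi> x * regular_rep g \<psi> x) = (LINT y|lborel. \<phi> y * \<psi> y)" .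
    show "(LINT x|lborel. \<phi> x * (\<psi> x - regular_rep g \<psi> x)) = 0"
      unfolding right_diff_distrib
      by (subst Bochner_Integration.integral_diff) (auto intro!: mi \<psi> loc_integrable_continuous cr simp: r)
  qed
  then show ?thesis by eventually_elim simp
qed

section \<open>The gradient of the Newtonian potential near the centre of symmetry\<close>

lemma C1_Lipschitz_at_0:
  fixes u :: "real^'n \<Rightarrow> real"
  assumes "Ck 1 u"
  obtains L where "\<And>x. norm x \<le> 1 \<Longrightarrow> \<bar>u x - u 0\<bar> \<le> L * norm x"
proof -
  have c: "continuous_on UNIV (\<lambda>z. \<Sum>i\<in>UNIV. \<bar>partial_deriv i u z\<bar>)"
    using assms by (intro continuous_intros) auto
  have "compact ((\<lambda>z. \<Sum>i\<in>UNIV. \<bar>partial_deriv i u z\<bar>) ` cball 0 1)"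
    by (intro compact_continuous_image continuous_on_subset[OF c]) auto
  then obtain L where L: "\<And>z. z \<in> cball 0 1 \<Longrightarrow> \<bar>\<Sum>i\<in>UNIV. \<bar>partial_deriv i u z\<bar>\<bar> \<le> L"
    using compact_imp_bounded[of "(\<lambda>z. \<Sum>i\<in>UNIV. \<bar>partial_deriv i u z\<bar>) ` cball 0 1"] by (force simp: bounded_iff)
  have "norm (u x - u 0) \<le> L * norm (x - 0)" if "norm x \<le> 1" for x
  proof (rule differentiable_bound[of "cball 0 1"])
    show "(u has_derivative (\<lambda>h. \<Sum>i\<in>UNIV. h $ i * partial_deriv i u z)) (at z within cball 0 1)" for z
      using Ck_has_derivative[of 0 u z] assms by (simp add: has_derivative_at_withinI)
    fix z :: "real^'n" assume z: "z \<in> cball 0 1"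
    show "onorm (\<lambda>h. \<Sum>i\<in>UNIV. h $ i * partial_deriv i u z) \<le> L"
    proof (rule onorm_le)
      fix h :: "real^'n"
      have "norm (\<Sum>i\<in>UNIV. h $ i * partial_deriv i u z) \<le> (\<Sum>i\<in>UNIV. \<bar>h $ i\<bar> * \<bar>partial_deriv i u z\<bar>)"
        by (rule order_trans[OF norm_sum]) (simp add: abs_mult)
      also have "\<dots> \<le> (\<Sum>i\<in>UNIV. norm h * \<bar>partial_deriv i u z\<bar>)"
        by (intro sum_mono mult_right_mono component_le_norm_cart) auto
      also have "\<dots> = (\<Sum>i\<in>UNIV. \<bar>partial_deriv i u z\<bar>) * norm h" by (simp add: sum_distrib_left mult.commute)
      also have "\<dots> \<le> L * norm h" using L[OF z] by (intro mult_right_mono) auto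
      finally show "norm (\<Sum>i\<in>UNIV. h $ i * partial_deriv i u z) \<le> L * norm h" .
    qed
  qed (use that in auto)
  then show ?thesis by (intro that[of L]) auto
qed

lemma conv_cong_kernel:
  assumes "\<And>y. f y \<noteq> 0 \<Longrightarrow> k (x - y) = l (x - y)"
  shows "conv f k x = conv f l x"
  unfolding conv_def by (rule Bochner_Integration.integral_cong) (use assms in force)+

text \<open>The factor \<open>1 - cutoff (16 t)\<close> vanishes for \<open>t \<le> 9/16\<close> and is \<open>1\<close> for \<open>t \<ge> 1\<close>. It removes the
  singularity of the gradient of the kernel without changing it outside the unit disc.\<close>

definition smooth_grad_profile :: "real \<Rightarrow> real" where
  "smooth_grad_profile t = (if t \<le> 0 then 0 else (1 - cutoff (16 * t)) * cut_ln' t)"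

lemma Ck_on_smooth_grad_profile: "Ck_on k UNIV smooth_grad_profile"
proof -
  have c: "Ck_on k {0<..} (\<lambda>t. 1 + (-1) * cutoff (16 * t + 0))"
    by (rule Ck_on_subset[of k UNIV], intro Ck_on_add Ck_on_mult Ck_on_const Ck_on_affine Ck_on_cutoff) auto
  have 1: "Ck_on k {0<..} smooth_grad_profile"
    by (rule Ck_on_cong[OF _ _ Ck_on_mult[OF c Ck_on_cut_ln']]) (auto simp: smooth_grad_profile_def)
  have 2: "Ck_on k {..<9/16} smooth_grad_profile"
    by (rule Ck_on_cong[where f="\<lambda>t. 0"]) (auto simp: smooth_grad_profile_def Ck_on_const cutoff_eq_1)
  have "{0<..} \<union> {..<9/16} = (UNIV :: real set)" by auto
  then show ?thesis using Ck_on_Un[OF _ _ 1 2] by simp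
qed

lemma newton_grad_far_smooth:
  obtains K where "\<And>k. Ck k K" "supp_in 4 K" "\<And>z. norm z \<ge> 1 \<Longrightarrow> K z = newton_grad 0 i z"
proof
  let ?K = "\<lambda>z::real^2. (2 * z $ i + 0) * radial 0 smooth_grad_profile (z - 0)"
  show "Ck k ?K" for k by (intro Ck_mult Ck_affine Ck_radial[OF Ck_on_smooth_grad_profile]) auto
  have "cut_ln' ((norm z)\<^sup>2) = 0" if "norm z > 4" for z :: "real^2"
    using cut_ln_large(2)[OF norm_gt_4[OF that]] .
  then show "supp_in 4 ?K" by (simp add: supp_in_def smooth_grad_profile_def)
  fix z :: "real^2" assume "norm z \<ge> 1"
  then have "(norm z)\<^sup>2 \<ge> 1" by (simp add: power2_eq_square mult_ge1_I)
  then show "?K z = newton_grad 0 i z" by (simp add: newton_grad_def smooth_grad_profile_def cutoff_eq_0)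
qed

text \<open>For \<open>|x| \<le> 1\<close> and \<open>|y| > 2\<close> one has \<open>|x - y| \<ge> 1\<close>, so the kernel may be replaced by a smooth one, and
  the convolution is of class \<open>C\<^sup>1\<close> near the origin.\<close>

lemma far_part_Lipschitz:
  assumes g: "loc_integrable g" and far: "\<And>y. norm y \<le> 2 \<Longrightarrow> g y = 0"
  obtains L where "\<And>x. norm x \<le> 1 \<Longrightarrow> \<bar>conv g (newton_grad 0 i) x - conv g (newton_grad 0 i) 0\<bar> \<le> L * norm x"
proof -
  obtain K where K: "\<And>k. Ck k K" "supp_in 4 K" "\<And>z. norm z \<ge> 1 \<Longrightarrow> K z = newton_grad 0 i z"
    by (rule newton_grad_far_smooth[of i]) (rule that)
  have eq: "conv g (newton_grad 0 i) x = conv g K x" if "norm x \<le> 1" for x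
  proof (rule conv_cong_kernel)
    fix y assume "g y \<noteq> 0"
    then have "norm y > 2" using far by force
    moreover have "norm y \<le> norm x + norm (x - y)" by norm
    ultimately show "newton_grad 0 i (x - y) = K (x - y)" using K(3)[of "x - y"] that by simp
  qed
  have "Ck 1 (conv g K)" by (rule Ck_conv[OF g K(1,2)])
  then obtain L where "\<And>x. norm x \<le> 1 \<Longrightarrow> \<bar>conv g K x - conv g K 0\<bar> \<le> L * norm x"
    by (rule C1_Lipschitz_at_0) (rule that)
  then show ?thesis by (intro that[of L]) (simp add: eq)
qed

text \<open>Only \<open>|x - y| \<le> 3 \<rho>\<close> contributes, and the integral of \<open>1/|z|\<close> over a disc is proportional to its radius.\<close>

lemma near_part_bound:
  obtains C where "C \<ge> 0" "\<And>g M \<rho> x. g \<in> borel_measurable borel \<Longrightarrow> (\<And>y. \<bar>g y\<bar> \<le> M) \<Longrightarrow> (\<And>y. norm y > 2 * \<rho> \<Longrightarrow> g y = 0)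
    \<Longrightarrow> 0 < \<rho> \<Longrightarrow> \<rho> < 1 \<Longrightarrow> norm x \<le> \<rho> \<Longrightarrow> \<bar>conv g (newton_grad 0 i) x\<bar> \<le> C * M * \<rho>"
proof -
  obtain C where C: "C > 0" "\<And>e i x. e \<ge> 0 \<Longrightarrow> x \<noteq> 0 \<Longrightarrow> \<bar>newton_grad e i x\<bar> \<le> C * riesz 4 x"
    by (rule newton_bounds) blast
  show ?thesis
  proof (rule that[of "3 * C * riesz_mass"])
    show "3 * C * riesz_mass \<ge> 0" using C(1) riesz_mass_nonneg by simp
    fix g :: "real^2 \<Rightarrow> real" and M \<rho> and x :: "real^2"
    assume g: "g \<in> borel_measurable borel" "\<And>y. \<bar>g y\<bar> \<le> M" "\<And>y. norm y > 2 * \<rho> \<Longrightarrow> g y = 0"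
      and \<rho>: "0 < \<rho>" "\<rho> < 1" and x: "norm x \<le> \<rho>"
    have M: "M \<ge> 0" using g(2) abs_ge_zero order_trans by blast
    let ?k = "\<lambda>z. indicator (cball 0 (3 * \<rho>)) z * newton_grad 0 i z"
    have k: "?k \<in> borel_measurable borel"
      by (intro borel_measurable_times borel_measurable_indicator borel_measurable_newton_grad) auto
    have b: "\<bar>?k z\<bar> \<le> C * riesz (3 * \<rho>) z" if "z \<noteq> 0" for z
      using C(2)[of 0 z i] that \<rho> by (auto simp: indicator_def riesz_def split: if_splits)
    have r: "integrable lborel (\<lambda>z. C * riesz (3 * \<rho>) z)" by (intro integrable_mult_right integrable_riesz)
    have ae: "AE z in lborel. \<bar>?k z\<bar> \<le> C * riesz (3 * \<rho>) z"
      using AE_lborel_singleton[of 0] by eventually_elim (rule b)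
    have ki: "integrable lborel ?k"
      by (rule Bochner_Integration.integrable_bound[OF r])
        (use k ae C(1) in \<open>auto simp: abs_mult riesz_nonneg\<close>)
    have "conv g (newton_grad 0 i) x = conv g ?k x"
    proof (rule conv_cong_kernel)
      fix y assume "g y \<noteq> 0"
      then have "norm y \<le> 2 * \<rho>" using g(3) by force
      moreover have "norm (x - y) \<le> norm x + norm y" by norm
      ultimately show "newton_grad 0 i (x - y) = ?k (x - y)" using x by (simp add: indicator_def)
    qed
    also have "\<bar>\<dots>\<bar> \<le> M * (LINT z|lborel. \<bar>?k z\<bar>)" by (rule conv_bounded_L1(2)[OF g(1,2) ki])
    also have "\<dots> \<le> M * (LINT z|lborel. C * riesz (3 * \<rho>) z)"
      by (intro mult_left_mono[OF _ M] integral_mono_AE[OF integrable_abs[OF ki] r ae])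
    also have "\<dots> = M * (C * (3 * \<rho> * riesz_mass))" using \<rho> by (simp add: integral_riesz)
    finally show "\<bar>conv g (newton_grad 0 i) x\<bar> \<le> 3 * C * riesz_mass * M * \<rho>"
      by (simp only: mult_ac)
  qed
qed

definition to_complex :: "real^2 \<Rightarrow> complex" where
  "to_complex x = Complex (x $ 1) (x $ 2)"

lemma to_complex_diff: "to_complex (x - y) = to_complex x - to_complex y" by (simp add: to_complex_def complex_eq_iff)
lemma to_complex_perp: "to_complex (perp y) = \<i> * to_complex y" by (simp add: to_complex_def complex_eq_iff)
lemma to_complex_0: "to_complex 0 = 0" by (simp add: to_complex_def complex_eq_iff)
lemma norm_to_complex: "cmod (to_complex x) = norm x"
proof -
  have "norm x = sqrt ((x $ 1)\<^sup>2 + (x $ 2)\<^sup>2)"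
    by (simp add: norm_eq_sqrt_inner inner_vec_def UNIV_2 power2_eq_square)
  then show ?thesis by (simp add: to_complex_def complex_norm)
qed

text \<open>In complex notation, the gradient of \<open>ln |z|\<^sup>2\<close> is the conjugate of \<open>2/z\<close>.\<close>

lemma newton_grad_small:
  assumes "norm z < 3"
  shows "newton_grad 0 1 z = 2 * Re (inverse (to_complex z))" "newton_grad 0 2 z = - 2 * Im (inverse (to_complex z))"
proof -
  have sq: "(norm z)\<^sup>2 = (z $ 1)\<^sup>2 + (z $ 2)\<^sup>2"
    unfolding power2_norm_eq_inner by (simp add: inner_vec_def UNIV_2 power2_eq_square)
  show "newton_grad 0 1 z = 2 * Re (inverse (to_complex z))" "newton_grad 0 2 z = - 2 * Im (inverse (to_complex z))"
  proof (atomize (full), cases "z = 0")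
    case False
    have "(norm z)\<^sup>2 < 3\<^sup>2" by (rule power_strict_mono) (use assms in auto)
    then have "radial 0 cut_ln' z = 1 / (norm z)\<^sup>2" using False by (simp add: cut_ln_small)
    then show "newton_grad 0 1 z = 2 * Re (inverse (to_complex z)) \<and> newton_grad 0 2 z = - 2 * Im (inverse (to_complex z))"
      by (simp add: newton_grad_def to_complex_def sq)
  qed (simp add: newton_grad_def to_complex_0)
qed

text \<open>The sum is \<open>4 z\<^sup>3 / (z\<^sup>4 - w\<^sup>4)\<close>: combining \<open>w\<close> with \<open>-w\<close>, and \<open>\<i>w\<close> with \<open>-\<i>w\<close>, gives
  \<open>2z / (z\<^sup>2 - w\<^sup>2)\<close> and \<open>2z / (z\<^sup>2 + w\<^sup>2)\<close>. Under the hypothesis the denominator is at least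
  \<open>|w|\<^sup>4 / 2\<close>.\<close>

lemma sum_inverse_rotations:
  fixes z w :: complex
  assumes "2 * cmod z \<le> cmod w" "z \<noteq> 0"
  shows "cmod (inverse (z - w) + inverse (z - \<i> * w) + inverse (z + w) + inverse (z + \<i> * w)) \<le> 8 * cmod z ^ 3 / cmod w ^ 4"
proof -
  have w: "cmod w > cmod z" using assms by (smt (verit) norm_le_zero_iff)
  have ne: "z - w \<noteq> 0" "z - \<i> * w \<noteq> 0" "z + w \<noteq> 0" "z + \<i> * w \<noteq> 0"
  proof -
    have "a + b \<noteq> 0" "a - b \<noteq> 0" if "cmod a < cmod b" for a b
      using that by (auto simp: add_eq_0_iff)
    from this[of z w] this[of z "\<i> * w"] w show "z - w \<noteq> 0" "z - \<i> * w \<noteq> 0" "z + w \<noteq> 0" "z + \<i> * w \<noteq> 0"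
      by (auto simp: norm_mult)
  qed
  have 1: "inverse (z - w) + inverse (z + w) = 2 * z / (z\<^sup>2 - w\<^sup>2)"
  proof -
    have "z\<^sup>2 - w\<^sup>2 = (z - w) * (z + w)" by (simp add: algebra_simps power2_eq_square)
    then show ?thesis using ne by (simp add: divide_simps)
  qed
  have 2: "inverse (z - \<i> * w) + inverse (z + \<i> * w) = 2 * z / (z\<^sup>2 + w\<^sup>2)"
  proof -
    have "z\<^sup>2 + w\<^sup>2 = (z - \<i> * w) * (z + \<i> * w)" by (simp add: algebra_simps power2_eq_square)
    then show ?thesis using ne by (simp add: divide_simps)
  qed
  have ne': "z\<^sup>2 - w\<^sup>2 \<noteq> 0" "z\<^sup>2 + w\<^sup>2 \<noteq> 0"
  proof -
    have "z\<^sup>2 - w\<^sup>2 = (z - w) * (z + w)" "z\<^sup>2 + w\<^sup>2 = (z - \<i> * w) * (z + \<i> * w)"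
      by (simp_all add: algebra_simps power2_eq_square)
    then show "z\<^sup>2 - w\<^sup>2 \<noteq> 0" "z\<^sup>2 + w\<^sup>2 \<noteq> 0" using ne by simp_all
  qed
  have "inverse (z - w) + inverse (z - \<i> * w) + inverse (z + w) + inverse (z + \<i> * w) = 2 * z / (z\<^sup>2 - w\<^sup>2) + 2 * z / (z\<^sup>2 + w\<^sup>2)"
    using 1 2 by (simp add: algebra_simps)
  also have "\<dots> = 4 * z ^ 3 / ((z\<^sup>2 - w\<^sup>2) * (z\<^sup>2 + w\<^sup>2))"
    using ne' by (simp add: add_frac_eq) (simp add: algebra_simps power2_eq_square power3_eq_cube)
  also have "(z\<^sup>2 - w\<^sup>2) * (z\<^sup>2 + w\<^sup>2) = z ^ 4 - w ^ 4" by (simp add: algebra_simps power2_eq_square power4_eq_xxxx)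
  finally have eq: "cmod (inverse (z - w) + inverse (z - \<i> * w) + inverse (z + w) + inverse (z + \<i> * w)) = 4 * cmod z ^ 3 / cmod (z ^ 4 - w ^ 4)"
    by (simp add: norm_divide norm_mult norm_power)
  have "(2 * cmod z) ^ 4 \<le> cmod w ^ 4" using assms by (intro power_mono) auto
  then have "16 * cmod z ^ 4 \<le> cmod w ^ 4" by (simp add: power_mult_distrib)
  then have "cmod z ^ 4 \<le> cmod w ^ 4 / 2" using zero_le_power[OF norm_ge_zero, of z 4] by linarith
  moreover have "cmod (w ^ 4) - cmod (z ^ 4) \<le> cmod (z ^ 4 - w ^ 4)"
    using norm_triangle_ineq2[of "w ^ 4" "z ^ 4"] by (simp add: norm_minus_commute)
  ultimately have "cmod w ^ 4 / 2 \<le> cmod (z ^ 4 - w ^ 4)" by (simp add: norm_power)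
  moreover have "cmod w ^ 4 > 0" using w by (smt (verit) norm_ge_zero zero_less_power)
  ultimately have "4 * cmod z ^ 3 / cmod (z ^ 4 - w ^ 4) \<le> 4 * cmod z ^ 3 / (cmod w ^ 4 / 2)"
    by (intro divide_left_mono mult_pos_pos) auto
  then show ?thesis unfolding eq by simp
qed

text \<open>By the invariance of \<open>g\<close> and of Lebesgue measure, the increment \<open>k\<close> of the kernel may be replaced by its
  average over the four rotations of \<open>y\<close>. The rotations of the constant term \<open>K(- y)\<close> cancel, and those of \<open>K(x - y)\<close>
  are summed by \<open>sum_inverse_rotations\<close>.\<close>

lemma annulus_part_bound:
  assumes g: "g \<in> borel_measurable borel" "\<And>y. \<bar>g y\<bar> \<le> M"
    and sym: "AE y in lborel. g (perp y) = g y"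
    and supp: "\<And>y. g y \<noteq> 0 \<Longrightarrow> 2 * \<rho> < norm y \<and> norm y \<le> 2"
    and x: "norm x = \<rho>" "0 < \<rho>" "\<rho> < 1"
  shows "\<bar>conv g (newton_grad 0 i) x - conv g (newton_grad 0 i) 0\<bar> \<le> 16 * M * bubble_mass * \<rho>"
proof -
  note [measurable] = g(1)
  have M: "M \<ge> 0" using g(2) abs_ge_zero order_trans by blast
  define k where "k y = newton_grad 0 i (x - y) - newton_grad 0 i (0 - y)" for y
  have [measurable]: "k \<in> borel_measurable borel" unfolding k_def[abs_def] by measurable
  have gk: "integrable lborel (\<lambda>y. g y * k y)"
    unfolding k_def right_diff_distrib
    by (intro Bochner_Integration.integrable_diff conv_bounded_L1(1)[OF g newton_grad_L1(1)])
  have rot: "integrable lborel (\<lambda>y. g y * q (perp y))" "(LINT y|lborel. g y * q (perp y)) = (LINT y|lborel. g y * q y)"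
    if [measurable]: "q \<in> borel_measurable borel" and q: "integrable lborel (\<lambda>y. g y * q y)" for q
  proof -
    have ae: "AE y in lborel. g (perp y) * q (perp y) = g y * q (perp y)"
      using sym by eventually_elim simp
    have "integrable lborel (\<lambda>y. g (perp y) * q (perp y))"
      using q integrable_perp[of "\<lambda>y. g y * q y"] by simp
    then show "integrable lborel (\<lambda>y. g y * q (perp y))"
      using integrable_cong_AE[OF _ _ ae] by simp
    have "(LINT y|lborel. g y * q (perp y)) = (LINT y|lborel. g (perp y) * q (perp y))"
      by (rule integral_cong_AE) (use ae in auto)
    also have "\<dots> = (LINT y|lborel. g y * q y)" using integral_perp[of "\<lambda>y. g y * q y"] by simp
    finally show "(LINT y|lborel. g y * q (perp y)) = (LINT y|lborel. g y * q y)" .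
  qed
  let ?I = "LINT y|lborel. g y * k y"
  define K4 where "K4 y = k y + k (perp y) + k (perp (perp y)) + k (perp (perp (perp y)))" for y
  note r1 = rot[of k, OF _ gk]
  note r2 = rot[of "\<lambda>y. k (perp y)", OF _ r1(1)]
  note r3 = rot[of "\<lambda>y. k (perp (perp y))", OF _ r2(1)]
  have i4: "integrable lborel (\<lambda>y. g y * K4 y)"
    unfolding K4_def distrib_left using gk r1 r2 r3 by (intro Bochner_Integration.integrable_add) auto
  have I4: "(LINT y|lborel. g y * K4 y) = 4 * ?I"
    unfolding K4_def distrib_left using gk r1 r2 r3 by simp
  have pt: "\<bar>g y * K4 y\<bar> \<le> 64 * M * \<rho> ^ 3 * (1 / ((norm y)\<^sup>2 + \<rho>\<^sup>2)\<^sup>2)" for y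
  proof (cases "g y = 0")
    case True
    then show ?thesis using M x by simp
  next
    case False
    then have y: "2 * \<rho> < norm y" "norm y \<le> 2" using supp by auto
    let ?z = "to_complex x" and ?w = "to_complex y"
    define s where "s = inverse (?z - ?w) + inverse (?z - \<i> * ?w) + inverse (?z + ?w) + inverse (?z + \<i> * ?w)"
    have z: "norm (x - perp y) < 3" "norm (x - y) < 3" "norm (x - perp (perp y)) < 3" "norm (x - perp (perp (perp y))) < 3"
      "norm (0 - y) < 3" "norm (0 - perp y) < 3" "norm (0 - perp (perp y)) < 3" "norm (0 - perp (perp (perp y))) < 3"
      using norm_triangle_ineq4[of x y] norm_triangle_ineq4[of x "perp y"] norm_triangle_ineq4[of x "perp (perp y)"]
        norm_triangle_ineq4[of x "perp (perp (perp y))"] x y by simp_all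
    have "\<i> * (\<i> * ?w) = - ?w" "\<i> * (\<i> * (\<i> * ?w)) = - \<i> * ?w" by (simp_all add: mult.assoc[symmetric])
    then have t: "to_complex (x - y) = ?z - ?w" "to_complex (x - perp y) = ?z - \<i> * ?w"
      "to_complex (x - perp (perp y)) = ?z + ?w" "to_complex (x - perp (perp (perp y))) = ?z + \<i> * ?w"
      "to_complex (0 - y) = - ?w" "to_complex (0 - perp y) = - (\<i> * ?w)"
      "to_complex (0 - perp (perp y)) = ?w" "to_complex (0 - perp (perp (perp y))) = \<i> * ?w"
      unfolding to_complex_diff to_complex_perp to_complex_0 by simp_all
    have "i = 1 \<or> i = 2" by (rule exhaust_2)
    moreover have "K4 y = 2 * Re s" if "i = 1"
    proof -
      have "2 * a - 2 * - e + (2 * b - 2 * - f) + (2 * c - 2 * e) + (2 * d - 2 * f) = 2 * (a + b + c + d)"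
        for a b c d e f :: real by simp
      then show ?thesis
        unfolding K4_def k_def that newton_grad_small(1)[OF z(1)] newton_grad_small(1)[OF z(2)]
          newton_grad_small(1)[OF z(3)] newton_grad_small(1)[OF z(4)] newton_grad_small(1)[OF z(5)] newton_grad_small(1)[OF z(6)]
          newton_grad_small(1)[OF z(7)] newton_grad_small(1)[OF z(8)] t s_def inverse_minus_eq plus_complex.sel uminus_complex.sel .
    qed
    moreover have "K4 y = - 2 * Im s" if "i = 2"
    proof -
      have "- 2 * a - - 2 * - e + (- 2 * b - - 2 * - f) + (- 2 * c - - 2 * e) + (- 2 * d - - 2 * f) = - 2 * (a + b + c + d)"
        for a b c d e f :: real by simp
      then show ?thesis
        unfolding K4_def k_def that newton_grad_small(2)[OF z(1)] newton_grad_small(2)[OF z(2)]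
          newton_grad_small(2)[OF z(3)] newton_grad_small(2)[OF z(4)] newton_grad_small(2)[OF z(5)] newton_grad_small(2)[OF z(6)]
          newton_grad_small(2)[OF z(7)] newton_grad_small(2)[OF z(8)] t s_def inverse_minus_eq plus_complex.sel uminus_complex.sel .
    qed
    ultimately have "K4 y = 2 * Re s \<or> K4 y = - 2 * Im s" by blast
    then have "\<bar>K4 y\<bar> \<le> 2 * cmod s" using abs_Re_le_cmod[of s] abs_Im_le_cmod[of s] by (auto simp: abs_mult)
    moreover have x0: "to_complex x \<noteq> 0" using norm_to_complex[of x] x by auto
    have "cmod s \<le> 8 * cmod ?z ^ 3 / cmod ?w ^ 4"
      unfolding s_def by (rule sum_inverse_rotations) (use x y x0 in \<open>auto simp: norm_to_complex\<close>)
    ultimately have K4: "\<bar>K4 y\<bar> \<le> 16 * \<rho> ^ 3 * (1 / norm y ^ 4)" using x by (simp add: norm_to_complex)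
    \<comment> \<open>\<open>1/|y|\<^sup>4\<close> is traded for a function whose integral over the whole plane is known.\<close>
    have "\<rho>\<^sup>2 \<le> (norm y)\<^sup>2" using x y by (intro power_mono) auto
    then have "((norm y)\<^sup>2 + \<rho>\<^sup>2)\<^sup>2 \<le> (2 * (norm y)\<^sup>2)\<^sup>2" by (intro power_mono) auto
    also have "\<dots> = 4 * norm y ^ 4" by (simp add: power_mult_distrib)
    finally have "4 / (4 * norm y ^ 4) \<le> 4 / ((norm y)\<^sup>2 + \<rho>\<^sup>2)\<^sup>2"
      using x y by (intro divide_left_mono mult_pos_pos zero_less_power add_nonneg_pos) auto
    then have "16 * \<rho> ^ 3 * (1 / norm y ^ 4) \<le> 16 * \<rho> ^ 3 * (4 * (1 / ((norm y)\<^sup>2 + \<rho>\<^sup>2)\<^sup>2))"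
      using x by (intro mult_left_mono) auto
    with K4 have "\<bar>K4 y\<bar> \<le> 64 * \<rho> ^ 3 * (1 / ((norm y)\<^sup>2 + \<rho>\<^sup>2)\<^sup>2)" by linarith
    then have "\<bar>g y\<bar> * \<bar>K4 y\<bar> \<le> M * (64 * \<rho> ^ 3 * (1 / ((norm y)\<^sup>2 + \<rho>\<^sup>2)\<^sup>2))"
      using g(2)[of y] M by (intro mult_mono) auto
    then show ?thesis by (simp add: abs_mult mult_ac)
  qed
  have "\<bar>LINT y|lborel. g y * K4 y\<bar> \<le> (LINT y|lborel. \<bar>g y * K4 y\<bar>)" by (rule integral_abs_bound)
  also have "\<dots> \<le> (LINT y::real^2|lborel. 64 * M * \<rho> ^ 3 * (1 / ((norm y)\<^sup>2 + \<rho>\<^sup>2)\<^sup>2))"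
    by (rule integral_mono[OF integrable_abs[OF i4] _ pt])
      (intro integrable_mult_right integrable_bubble_scaled x)
  also have "\<dots> = 64 * M * \<rho> ^ 3 * (bubble_mass / \<rho>\<^sup>2)"
    by (simp only: integral_mult_right_zero integral_bubble_scaled[OF x(2)])
  also have "\<dots> = 64 * M * bubble_mass * \<rho>" using x by (simp add: power2_eq_square power3_eq_cube)
  finally have "\<bar>?I\<bar> \<le> 16 * M * bubble_mass * \<rho>" unfolding I4 by simp
  moreover have "conv g (newton_grad 0 i) x - conv g (newton_grad 0 i) 0 = ?I"
    unfolding conv_def k_def right_diff_distrib
    by (rule Bochner_Integration.integral_diff[symmetric]) (intro conv_bounded_L1(1)[OF g newton_grad_L1(1)])+
  ultimately show ?thesis by simp
qed

text \<open>The near and far parts of \<open>g\<close> contribute \<open>O(|x|)\<close> by size and by smoothness of the kernel; the symmetry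
  of \<open>g\<close> is inherited by its restriction to the annulus, which is rotation invariant.\<close>

lemma symmetric_newton_grad_bound:
  assumes g: "g \<in> borel_measurable borel" "\<And>y. \<bar>g y\<bar> \<le> M"
    and sym: "AE y in lborel. g (perp y) = g y"
  obtains C where "\<And>x. norm x < 1 \<Longrightarrow> \<bar>conv g (newton_grad 0 i) x - conv g (newton_grad 0 i) 0\<bar> \<le> C * norm x"
proof -
  note [measurable] = g(1)
  have M: "M \<ge> 0" using g(2) abs_ge_zero order_trans by blast
  let ?K = "newton_grad 0 i"
  obtain C where C: "C \<ge> 0" "\<And>g M \<rho> x. g \<in> borel_measurable borel \<Longrightarrow> (\<And>y. \<bar>g y\<bar> \<le> M) \<Longrightarrow> (\<And>y. norm y > 2 * \<rho> \<Longrightarrow> g y = 0)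
    \<Longrightarrow> 0 < \<rho> \<Longrightarrow> \<rho> < 1 \<Longrightarrow> norm x \<le> \<rho> \<Longrightarrow> \<bar>conv g ?K x\<bar> \<le> C * M * \<rho>"
    by (rule near_part_bound[of i]) blast
  define g3 where "g3 y = indicator (- cball 0 2) y * g y" for y
  have ind: "\<bar>indicator S y * g y\<bar> \<le> M" for S :: "(real^2) set" and y
    using g(2)[of y] M by (simp add: indicator_def)
  have ind_meas: "(\<lambda>y. indicator S y * g y) \<in> borel_measurable borel" if "S \<in> sets borel" for S
    using that by (intro borel_measurable_times borel_measurable_indicator g)
  have g3: "g3 \<in> borel_measurable borel" "\<And>y. \<bar>g3 y\<bar> \<le> M"
    unfolding g3_def[abs_def] by (intro ind_meas, simp) (rule ind)
  have g3_far: "g3 y = 0" if "norm y \<le> 2" for y using that by (simp add: g3_def)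
  obtain L where L: "\<And>x. norm x \<le> 1 \<Longrightarrow> \<bar>conv g3 ?K x - conv g3 ?K 0\<bar> \<le> L * norm x"
    by (rule far_part_Lipschitz[OF loc_integrable_bounded[OF g3], of i], erule g3_far) (rule that)
  let ?C = "2 * (C * M) + 16 * M * bubble_mass + L"
  have "\<bar>conv g ?K x - conv g ?K 0\<bar> \<le> ?C * norm x" if "norm x < 1" for x
  proof (cases "x = 0")
    case False
    define \<rho> where "\<rho> = norm x"
    have \<rho>: "norm x = \<rho>" "0 < \<rho>" "\<rho> < 1" using that False by (auto simp: \<rho>_def)
    define g1 where "g1 y = indicator (cball 0 (2 * \<rho>)) y * g y" for y
    define g2 where "g2 y = indicator (cball 0 2 - cball 0 (2 * \<rho>)) y * g y" for y
    have g1: "g1 \<in> borel_measurable borel" "\<And>y. \<bar>g1 y\<bar> \<le> M" unfolding g1_def[abs_def] by (intro ind_meas, simp) (rule ind)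
    have g2: "g2 \<in> borel_measurable borel" "\<And>y. \<bar>g2 y\<bar> \<le> M" unfolding g2_def[abs_def] by (intro ind_meas, simp) (rule ind)
    have split: "g y = g1 y + g2 y + g3 y" for y
      using \<rho> by (auto simp: g1_def g2_def g3_def indicator_def)
    have cs: "conv g ?K u = conv g1 ?K u + conv g2 ?K u + conv g3 ?K u" for u
      unfolding conv_def split distrib_right
      using conv_bounded_L1(1)[OF g1 newton_grad_L1(1)] conv_bounded_L1(1)[OF g2 newton_grad_L1(1)]
        conv_bounded_L1(1)[OF g3 newton_grad_L1(1)] by simp
    have "\<bar>conv g1 ?K u\<bar> \<le> C * M * \<rho>" if "norm u \<le> \<rho>" for u
      by (rule C(2)[OF g1 _ \<rho>(2,3) that]) (simp add: g1_def)
    then have 1: "\<bar>conv g1 ?K x\<bar> \<le> C * M * \<rho>" "\<bar>conv g1 ?K 0\<bar> \<le> C * M * \<rho>" using \<rho> by auto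
    have "AE y in lborel. g2 (perp y) = g2 y"
      using sym by eventually_elim (simp add: g2_def indicator_def)
    then have 2: "\<bar>conv g2 ?K x - conv g2 ?K 0\<bar> \<le> 16 * M * bubble_mass * \<rho>"
      by (rule annulus_part_bound[OF g2 _ _ \<rho>]) (auto simp: g2_def indicator_def split: if_splits)
    have 3: "\<bar>conv g3 ?K x - conv g3 ?K 0\<bar> \<le> L * \<rho>" using L[of x] \<rho> by simp
    show ?thesis unfolding cs \<rho>(1) using 1 2 3 by (simp add: algebra_simps) 
  qed simp
  then show ?thesis by (rule that)
qed

section \<open>The theorem\<close>

lemma AE_perp:
  assumes "AE x in lborel. P x"
  shows "AE x in lborel. P (perp x)"
proof -
  obtain N where N: "{x. \<not> P x} \<subseteq> N" "N \<in> sets lborel" "emeasure lborel N = 0"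
    using assms by (auto elim!: AE_E)
  have "perp -` N \<in> null_sets lborel"
  proof
    show "perp -` N \<in> sets lborel"
      using N(2) measurable_sets[OF borel_measurable_perp, of N] by auto
    have "emeasure lborel (perp -` N) = emeasure (distr lborel borel perp) N"
      using N(2) by (subst emeasure_distr) auto
    then show "emeasure lborel (perp -` N) = 0" unfolding distr_perp N(3) .
  qed
  then show ?thesis
    by (rule AE_I') (use N(1) in auto)
qed

text \<open>Truncation turns the essential bound into a pointwise one.\<close>

lemma Linfty_borel_representative:
  fixes g :: "real^'n \<Rightarrow> real"
  assumes "Linfty g"
  obtains g' M where "g' \<in> borel_measurable borel" "\<And>y. \<bar>g' y\<bar> \<le> M" "AE x in lebesgue. g x = g' x"
proof -
  obtain C where C: "g \<in> borel_measurable lebesgue" "AE x in lebesgue. \<bar>g x\<bar> \<le> C"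
    using assms by (auto simp: Linfty_def)
  obtain g0 where g0: "g0 \<in> borel_measurable lborel" "AE x in lborel. g x = g0 x"
    using completion_ex_borel_measurable_real[OF C(1)] by blast
  let ?g' = "\<lambda>x. max (- \<bar>C\<bar>) (min \<bar>C\<bar> (g0 x))"
  show ?thesis
  proof (rule that[of ?g' "\<bar>C\<bar>"])
    show "?g' \<in> borel_measurable borel" using g0(1) by simp
    show "AE x in lebesgue. g x = ?g' x"
      using C(2) AE_completion[OF g0(2)] by eventually_elim auto
  qed auto
qed

lemma Linfty_loc_borel_representative:
  fixes f :: "real^'n \<Rightarrow> real"
  assumes "Linfty_loc f"
  obtains f' where "loc_integrable f'" "AE x in lebesgue. f x = f' x"
proof -
  have f: "f \<in> borel_measurable lebesgue" "\<And>K. compact K \<Longrightarrow> \<exists>C. AE x in lebesgue. x \<in> K \<longrightarrow> \<bar>f x\<bar> \<le> C"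
    using assms by (auto simp: Linfty_loc_def)
  obtain f' where f': "f' \<in> borel_measurable lborel" "AE x in lborel. f x = f' x"
    using completion_ex_borel_measurable_real[OF f(1)] by blast
  have f'_meas: "f' \<in> borel_measurable borel" using f'(1) by simp
  have "integrable lborel (\<lambda>y. indicator (cball 0 r) y * f' y)" for r
  proof -
    obtain C where C: "AE x in lebesgue. x \<in> cball 0 r \<longrightarrow> \<bar>f x\<bar> \<le> C"
      using f(2)[of "cball 0 r"] by auto
    have ae: "AE x in lborel. x \<in> cball 0 r \<longrightarrow> \<bar>f' x\<bar> \<le> C"
      using C[unfolded AE_completion_iff] f'(2) by eventually_elim auto
    show ?thesis
    proof (rule Bochner_Integration.integrable_bound)
      show "integrable lborel (\<lambda>y::real^'n. indicator (cball 0 r) y * C)"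
        by (intro integrable_mult_left) (auto intro!: integrable_real_indicator emeasure_compact_finite)
      show "(\<lambda>y. indicator (cball 0 r) y * f' y) \<in> borel_measurable lborel"
        using f'_meas by (simp add: borel_measurable_times borel_measurable_indicator)
      show "AE y in lborel. norm (indicator (cball 0 r) y * f' y) \<le> norm (indicator (cball 0 r) y * C)"
        using ae by eventually_elim (auto simp: indicator_def)
    qed
  qed
  then have "loc_integrable f'" using f'_meas by (simp add: loc_integrable_def)
  then show ?thesis using AE_completion[OF f'(2)] by (rule that)
qed

lemma integral_lebesgue_representative:
  fixes f f' h :: "real^'n \<Rightarrow> real"
  assumes "f \<in> borel_measurable lebesgue" "f' \<in> borel_measurable borel" "AE x in lebesgue. f x = f' x"
    "continuous_on UNIV h"
  shows "(LINT x|lebesgue. f x * h x) = (LINT x|lborel. f' x * h x)"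
proof -
  have [measurable]: "h \<in> borel_measurable borel" by (rule borel_measurable_continuous_onI) fact
  have [measurable]: "h \<in> borel_measurable lebesgue" "f' \<in> borel_measurable lebesgue"
    using assms(2) by (auto intro: measurable_completion)
  have "(LINT x|lebesgue. f x * h x) = (LINT x|lebesgue. f' x * h x)"
    by (rule integral_cong_AE) (use assms in auto)
  also have "\<dots> = (LINT x|lborel. f' x * h x)"
    by (rule integral_completion) (use assms(2) in auto)
  finally show ?thesis .
qed

lemma continuous_on_laplacian:
  assumes "Ck 2 \<phi>"
  shows "continuous_on UNIV (laplacian \<phi>)"
  unfolding laplacian_def[abs_def] using assms
  by (intro continuous_on_sum) (auto simp: numeral_2_eq_2)

theorem lemma3p1:
  fixes g \<psi> :: "real^2 \<Rightarrow> real"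
  assumes "Linfty g"
    and "AE x in lebesgue. g x = g (perp x)"
    and "Linfty_loc \<psi>"
    and "solves_poisson \<psi> g"
  shows "\<exists>\<Psi>. Ck 1 \<Psi> \<and> (AE x in lebesgue. \<Psi> x = \<psi> x) \<and>
    (grad \<Psi> 0 = 0 \<longrightarrow> (SUP x\<in>ball 0 1 - {0}. ereal (norm (grad \<Psi> x) / norm x)) < \<infinity>)"
proof -
  obtain g' M where g': "g' \<in> borel_measurable borel" "\<And>y. \<bar>g' y\<bar> \<le> M" and gg': "AE x in lebesgue. g x = g' x"
    using Linfty_borel_representative[OF assms(1)] by blast
  obtain \<psi>' where \<psi>': "loc_integrable \<psi>'" and \<psi>\<psi>': "AE x in lebesgue. \<psi> x = \<psi>' x"
    using Linfty_loc_borel_representative[OF assms(3)] by blast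
  have weak: "(LINT y|lborel. \<psi>' y * laplacian \<phi> y) = (LINT y|lborel. g' y * \<phi> y)" if "test_function \<phi>" for \<phi>
  proof -
    have C: "Ck k \<phi>" for k using that by (simp add: test_function_def)
    have "(LINT y|lborel. \<psi>' y * laplacian \<phi> y) = (LINT y|lebesgue. \<psi> y * laplacian \<phi> y)"
      by (rule integral_lebesgue_representative[OF _ _ \<psi>\<psi>', symmetric])
        (use assms(3) \<psi>' continuous_on_laplacian[OF C] in \<open>auto simp: Linfty_loc_def loc_integrable_def\<close>)
    also have "\<dots> = (LINT y|lebesgue. g y * \<phi> y)" using assms(4) that by (simp add: solves_poisson_def)
    also have "\<dots> = (LINT y|lborel. g' y * \<phi> y)"
      by (rule integral_lebesgue_representative[OF _ g'(1) gg' Ck_imp_continuous[OF C]])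
        (use assms(1) in \<open>simp add: Linfty_def\<close>)
    finally show ?thesis .
  qed
  have sym: "AE y in lborel. g' (perp y) = g' y"
    using assms(2)[unfolded AE_completion_iff] gg'[unfolded AE_completion_iff]
      AE_perp[OF gg'[unfolded AE_completion_iff]]
    by eventually_elim simp
  define N where "N = conv g' (newton 0)"
  define h where "h = conv \<psi>' (lap_kernel 0)"
  define c where "c = 1 / (4 * bubble_mass)"
  define \<Psi> where "\<Psi> = regular_rep g' \<psi>'"
  have \<Psi>: "\<Psi> = (\<lambda>x. c * (N x + (- 1) * h x))"
    by (simp add: \<Psi>_def regular_rep_def[abs_def] N_def h_def c_def)
  have N1: "Ck 1 N" and dN: "\<And>i. partial_deriv i N = conv g' (newton_grad 0 i)"
    unfolding N_def by (rule conv_newton_C1[OF g'])+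
  have h2: "Ck (Suc 1) h"
    unfolding h_def by (rule Ck_conv[OF \<psi>' Ck_lap_kernel supp_in_kernels(3)]) simp
  then have h1: "Ck 1 h" and dh1: "\<And>i. Ck 1 (partial_deriv i h)" by (simp_all only: Ck_Suc_imp, simp only: Ck.simps)
  have C1: "Ck 1 \<Psi>" unfolding \<Psi> by (intro Ck_mult Ck_add Ck_const N1 h1)
  have d\<Psi>: "partial_deriv i \<Psi> x = c * (partial_deriv i N x - partial_deriv i h x)" for i x
  proof -
    have "(\<Psi> has_derivative (\<lambda>v. \<Sum>i\<in>UNIV. v $ i * (c * (partial_deriv i N x - partial_deriv i h x)))) (at x)" for x
    proof -
      have "(\<Psi> has_derivative (\<lambda>v. c * ((\<Sum>i\<in>UNIV. v $ i * partial_deriv i N x) + (- 1) * (\<Sum>i\<in>UNIV. v $ i * partial_deriv i h x)))) (at x)"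
        unfolding \<Psi> using N1 h1
        by (intro has_derivative_mult_right has_derivative_add Ck_has_derivative[of 0]) (simp_all only: One_nat_def)
      then show ?thesis
        by (simp add: sum_distrib_left algebra_simps sum_subtractf flip: sum.distrib)
    qed
    moreover have "Ck 0 (\<lambda>x. c * (partial_deriv i N x - partial_deriv i h x))" for i
      using N1 h1 by (auto intro!: continuous_intros)
    ultimately have "partial_deriv i \<Psi> = (\<lambda>x. c * (partial_deriv i N x - partial_deriv i h x))"
      by (rule Ck_SucI(2))
    then show ?thesis by simp
  qed
  have "AE x in lborel. \<Psi> x = \<psi>' x"
    unfolding \<Psi>_def by (rule regular_rep_AE[OF _ \<psi>' g']) (rule weak)
  from AE_completion[OF this] \<psi>\<psi>' have ae: "AE x in lebesgue. \<Psi> x = \<psi> x"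
    by eventually_elim simp
  have "\<exists>L. \<forall>x. norm x < 1 \<longrightarrow> \<bar>partial_deriv i \<Psi> x - partial_deriv i \<Psi> 0\<bar> \<le> L * norm x" for i
  proof -
    obtain A where A: "\<And>x. norm x < 1 \<Longrightarrow> \<bar>partial_deriv i N x - partial_deriv i N 0\<bar> \<le> A * norm x"
      using symmetric_newton_grad_bound[OF g' sym, of i] unfolding dN by blast
    obtain B where B: "\<And>x. norm x \<le> 1 \<Longrightarrow> \<bar>partial_deriv i h x - partial_deriv i h 0\<bar> \<le> B * norm x"
      using C1_Lipschitz_at_0[OF dh1[of i]] by blast
    have "\<bar>partial_deriv i \<Psi> x - partial_deriv i \<Psi> 0\<bar> \<le> (\<bar>c\<bar> * (A + B)) * norm x" if "norm x < 1" for x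
    proof -
      have "\<bar>partial_deriv i \<Psi> x - partial_deriv i \<Psi> 0\<bar> = \<bar>c\<bar> * \<bar>(partial_deriv i N x - partial_deriv i N 0) - (partial_deriv i h x - partial_deriv i h 0)\<bar>"
        unfolding d\<Psi> abs_mult[symmetric] by (simp add: algebra_simps)
      also have "\<dots> \<le> \<bar>c\<bar> * (A * norm x + B * norm x)"
        using A[OF that] B[of x] that by (intro mult_left_mono) auto
      finally show ?thesis by (simp add: algebra_simps)
    qed
    then show ?thesis by blast
  qed
  then obtain L where L: "\<And>i x. norm x < 1 \<Longrightarrow> \<bar>partial_deriv i \<Psi> x - partial_deriv i \<Psi> 0\<bar> \<le> L i * norm x"
    by metis
  have "(SUP x\<in>ball 0 1 - {0}. ereal (norm (grad \<Psi> x) / norm x)) < \<infinity>" if z: "grad \<Psi> 0 = 0"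
  proof -
    have z': "partial_deriv i \<Psi> 0 = 0" for i using z by (simp add: grad_def vec_eq_iff)
    have "(SUP x\<in>ball 0 1 - {0}. ereal (norm (grad \<Psi> x) / norm x)) \<le> ereal (\<Sum>i\<in>UNIV. L i)"
    proof (rule SUP_least)
      fix x :: "real^2" assume x: "x \<in> ball 0 1 - {0}"
      have "norm (grad \<Psi> x) \<le> (\<Sum>i\<in>UNIV. \<bar>grad \<Psi> x $ i\<bar>)" by (rule norm_le_l1_cart)
      also have "\<dots> \<le> (\<Sum>i\<in>UNIV. L i * norm x)"
        by (intro sum_mono) (use L[of x] z' x in \<open>simp add: grad_def\<close>)
      finally show "ereal (norm (grad \<Psi> x) / norm x) \<le> ereal (\<Sum>i\<in>UNIV. L i)"
        using x by (simp add: sum_distrib_right[symmetric] divide_le_eq)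
    qed
    then show ?thesis using le_less_trans by fastforce
  qed
  with C1 ae show ?thesis by blast
qed

end
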